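(* Let $R\to S$ be a homomorphism of commutative rings and $M$ an $R$-module. Then: (1) If $R\to S$ is pure and $S\otimes_R M$ is an intersection flat $S$-module, then $M$ is an intersection flat $R$-module. (2) If $R\to S$ is cyclically pure, $M$ is flat and $S\otimes_R M$ is an Ohm-Rush $S$-module, then $M$ is an Ohm-Rush $R$-module.
   Context: A map of $R$-modules $M\to N$ is pure (resp. cyclically pure) if for every $R$-module (resp. every cyclic $R$-module) $P$ the induced map $M\otimes_R P\to N\otimes_R P$ is injective. A ring homomorphism $R\to S$ is pure (resp. cyclically pure) if it is so as a map of $R$-modules. If $U\subseteq L$ is a submodule of an $R$-module, $UM$ denotes the image of $U\otimes_R M\to L\otimes_R M$. An $R$-module $M$ is intersection flat if for every finitely generated $R$-module $L$ and every collection $\{U_i\}_{i\in\Lambda}$ of submodules of $L$ one has $\left(\bigcap_iU_i\right)M=\bigcap_i(U_iM)$. For $x\in M$, the content $c_M(x)$ is the intersection of all ideals $I$ of $R$ with $x\in IM$. $M$ is an Ohm-Rush $R$-module if $x\in c_M(x)M$ for all $x\in M$. These notions apply to $S$-modules by replacing $R$ by $S$. *)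

theory Defs
  imports "HOL-Algebra.Free_Abelian_Groups" "HOL-Algebra.Module" "HOL-Algebra.RingHom" "HOL-Algebra.Generated_Groups"
begin

section \<open>Tensor products\<close>

text \<open>
  The tensor product of \<open>M\<close> and \<open>N\<close> over \<open>R\<close> is the free abelian group on
  \<open>carrier M \<times> carrier N\<close> modulo the subgroup generated by the bilinearity and balancing
  relations, so its elements are cosets.
\<close>

definition tensor_rels ::
  "('r, 'x) ring_scheme \<Rightarrow> ('r, 'm, 'y) module_scheme \<Rightarrow> ('r, 'n, 'z) module_scheme \<Rightarrow>
   ('m \<times> 'n \<Rightarrow>\<^sub>0 int) set"
  where "tensor_rels R M N =
    {frag_of (x \<oplus>\<^bsub>M\<^esub> x', y) - frag_of (x, y) - frag_of (x', y) | x x' y.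
       x \<in> carrier M \<and> x' \<in> carrier M \<and> y \<in> carrier N} \<union>
    {frag_of (x, y \<oplus>\<^bsub>N\<^esub> y') - frag_of (x, y) - frag_of (x, y') | x y y'.
       x \<in> carrier M \<and> y \<in> carrier N \<and> y' \<in> carrier N} \<union>
    {frag_of (r \<odot>\<^bsub>M\<^esub> x, y) - frag_of (x, r \<odot>\<^bsub>N\<^esub> y) | r x y.
       r \<in> carrier R \<and> x \<in> carrier M \<and> y \<in> carrier N}"

definition tensor_kernel ::
  "('r, 'x) ring_scheme \<Rightarrow> ('r, 'm, 'y) module_scheme \<Rightarrow> ('r, 'n, 'z) module_scheme \<Rightarrow>
   ('m \<times> 'n \<Rightarrow>\<^sub>0 int) set"
  where "tensor_kernel R M N =
    generate (free_Abelian_group (carrier M \<times> carrier N)) (tensor_rels R M N)"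

definition tensor_coset ::
  "('r, 'x) ring_scheme \<Rightarrow> ('r, 'm, 'y) module_scheme \<Rightarrow> ('r, 'n, 'z) module_scheme \<Rightarrow>
   ('m \<times> 'n \<Rightarrow>\<^sub>0 int) \<Rightarrow> ('m \<times> 'n \<Rightarrow>\<^sub>0 int) set"
  where "tensor_coset R M N c =
    tensor_kernel R M N #>\<^bsub>free_Abelian_group (carrier M \<times> carrier N)\<^esub> c"

definition pure_tensor ::
  "('r, 'x) ring_scheme \<Rightarrow> ('r, 'm, 'y) module_scheme \<Rightarrow> ('r, 'n, 'z) module_scheme \<Rightarrow>
   'm \<Rightarrow> 'n \<Rightarrow> ('m \<times> 'n \<Rightarrow>\<^sub>0 int) set"
  where "pure_tensor R M N x y = tensor_coset R M N (frag_of (x, y))"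

text \<open>
  The map \<open>g \<otimes> h\<close> from \<open>M \<otimes> N\<close> to \<open>M' \<otimes> N'\<close>. The union is over all representatives of a
  coset; for linear \<open>g\<close> and \<open>h\<close> they all give the same coset, see \<open>tensor_map_coset\<close> below.
\<close>

definition tensor_map ::
  "('r, 'x) ring_scheme \<Rightarrow> ('r, 'm, 'y) module_scheme \<Rightarrow> ('r, 'n, 'z) module_scheme \<Rightarrow>
   ('r, 'm1, 'y1) module_scheme \<Rightarrow> ('r, 'n1, 'z1) module_scheme \<Rightarrow>
   ('m \<Rightarrow> 'm1) \<Rightarrow> ('n \<Rightarrow> 'n1) \<Rightarrow> ('m \<times> 'n \<Rightarrow>\<^sub>0 int) set \<Rightarrow> ('m1 \<times> 'n1 \<Rightarrow>\<^sub>0 int) set"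
  where "tensor_map R M N M' N' g h X =
    (\<Union>c\<in>X. tensor_coset R M' N' (frag_extend (\<lambda>(x, y). frag_of (g x, h y)) c))"

text \<open>
  \<open>M \<otimes>\<^sub>R N\<close> with scalars acting through the first factor by \<open>act\<close>. The record type forces a
  ring multiplication and a unit on the module; these two fields are irrelevant.
\<close>

definition tensor_by ::
  "('a \<Rightarrow> 'm \<Rightarrow> 'm) \<Rightarrow>
   ('r, 'x) ring_scheme \<Rightarrow> ('r, 'm, 'y) module_scheme \<Rightarrow> ('r, 'n, 'z) module_scheme \<Rightarrow>
   ('a, ('m \<times> 'n \<Rightarrow>\<^sub>0 int) set) module"
  where "tensor_by act R M N =
    (let Q = free_Abelian_group (carrier M \<times> carrier N) Mod tensor_kernel R M N in
     \<lparr>carrier = carrier Q, mult = (\<lambda>_ _. one Q), one = one Q, zero = one Q, add = monoid.mult Q,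
      smult = (\<lambda>a. tensor_map R M N M N (act a) (\<lambda>y. y))\<rparr>)"

definition tensor ::
  "('r, 'x) ring_scheme \<Rightarrow> ('r, 'm, 'y) module_scheme \<Rightarrow> ('r, 'n, 'z) module_scheme \<Rightarrow>
   ('r, ('m \<times> 'n \<Rightarrow>\<^sub>0 int) set) module"
  where "tensor R M N = tensor_by (smult M) R M N"

text \<open>\<open>S\<close> as a module over \<open>R\<close> along \<open>f\<close>; in particular \<open>alg_module R (\<lambda>r. r)\<close> is \<open>R\<close> over itself.\<close>

definition alg_module :: "('s, 'y) ring_scheme \<Rightarrow> ('r \<Rightarrow> 's) \<Rightarrow> ('r, 's) module"
  where "alg_module S f =
    \<lparr>carrier = carrier S, mult = monoid.mult S, one = one S, zero = zero S, add = add S,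
     smult = (\<lambda>r s. f r \<otimes>\<^bsub>S\<^esub> s)\<rparr>"

definition base_change ::
  "('r, 'x) ring_scheme \<Rightarrow> ('s, 'y) ring_scheme \<Rightarrow> ('r \<Rightarrow> 's) \<Rightarrow> ('r, 'm, 'z) module_scheme \<Rightarrow>
   ('s, ('s \<times> 'm \<Rightarrow>\<^sub>0 int) set) module"
  where "base_change R S f M = tensor_by (monoid.mult S) R (alg_module S f) M"

definition lin_maps ::
  "('r, 'x) ring_scheme \<Rightarrow> ('r, 'm, 'y) module_scheme \<Rightarrow> ('r, 'n, 'z) module_scheme \<Rightarrow> ('m \<Rightarrow> 'n) set"
  where "lin_maps R M N =
    {g \<in> carrier M \<rightarrow> carrier N.
       (\<forall>x\<in>carrier M. \<forall>y\<in>carrier M. g (x \<oplus>\<^bsub>M\<^esub> y) = g x \<oplus>\<^bsub>N\<^esub> g y) \<and>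
       (\<forall>r\<in>carrier R. \<forall>x\<in>carrier M. g (r \<odot>\<^bsub>M\<^esub> x) = r \<odot>\<^bsub>N\<^esub> g x)}"


section \<open>Purity, flatness, intersection flatness, Ohm-Rush modules\<close>

text \<open>
  HOL cannot quantify over types inside a formula, so each definition that speaks of ``every
  module'' takes the type in which the carriers of the test modules live as an argument.
  The type \<open>'r test_carrier\<close> contains the cosets of submodules of \<open>R\<^sup>n\<close>
  (encoded as functions vanishing from \<open>n\<close> on), hence an isomorphic
  copy of every finitely generated \<open>R\<close>-module. A hypothesis restricted to test modules in this
  type is implied by the one for all modules; a conclusion for all modules needs a free type
  variable as the argument instead.
\<close>

type_synonym 'r test_carrier = "(nat \<Rightarrow> 'r) set"

definition cyclic_module :: "('r, 'x) ring_scheme \<Rightarrow> ('r, 'm, 'y) module_scheme \<Rightarrow> bool"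
  where "cyclic_module R P \<longleftrightarrow>
    (\<exists>x\<in>carrier P. carrier P = (\<lambda>r. r \<odot>\<^bsub>P\<^esub> x) ` carrier R)"

definition fin_gen_module :: "('r, 'x) ring_scheme \<Rightarrow> ('r, 'm, 'y) module_scheme \<Rightarrow> bool"
  where "fin_gen_module R L \<longleftrightarrow>
    (\<exists>G. finite G \<and> G \<subseteq> carrier L \<and>
      carrier L = {(\<Oplus>\<^bsub>L\<^esub>g\<in>G. a g \<odot>\<^bsub>L\<^esub> g) | a. a \<in> G \<rightarrow> carrier R})"

definition pure_map ::
  "'p itself \<Rightarrow> ('r, 'x) ring_scheme \<Rightarrow> ('r, 'm, 'y) module_scheme \<Rightarrow> ('r, 'n, 'z) module_scheme \<Rightarrow>
   ('m \<Rightarrow> 'n) \<Rightarrow> bool"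
  where "pure_map _ R M N g \<longleftrightarrow>
    (\<forall>P :: ('r, 'p) module. module R P \<longrightarrow>
      inj_on (tensor_map R M P N P g (\<lambda>p. p)) (carrier (tensor R M P)))"

definition cyclically_pure_map ::
  "'p itself \<Rightarrow> ('r, 'x) ring_scheme \<Rightarrow> ('r, 'm, 'y) module_scheme \<Rightarrow> ('r, 'n, 'z) module_scheme \<Rightarrow>
   ('m \<Rightarrow> 'n) \<Rightarrow> bool"
  where "cyclically_pure_map _ R M N g \<longleftrightarrow>
    (\<forall>P :: ('r, 'p) module. module R P \<and> cyclic_module R P \<longrightarrow>
      inj_on (tensor_map R M P N P g (\<lambda>p. p)) (carrier (tensor R M P)))"

definition pure_ring_hom ::
  "'p itself \<Rightarrow> ('r, 'x) ring_scheme \<Rightarrow> ('s, 'y) ring_scheme \<Rightarrow> ('r \<Rightarrow> 's) \<Rightarrow> bool"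
  where "pure_ring_hom T R S f \<longleftrightarrow> pure_map T R (alg_module R (\<lambda>r. r)) (alg_module S f) f"

definition cyclically_pure_ring_hom ::
  "'p itself \<Rightarrow> ('r, 'x) ring_scheme \<Rightarrow> ('s, 'y) ring_scheme \<Rightarrow> ('r \<Rightarrow> 's) \<Rightarrow> bool"
  where "cyclically_pure_ring_hom T R S f \<longleftrightarrow>
    cyclically_pure_map T R (alg_module R (\<lambda>r. r)) (alg_module S f) f"

definition flat_module ::
  "'p itself \<Rightarrow> ('r, 'x) ring_scheme \<Rightarrow> ('r, 'm, 'y) module_scheme \<Rightarrow> bool"
  where "flat_module _ R M \<longleftrightarrow>
    (\<forall>(N :: ('r, 'p) module) (N' :: ('r, 'p) module) g.
      module R N \<and> module R N' \<and> g \<in> lin_maps R N N' \<and> inj_on g (carrier N) \<longrightarrow>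
      inj_on (tensor_map R N M N' M g (\<lambda>x. x)) (carrier (tensor R N M)))"

text \<open>\<open>UM\<close>, the image of \<open>U \<otimes> M\<close> in \<open>L \<otimes> M\<close>, for a submodule \<open>U\<close> of \<open>L\<close>.\<close>

definition submodule_times ::
  "('r, 'x) ring_scheme \<Rightarrow> ('r, 'l, 'y) module_scheme \<Rightarrow> 'l set \<Rightarrow> ('r, 'm, 'z) module_scheme \<Rightarrow>
   ('l \<times> 'm \<Rightarrow>\<^sub>0 int) set set"
  where "submodule_times R L U M =
    tensor_map R (L\<lparr>carrier := U\<rparr>) M L M (\<lambda>u. u) (\<lambda>x. x) ` carrier (tensor R (L\<lparr>carrier := U\<rparr>) M)"

text \<open>
  The intersection of the empty collection of submodules of \<open>L\<close> is \<open>L\<close>, whence the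
  intersections with the carriers.
\<close>

definition intersection_flat ::
  "'l itself \<Rightarrow> ('r, 'x) ring_scheme \<Rightarrow> ('r, 'm, 'y) module_scheme \<Rightarrow> bool"
  where "intersection_flat _ R M \<longleftrightarrow>
    (\<forall>(L :: ('r, 'l) module) \<U>.
      module R L \<and> fin_gen_module R L \<and> (\<forall>U\<in>\<U>. submodule U R L) \<longrightarrow>
      submodule_times R L (carrier L \<inter> \<Inter>\<U>) M =
        carrier (tensor R L M) \<inter> (\<Inter>U\<in>\<U>. submodule_times R L U M))"

text \<open>
  For an ideal \<open>I\<close>, \<open>IM\<close> is regarded as a subset of \<open>M\<close>; \<open>ideal_times_eq\<close> below identifies it
  with \<open>submodule_times\<close> along the isomorphism of \<open>R \<otimes> M\<close> with \<open>M\<close>.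
\<close>

definition ideal_times :: "'r set \<Rightarrow> ('r, 'm, 'y) module_scheme \<Rightarrow> 'm set"
  where "ideal_times I M =
    generate (add_monoid M) {a \<odot>\<^bsub>M\<^esub> x | a x. a \<in> I \<and> x \<in> carrier M}"

definition content :: "('r, 'x) ring_scheme \<Rightarrow> ('r, 'm, 'y) module_scheme \<Rightarrow> 'm \<Rightarrow> 'r set"
  where "content R M x = \<Inter>{I. ideal I R \<and> x \<in> ideal_times I M}"

definition ohm_rush :: "('r, 'x) ring_scheme \<Rightarrow> ('r, 'm, 'y) module_scheme \<Rightarrow> bool"
  where "ohm_rush R M \<longleftrightarrow> (\<forall>x\<in>carrier M. x \<in> ideal_times (content R M x) M)"


section \<open>Well-definedness\<close>

lemma tensor_rels_keys:
  assumes "module R M" "module R N" "c \<in> tensor_rels R M N"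
  shows "Poly_Mapping.keys c \<subseteq> carrier M \<times> carrier N"
proof -
  interpret M: module R M by fact
  interpret N: module R N by fact
  have keys3: "Poly_Mapping.keys (frag_of a - frag_of b - frag_of d) \<subseteq> {a, b, d}"
    and keys2: "Poly_Mapping.keys (frag_of a - frag_of b) \<subseteq> {a, b}" for a b d :: "'c \<times> 'e"
    using keys_diff[of "frag_of a - frag_of b" "frag_of d"] keys_diff[of "frag_of a" "frag_of b"]
    by auto
  consider
    (1) x x' y where "c = frag_of (x \<oplus>\<^bsub>M\<^esub> x', y) - frag_of (x, y) - frag_of (x', y)"
       "x \<in> carrier M" "x' \<in> carrier M" "y \<in> carrier N"
  | (2) x y y' where "c = frag_of (x, y \<oplus>\<^bsub>N\<^esub> y') - frag_of (x, y) - frag_of (x, y')"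
       "x \<in> carrier M" "y \<in> carrier N" "y' \<in> carrier N"
  | (3) r x y where "c = frag_of (r \<odot>\<^bsub>M\<^esub> x, y) - frag_of (x, r \<odot>\<^bsub>N\<^esub> y)"
       "r \<in> carrier R" "x \<in> carrier M" "y \<in> carrier N"
    using assms(3) unfolding tensor_rels_def by blast
  then show ?thesis
  proof cases
    case (1 x x' y)
    then show ?thesis
      unfolding 1(1) by (intro order_trans[OF keys3]) auto
  next
    case (2 x y y')
    then show ?thesis
      unfolding 2(1) by (intro order_trans[OF keys3]) auto
  next
    case (3 r x y)
    then show ?thesis
      unfolding 3(1) by (intro order_trans[OF keys2]) auto
  qed
qed

lemma tensor_kernel_subgroup:
  assumes "module R M" "module R N"
  shows "subgroup (tensor_kernel R M N) (free_Abelian_group (carrier M \<times> carrier N))"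
  unfolding tensor_kernel_def
  using tensor_rels_keys[OF assms] by (intro group.generate_is_subgroup) auto

lemma tensor_kernel_normal:
  assumes "module R M" "module R N"
  shows "tensor_kernel R M N \<lhd> free_Abelian_group (carrier M \<times> carrier N)"
  by (intro comm_group.subgroup_imp_normal abelian_free_Abelian_group tensor_kernel_subgroup assms)

lemma tensor_kernel_closed:
  assumes "module R M" "module R N"
  shows "0 \<in> tensor_kernel R M N"
    and "c \<in> tensor_kernel R M N \<Longrightarrow> - c \<in> tensor_kernel R M N"
    and "c \<in> tensor_kernel R M N \<Longrightarrow> d \<in> tensor_kernel R M N \<Longrightarrow> c + d \<in> tensor_kernel R M N"
    and "c \<in> tensor_kernel R M N \<Longrightarrow> d \<in> tensor_kernel R M N \<Longrightarrow> c - d \<in> tensor_kernel R M N"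
    and "c \<in> tensor_kernel R M N \<Longrightarrow> Poly_Mapping.keys c \<subseteq> carrier M \<times> carrier N"
proof -
  let ?F = "free_Abelian_group (carrier M \<times> carrier N)"
  interpret K: subgroup "tensor_kernel R M N" ?F
    by (rule tensor_kernel_subgroup[OF assms])
  show keys: "Poly_Mapping.keys c \<subseteq> carrier M \<times> carrier N" if "c \<in> tensor_kernel R M N" for c
    using K.mem_carrier[OF that] by simp
  show "0 \<in> tensor_kernel R M N"
    using K.one_closed by simp
  show uminus: "- c \<in> tensor_kernel R M N" if "c \<in> tensor_kernel R M N" for c
    using K.m_inv_closed[OF that] keys[OF that] by simp
  show plus: "c + d \<in> tensor_kernel R M N"
    if "c \<in> tensor_kernel R M N" "d \<in> tensor_kernel R M N" for c d
    using K.m_closed[OF that] by simp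
  show "c - d \<in> tensor_kernel R M N"
    if "c \<in> tensor_kernel R M N" "d \<in> tensor_kernel R M N"
    using plus[OF that(1) uminus[OF that(2)]] by simp
qed

lemma tensor_coset_altdef: "tensor_coset R M N c = (\<lambda>k. k + c) ` tensor_kernel R M N"
  unfolding tensor_coset_def r_coset_def mult_free_Abelian_group by blast

lemma tensor_coset_eq_iff:
  assumes "module R M" "module R N"
  shows "tensor_coset R M N c = tensor_coset R M N d \<longleftrightarrow> c - d \<in> tensor_kernel R M N"
proof
  assume "tensor_coset R M N c = tensor_coset R M N d"
  moreover have "c \<in> tensor_coset R M N c"
    unfolding tensor_coset_altdef
    by (rule image_eqI[OF _ tensor_kernel_closed(1)[OF assms]]) simp
  ultimately have "c \<in> tensor_coset R M N d"
    by (rule subst)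
  then obtain k where "k \<in> tensor_kernel R M N" "c = k + d"
    unfolding tensor_coset_altdef by blast
  then show "c - d \<in> tensor_kernel R M N"
    by simp
next
  assume *: "c - d \<in> tensor_kernel R M N"
  have "k + c \<in> (\<lambda>k. k + d) ` tensor_kernel R M N" if "k \<in> tensor_kernel R M N" for k
    by (rule image_eqI[OF _ tensor_kernel_closed(3)[OF assms that *]]) simp
  moreover have "k + d \<in> (\<lambda>k. k + c) ` tensor_kernel R M N" if "k \<in> tensor_kernel R M N" for k
    by (rule image_eqI[OF _ tensor_kernel_closed(4)[OF assms that *]]) simp
  ultimately show "tensor_coset R M N c = tensor_coset R M N d"
    unfolding tensor_coset_altdef by blast
qed

lemma frag_map_keys:
  assumes "g \<in> lin_maps R M M'" "h \<in> lin_maps R N N'"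
    and "Poly_Mapping.keys c \<subseteq> carrier M \<times> carrier N"
  shows "Poly_Mapping.keys (frag_extend (\<lambda>(x, y). frag_of (g x, h y)) c) \<subseteq> carrier M' \<times> carrier N'"
proof
  fix p assume "p \<in> Poly_Mapping.keys (frag_extend (\<lambda>(x, y). frag_of (g x, h y)) c)"
  then obtain q where q: "q \<in> Poly_Mapping.keys c"
    "p \<in> Poly_Mapping.keys ((\<lambda>(x, y). frag_of (g x, h y)) q)"
    using keys_frag_extend[of "\<lambda>(x, y). frag_of (g x, h y)" c] by blast
  obtain x y where xy: "q = (x, y)" by fastforce
  with q(2) have "p = (g x, h y)" by simp
  moreover have "x \<in> carrier M" "y \<in> carrier N" using q(1) xy assms(3) by auto
  ultimately show "p \<in> carrier M' \<times> carrier N'"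
    using assms(1,2) by (auto simp: lin_maps_def)
qed

lemma frag_map_rels:
  assumes "module R M" "module R N" "g \<in> lin_maps R M M'" "h \<in> lin_maps R N N'"
    and "c \<in> tensor_rels R M N"
  shows "frag_extend (\<lambda>(x, y). frag_of (g x, h y)) c \<in> tensor_rels R M' N'"
proof -
  interpret M: module R M by fact
  interpret N: module R N by fact
  have g: "g x \<in> carrier M'" "g (x \<oplus>\<^bsub>M\<^esub> x') = g x \<oplus>\<^bsub>M'\<^esub> g x'" "g (r \<odot>\<^bsub>M\<^esub> x) = r \<odot>\<^bsub>M'\<^esub> g x"
    if "x \<in> carrier M" "x' \<in> carrier M" "r \<in> carrier R" for r x x'
    using assms(3) that by (auto simp: lin_maps_def)
  have h: "h x \<in> carrier N'" "h (x \<oplus>\<^bsub>N\<^esub> x') = h x \<oplus>\<^bsub>N'\<^esub> h x'" "h (r \<odot>\<^bsub>N\<^esub> x) = r \<odot>\<^bsub>N'\<^esub> h x"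
    if "x \<in> carrier N" "x' \<in> carrier N" "r \<in> carrier R" for r x x'
    using assms(4) that by (auto simp: lin_maps_def)
  have R0: "\<zero>\<^bsub>R\<^esub> \<in> carrier R" by simp
  consider
    (1) x x' y where "c = frag_of (x \<oplus>\<^bsub>M\<^esub> x', y) - frag_of (x, y) - frag_of (x', y)"
       "x \<in> carrier M" "x' \<in> carrier M" "y \<in> carrier N"
  | (2) x y y' where "c = frag_of (x, y \<oplus>\<^bsub>N\<^esub> y') - frag_of (x, y) - frag_of (x, y')"
       "x \<in> carrier M" "y \<in> carrier N" "y' \<in> carrier N"
  | (3) r x y where "c = frag_of (r \<odot>\<^bsub>M\<^esub> x, y) - frag_of (x, r \<odot>\<^bsub>N\<^esub> y)"
       "r \<in> carrier R" "x \<in> carrier M" "y \<in> carrier N"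
    using assms(5) unfolding tensor_rels_def by blast
  then show ?thesis
  proof cases
    case (1 x x' y)
    have "frag_extend (\<lambda>(x, y). frag_of (g x, h y)) c =
      frag_of (g x \<oplus>\<^bsub>M'\<^esub> g x', h y) - frag_of (g x, h y) - frag_of (g x', h y)"
      using 1 g(2)[OF 1(2,3) R0] by (simp add: frag_extend_diff)
    then show ?thesis
      using g(1)[OF 1(2) 1(2) R0] g(1)[OF 1(3) 1(3) R0] h(1)[OF 1(4) 1(4) R0]
      unfolding tensor_rels_def by blast
  next
    case (2 x y y')
    have "frag_extend (\<lambda>(x, y). frag_of (g x, h y)) c =
      frag_of (g x, h y \<oplus>\<^bsub>N'\<^esub> h y') - frag_of (g x, h y) - frag_of (g x, h y')"
      using 2 h(2)[OF 2(3,4) R0] by (simp add: frag_extend_diff)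
    then show ?thesis
      using g(1)[OF 2(2) 2(2) R0] h(1)[OF 2(3) 2(3) R0] h(1)[OF 2(4) 2(4) R0]
      unfolding tensor_rels_def by blast
  next
    case (3 r x y)
    have "frag_extend (\<lambda>(x, y). frag_of (g x, h y)) c =
      frag_of (r \<odot>\<^bsub>M'\<^esub> g x, h y) - frag_of (g x, r \<odot>\<^bsub>N'\<^esub> h y)"
      using 3 g(3)[OF 3(3,3,2)] h(3)[OF 3(4,4,2)] by (simp add: frag_extend_diff)
    then show ?thesis
      using g(1)[OF 3(3,3,2)] h(1)[OF 3(4,4,2)] 3(2)
      unfolding tensor_rels_def by blast
  qed
qed

lemma frag_map_kernel:
  assumes "module R M" "module R N" "module R M'" "module R N'"
    and "g \<in> lin_maps R M M'" "h \<in> lin_maps R N N'"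
    and "c \<in> tensor_kernel R M N"
  shows "frag_extend (\<lambda>(x, y). frag_of (g x, h y)) c \<in> tensor_kernel R M' N'"
  using assms(7) unfolding tensor_kernel_def[of R M N]
proof (induction rule: generate.induct)
  case one
  then show ?case using tensor_kernel_closed(1)[OF assms(3,4)] by simp
next
  case (incl c)
  then show ?case
    using frag_map_rels[OF assms(1,2,5,6)] by (auto simp: tensor_kernel_def intro: generate.incl)
next
  case (inv c)
  then have "frag_extend (\<lambda>(x, y). frag_of (g x, h y)) c \<in> tensor_kernel R M' N'"
    using frag_map_rels[OF assms(1,2,5,6)] by (auto simp: tensor_kernel_def intro: generate.incl)
  then show ?case
    using inv tensor_rels_keys[OF assms(1,2) inv] tensor_kernel_closed(2)[OF assms(3,4)]
    by (simp add: frag_extend_minus)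
next
  case (eng c d)
  then show ?case
    using tensor_kernel_closed(3)[OF assms(3,4)] by (simp add: frag_extend_add)
qed

lemma tensor_map_coset:
  assumes "module R M" "module R N" "module R M'" "module R N'"
    and "g \<in> lin_maps R M M'" "h \<in> lin_maps R N N'"
  shows "tensor_map R M N M' N' g h (tensor_coset R M N c) =
    tensor_coset R M' N' (frag_extend (\<lambda>(x, y). frag_of (g x, h y)) c)"
proof -
  let ?h = "frag_extend (\<lambda>(x, y). frag_of (g x, h y))"
  have "tensor_coset R M' N' (?h d) = tensor_coset R M' N' (?h c)"
    if "d \<in> tensor_coset R M N c" for d
  proof -
    from that have "d - c \<in> tensor_kernel R M N"
      by (auto simp: tensor_coset_altdef)
    from frag_map_kernel[OF assms this] show ?thesis
      by (simp add: tensor_coset_eq_iff[OF assms(3,4)] frag_extend_diff)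
  qed
  moreover have "tensor_coset R M N c \<noteq> {}"
    using tensor_kernel_closed(1)[OF assms(1,2)] by (auto simp: tensor_coset_altdef)
  ultimately show ?thesis
    unfolding tensor_map_def by blast
qed

lemma tensor_map_pure_tensor:
  assumes "module R M" "module R N" "module R M'" "module R N'"
    and "g \<in> lin_maps R M M'" "h \<in> lin_maps R N N'"
  shows "tensor_map R M N M' N' g h (pure_tensor R M N x y) = pure_tensor R M' N' (g x) (h y)"
  using tensor_map_coset[OF assms] by (simp add: pure_tensor_def)

lemma tensor_by_simps:
  assumes "module R M" "module R N"
  shows "carrier (tensor_by act R M N) =
      tensor_coset R M N ` {c. Poly_Mapping.keys c \<subseteq> carrier M \<times> carrier N}"
    and "zero (tensor_by act R M N) = tensor_coset R M N 0"
    and "Poly_Mapping.keys c \<subseteq> carrier M \<times> carrier N \<Longrightarrow>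
      Poly_Mapping.keys d \<subseteq> carrier M \<times> carrier N \<Longrightarrow>
      tensor_coset R M N c \<oplus>\<^bsub>tensor_by act R M N\<^esub> tensor_coset R M N d = tensor_coset R M N (c + d)"
    and "act a \<in> lin_maps R M M \<Longrightarrow>
      a \<odot>\<^bsub>tensor_by act R M N\<^esub> tensor_coset R M N c =
      tensor_coset R M N (frag_extend (\<lambda>(x, y). frag_of (act a x, y)) c)"
proof -
  show "carrier (tensor_by act R M N) =
      tensor_coset R M N ` {c. Poly_Mapping.keys c \<subseteq> carrier M \<times> carrier N}"
    by (auto simp: tensor_by_def Let_def FactGroup_def RCOSETS_def tensor_coset_def)
  show "zero (tensor_by act R M N) = tensor_coset R M N 0"
    by (auto simp: tensor_by_def Let_def tensor_coset_altdef)
  show "tensor_coset R M N c \<oplus>\<^bsub>tensor_by act R M N\<^esub> tensor_coset R M N d = tensor_coset R M N (c + d)"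
    if "Poly_Mapping.keys c \<subseteq> carrier M \<times> carrier N" "Poly_Mapping.keys d \<subseteq> carrier M \<times> carrier N"
    using that normal.rcos_sum[OF tensor_kernel_normal[OF assms], of c d]
    by (simp add: tensor_by_def Let_def FactGroup_def tensor_coset_def)
  show "a \<odot>\<^bsub>tensor_by act R M N\<^esub> tensor_coset R M N c =
      tensor_coset R M N (frag_extend (\<lambda>(x, y). frag_of (act a x, y)) c)"
    if "act a \<in> lin_maps R M M"
  proof -
    have "(\<lambda>y. y) \<in> lin_maps R N N" by (auto simp: lin_maps_def)
    from tensor_map_coset[OF assms assms that this] show ?thesis
      by (simp add: tensor_by_def Let_def)
  qed
qed

lemma tensor_kernel_rels:
  assumes "module R M" "module R N"
  shows "x \<in> carrier M \<Longrightarrow> x' \<in> carrier M \<Longrightarrow> y \<in> carrier N \<Longrightarrow>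
      frag_of (x \<oplus>\<^bsub>M\<^esub> x', y) - frag_of (x, y) - frag_of (x', y) \<in> tensor_kernel R M N"
    and "x \<in> carrier M \<Longrightarrow> y \<in> carrier N \<Longrightarrow> y' \<in> carrier N \<Longrightarrow>
      frag_of (x, y \<oplus>\<^bsub>N\<^esub> y') - frag_of (x, y) - frag_of (x, y') \<in> tensor_kernel R M N"
    and "r \<in> carrier R \<Longrightarrow> x \<in> carrier M \<Longrightarrow> y \<in> carrier N \<Longrightarrow>
      frag_of (r \<odot>\<^bsub>M\<^esub> x, y) - frag_of (x, r \<odot>\<^bsub>N\<^esub> y) \<in> tensor_kernel R M N"
  unfolding tensor_kernel_def tensor_rels_def by (rule generate.incl; blast)+

lemma tensor_by_module:
  assumes M: "module R M" and N: "module R N" and A: "cring A"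
    and lin: "\<And>a. a \<in> carrier A \<Longrightarrow> act a \<in> lin_maps R M M"
    and add: "\<And>a b x. a \<in> carrier A \<Longrightarrow> b \<in> carrier A \<Longrightarrow> x \<in> carrier M \<Longrightarrow>
      act (a \<oplus>\<^bsub>A\<^esub> b) x = act a x \<oplus>\<^bsub>M\<^esub> act b x"
    and mult: "\<And>a b x. a \<in> carrier A \<Longrightarrow> b \<in> carrier A \<Longrightarrow> x \<in> carrier M \<Longrightarrow>
      act (a \<otimes>\<^bsub>A\<^esub> b) x = act a (act b x)"
    and one: "\<And>x. x \<in> carrier M \<Longrightarrow> act \<one>\<^bsub>A\<^esub> x = x"
  shows "module A (tensor_by act R M N)"
proof -
  interpret A: cring A by fact
  let ?C = "carrier M \<times> carrier N"
  let ?h = "\<lambda>a. frag_extend (\<lambda>(x, y). frag_of (act a x, y))"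
  note simps = tensor_by_simps[OF M N]
  have idN: "(\<lambda>y. y) \<in> lin_maps R N N" by (auto simp: lin_maps_def)
  have keys_h: "Poly_Mapping.keys (?h a c) \<subseteq> ?C"
    if "a \<in> carrier A" "Poly_Mapping.keys c \<subseteq> ?C" for a c
    using frag_map_keys[OF lin[OF that(1)] idN that(2)] .
  have keys_add: "Poly_Mapping.keys (c + d) \<subseteq> ?C"
    if "Poly_Mapping.keys c \<subseteq> ?C" "Poly_Mapping.keys d \<subseteq> ?C" for c d :: "'c \<times> 'e \<Rightarrow>\<^sub>0 int"
    using that keys_add[of c d] by blast
  have act_closed: "act a x \<in> carrier M" if "a \<in> carrier A" "x \<in> carrier M" for a x
    using lin[OF that(1)] that(2) by (auto simp: lin_maps_def)
  note eqI = tensor_coset_eq_iff[OF M N, THEN iffD2]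
  note K = tensor_kernel_closed[OF M N]
  show ?thesis
  proof (rule moduleI)
    show "cring A" by fact
    show "abelian_group (tensor_by act R M N)"
    proof (rule abelian_groupI)
      fix X assume "X \<in> carrier (tensor_by act R M N)"
      then obtain c where c: "X = tensor_coset R M N c" "Poly_Mapping.keys c \<subseteq> ?C"
        by (auto simp: simps)
      have "tensor_coset R M N (- c) \<oplus>\<^bsub>tensor_by act R M N\<^esub> X = \<zero>\<^bsub>tensor_by act R M N\<^esub>"
        using c by (simp add: simps)
      moreover have "tensor_coset R M N (- c) \<in> carrier (tensor_by act R M N)"
        using c by (auto simp: simps)
      ultimately show "\<exists>Y\<in>carrier (tensor_by act R M N).
          Y \<oplus>\<^bsub>tensor_by act R M N\<^esub> X = \<zero>\<^bsub>tensor_by act R M N\<^esub>"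
        by blast
    qed (auto simp: simps algebra_simps keys_add intro!: imageI dest!: subsetD[OF Poly_Mapping.keys_add])
  next
    fix a X assume "a \<in> carrier A" "X \<in> carrier (tensor_by act R M N)"
    then show "a \<odot>\<^bsub>tensor_by act R M N\<^esub> X \<in> carrier (tensor_by act R M N)"
      using keys_h by (auto simp: simps lin)
  next
    fix a b X assume *: "a \<in> carrier A" "b \<in> carrier A" "X \<in> carrier (tensor_by act R M N)"
    then obtain c where c: "X = tensor_coset R M N c" "Poly_Mapping.keys c \<subseteq> ?C"
      by (auto simp: simps)
    have "?h (a \<oplus>\<^bsub>A\<^esub> b) c - (?h a c + ?h b c) \<in> tensor_kernel R M N"
      using c(2)
    proof (induction rule: frag_induction)
      case (one p)
      then show ?case
        using tensor_kernel_rels(1)[OF M N] * act_closed add by (auto simp: diff_diff_eq[symmetric])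
    next
      case (diff c d)
      from K(4)[OF diff] show ?case by (simp add: frag_extend_diff algebra_simps)
    qed (use K in simp)
    then show "(a \<oplus>\<^bsub>A\<^esub> b) \<odot>\<^bsub>tensor_by act R M N\<^esub> X =
        a \<odot>\<^bsub>tensor_by act R M N\<^esub> X \<oplus>\<^bsub>tensor_by act R M N\<^esub> b \<odot>\<^bsub>tensor_by act R M N\<^esub> X"
      using * c keys_h by (simp add: simps lin eqI)
  next
    fix a X Y assume "a \<in> carrier A" "X \<in> carrier (tensor_by act R M N)"
      "Y \<in> carrier (tensor_by act R M N)"
    then show "a \<odot>\<^bsub>tensor_by act R M N\<^esub> (X \<oplus>\<^bsub>tensor_by act R M N\<^esub> Y) =
        a \<odot>\<^bsub>tensor_by act R M N\<^esub> X \<oplus>\<^bsub>tensor_by act R M N\<^esub> a \<odot>\<^bsub>tensor_by act R M N\<^esub> Y"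
      using keys_h by (auto simp: simps lin frag_extend_add)
  next
    fix a b X assume *: "a \<in> carrier A" "b \<in> carrier A" "X \<in> carrier (tensor_by act R M N)"
    then obtain c where c: "X = tensor_coset R M N c" "Poly_Mapping.keys c \<subseteq> ?C"
      by (auto simp: simps)
    have "?h (a \<otimes>\<^bsub>A\<^esub> b) c = ?h a (?h b c)"
      using c(2)
    proof (induction rule: frag_induction)
      case (one p)
      then show ?case using * mult by auto
    qed (simp_all add: frag_extend_diff)
    then show "(a \<otimes>\<^bsub>A\<^esub> b) \<odot>\<^bsub>tensor_by act R M N\<^esub> X =
        a \<odot>\<^bsub>tensor_by act R M N\<^esub> (b \<odot>\<^bsub>tensor_by act R M N\<^esub> X)"
      using * c by (simp add: simps lin)
  next
    fix X assume "X \<in> carrier (tensor_by act R M N)"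
    then obtain c where c: "X = tensor_coset R M N c" "Poly_Mapping.keys c \<subseteq> ?C"
      by (auto simp: simps)
    have "?h \<one>\<^bsub>A\<^esub> c = c"
      using c(2)
    proof (induction rule: frag_induction)
      case (one p)
      then show ?case using assms(7) by auto
    qed (simp_all add: frag_extend_diff)
    then show "\<one>\<^bsub>A\<^esub> \<odot>\<^bsub>tensor_by act R M N\<^esub> X = X"
      using c by (simp add: simps lin)
  qed
qed

lemma tensor_module:
  assumes "module R M" "module R N"
  shows "module R (tensor R M N)"
proof -
  interpret M: module R M by fact
  show ?thesis
    unfolding tensor_def
    by (rule tensor_by_module[OF assms M.R.is_cring])
      (auto simp: lin_maps_def M.smult_l_distr M.smult_r_distr M.smult_assoc1[symmetric] M.R.m_comm)
qed

lemma alg_module_module: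
  assumes "ring_hom_cring R S f"
  shows "module R (alg_module S f)"
proof -
  interpret ring_hom_cring R S f by fact
  show ?thesis
  proof (rule moduleI)
    show "abelian_group (alg_module S f)"
      by (rule abelian_groupI)
        (auto simp: alg_module_def S.a_assoc intro: S.add.l_inv_ex S.a_comm)
  qed (auto simp: alg_module_def R.is_cring S.l_distr S.r_distr S.m_assoc)
qed

lemma base_change_module:
  assumes "ring_hom_cring R S f" "module R M"
  shows "module S (base_change R S f M)"
proof -
  interpret ring_hom_cring R S f by fact
  show ?thesis
    unfolding base_change_def
    by (rule tensor_by_module[OF alg_module_module[OF assms(1)] assms(2) S.is_cring])
      (auto simp: alg_module_def lin_maps_def S.l_distr S.r_distr S.m_assoc S.m_lcomm)
qed

lemma submodule_times_eq:
  assumes "module R L" "module R M" "submodule U R L"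
  shows "submodule_times R L U M = tensor_coset R L M ` {c. Poly_Mapping.keys c \<subseteq> U \<times> carrier M}"
proof -
  have U: "module R (L\<lparr>carrier := U\<rparr>)"
    by (rule submodule.submodule_is_module[OF assms(3,1)])
  have "U \<subseteq> carrier L"
    using module.submoduleE(1)[OF assms(1,3)] .
  then have lin: "(\<lambda>u. u) \<in> lin_maps R (L\<lparr>carrier := U\<rparr>) L" "(\<lambda>x. x) \<in> lin_maps R M M"
    by (auto simp: lin_maps_def)
  have "frag_extend (\<lambda>(x, y). frag_of (x, y)) c = c" for c :: "'c \<times> 'e \<Rightarrow>\<^sub>0 int"
  proof -
    have "(\<lambda>(x, y). frag_of (x, y)) = (frag_of :: 'c \<times> 'e \<Rightarrow> _)" by auto
    then show ?thesis using frag_expansion[of c] by metis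
  qed
  then show ?thesis
    unfolding submodule_times_def tensor_def tensor_by_simps(1)[OF U assms(2)]
    by (simp add: image_image tensor_map_coset[OF U assms(2,1,2) lin])
qed

lemma ideal_times_eq:
  assumes "module R M" "ideal I R" "x \<in> carrier M"
  shows "x \<in> ideal_times I M \<longleftrightarrow>
    pure_tensor R (alg_module R (\<lambda>r. r)) M \<one>\<^bsub>R\<^esub> x \<in>
    submodule_times R (alg_module R (\<lambda>r. r)) I M"
proof -
  interpret M: module R M by fact
  interpret I: ideal I R by fact
  let ?A = "alg_module R (\<lambda>r. r)" and ?C = "carrier R \<times> carrier M"
  let ?K = "tensor_kernel R ?A M"
  have carA [simp]: "carrier ?A = carrier R" by (simp add: alg_module_def)
  have A: "module R ?A"
    by (rule alg_module_module) (simp add: ring_hom_cring_def ring_hom_cring_axioms_def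
        M.R.is_cring ring_hom_def)
  have "submodule I R ?A"
  proof (rule module.submoduleI[OF A])
    have "\<ominus>\<^bsub>?A\<^esub> a = \<ominus>\<^bsub>R\<^esub> a" for a
      by (simp add: a_inv_def m_inv_def alg_module_def)
    then show "\<ominus>\<^bsub>?A\<^esub> a \<in> I" if "a \<in> I" for a
      using I.a_inv_closed that by simp
  qed (use I.a_subset I.I_l_closed in \<open>auto simp: alg_module_def\<close>)
  note times = submodule_times_eq[OF A assms(1) this]
  note K = tensor_kernel_closed[OF A assms(1)] and rels = tensor_kernel_rels[OF A assms(1)]
  have iff: "pure_tensor R ?A M \<one>\<^bsub>R\<^esub> x \<in> submodule_times R ?A I M \<longleftrightarrow>
    (\<exists>c. Poly_Mapping.keys c \<subseteq> I \<times> carrier M \<and> frag_of (\<one>\<^bsub>R\<^esub>, x) - c \<in> ?K)" for x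
    unfolding times pure_tensor_def by (auto simp: tensor_coset_eq_iff[OF A assms(1)])
  let ?G = "{a \<odot>\<^bsub>M\<^esub> x | a x. a \<in> I \<and> x \<in> carrier M}"
  have I_car: "a \<in> carrier R" if "a \<in> I" for a
    using I.a_subset that by blast
  have G: "?G \<subseteq> carrier (add_monoid M)"
    using I_car by auto
  have group_M: "group (add_monoid M)"
    using M.a_group .
  have sub: "subgroup (ideal_times I M) (add_monoid M)"
    unfolding ideal_times_def by (rule group.generate_is_subgroup[OF group_M G])
  have mono: "\<exists>c. Poly_Mapping.keys c \<subseteq> I \<times> carrier M \<and> frag_of (\<one>\<^bsub>R\<^esub>, a \<odot>\<^bsub>M\<^esub> m) - c \<in> ?K"
    if "a \<in> I" "m \<in> carrier M" for a m
  proof -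
    have "frag_of (a, m) - frag_of (\<one>\<^bsub>R\<^esub>, a \<odot>\<^bsub>M\<^esub> m) \<in> ?K"
      using rels(3)[of a "\<one>\<^bsub>R\<^esub>" m] that I_car by (simp add: alg_module_def)
    from K(2)[OF this] show ?thesis
      using that by (intro exI[of _ "frag_of (a, m)"]) simp
  qed
  show ?thesis
  proof
    assume "x \<in> ideal_times I M"
    then have "x \<in> carrier M \<and>
      (\<exists>c. Poly_Mapping.keys c \<subseteq> I \<times> carrier M \<and> frag_of (\<one>\<^bsub>R\<^esub>, x) - c \<in> ?K)"
      unfolding ideal_times_def
    proof (induction rule: generate.induct)
      case one
      have "\<zero>\<^bsub>R\<^esub> \<odot>\<^bsub>M\<^esub> \<zero>\<^bsub>M\<^esub> = \<zero>\<^bsub>M\<^esub>" by simp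
      then show ?case
        using mono[OF I.zero_closed M.M.zero_closed] by simp
    next
      case (incl h)
      then show ?case using mono I_car by auto
    next
      case (inv h)
      then obtain a m where am: "a \<in> I" "m \<in> carrier M" "h = a \<odot>\<^bsub>M\<^esub> m" by blast
      have "inv\<^bsub>add_monoid M\<^esub> h = (\<ominus>\<^bsub>R\<^esub> a) \<odot>\<^bsub>M\<^esub> m"
        using M.smult_l_minus[OF I_car[OF am(1)] am(2)] am(3) by (simp add: a_inv_def)
      then show ?case
        using mono[OF I.a_inv_closed[OF am(1)] am(2)] am I_car by simp
    next
      case (eng y z)
      then obtain c d where cd: "Poly_Mapping.keys c \<subseteq> I \<times> carrier M"
        "frag_of (\<one>\<^bsub>R\<^esub>, y) - c \<in> ?K" "Poly_Mapping.keys d \<subseteq> I \<times> carrier M"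
        "frag_of (\<one>\<^bsub>R\<^esub>, z) - d \<in> ?K" "y \<in> carrier M" "z \<in> carrier M"
        by blast
      have "frag_of (\<one>\<^bsub>R\<^esub>, y \<oplus>\<^bsub>M\<^esub> z) - frag_of (\<one>\<^bsub>R\<^esub>, y) - frag_of (\<one>\<^bsub>R\<^esub>, z) \<in> ?K"
        using cd(5,6) by (intro rels(2)) auto
      from K(3)[OF this K(3)[OF cd(2,4)]]
      have "frag_of (\<one>\<^bsub>R\<^esub>, y \<oplus>\<^bsub>M\<^esub> z) - (c + d) \<in> ?K"
        by (simp add: algebra_simps)
      moreover have "Poly_Mapping.keys (c + d) \<subseteq> I \<times> carrier M"
        using keys_add[of c d] cd(1,3) by blast
      ultimately show ?case
        using cd(5,6) by auto
    qed
    then show "pure_tensor R ?A M \<one>\<^bsub>R\<^esub> x \<in> submodule_times R ?A I M"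
      using iff by blast
  next
    assume "pure_tensor R ?A M \<one>\<^bsub>R\<^esub> x \<in> submodule_times R ?A I M"
    then obtain c where c: "Poly_Mapping.keys c \<subseteq> I \<times> carrier M" "frag_of (\<one>\<^bsub>R\<^esub>, x) - c \<in> ?K"
      using iff by blast
    have "(\<lambda>(r, m). r \<odot>\<^bsub>M\<^esub> m) ` ?C \<subseteq> carrier (add_monoid M)" by auto
    then obtain \<mu> where \<mu>: "\<mu> \<in> hom (free_Abelian_group ?C) (add_monoid M)"
      "\<And>p. p \<in> ?C \<Longrightarrow> \<mu> (frag_of p) = (\<lambda>(r, m). r \<odot>\<^bsub>M\<^esub> m) p"
      using comm_group.free_Abelian_group_universal[OF M.a_comm_group] by metis
    interpret \<mu>: group_hom "free_Abelian_group ?C" "add_monoid M" \<mu>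
      using \<mu>(1) group_M by (simp add: group_hom_def group_hom_axioms_def)
    have \<mu>_closed: "\<mu> a \<in> carrier M" if "Poly_Mapping.keys a \<subseteq> ?C" for a
      using \<mu>.hom_closed[of a] that by simp
    have \<mu>_add: "\<mu> (a + b) = \<mu> a \<oplus>\<^bsub>M\<^esub> \<mu> b"
      if "Poly_Mapping.keys a \<subseteq> ?C" "Poly_Mapping.keys b \<subseteq> ?C" for a b
      using \<mu>.hom_mult[of a b] that by simp
    have \<mu>_minus: "\<mu> (- a) = \<ominus>\<^bsub>M\<^esub> \<mu> a" if "Poly_Mapping.keys a \<subseteq> ?C" for a
      using \<mu>.hom_inv[of a] that by (simp add: a_inv_def)
    have \<mu>_diff: "\<mu> (a - b) = \<mu> a \<ominus>\<^bsub>M\<^esub> \<mu> b"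
      if "Poly_Mapping.keys a \<subseteq> ?C" "Poly_Mapping.keys b \<subseteq> ?C" for a b
      using \<mu>_add[of a "- b"] \<mu>_minus[of b] that by (simp add: a_minus_def)
    have \<mu>_of: "\<mu> (frag_of (r, m)) = r \<odot>\<^bsub>M\<^esub> m" if "r \<in> carrier R" "m \<in> carrier M" for r m
      using \<mu>(2)[of "(r, m)"] that by simp
    have keys_diff': "Poly_Mapping.keys (a - b) \<subseteq> ?C"
      if "Poly_Mapping.keys a \<subseteq> ?C" "Poly_Mapping.keys b \<subseteq> ?C" for a b :: "'a \<times> 'c \<Rightarrow>\<^sub>0 int"
      using keys_diff[of a b] that by blast
    have cancel: "(u \<oplus>\<^bsub>M\<^esub> v) \<ominus>\<^bsub>M\<^esub> u \<ominus>\<^bsub>M\<^esub> v = \<zero>\<^bsub>M\<^esub>" if "u \<in> carrier M" "v \<in> carrier M" for u v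
    proof -
      have "(u \<oplus>\<^bsub>M\<^esub> v) \<ominus>\<^bsub>M\<^esub> u = (v \<oplus>\<^bsub>M\<^esub> u) \<oplus>\<^bsub>M\<^esub> \<ominus>\<^bsub>M\<^esub> u"
        using that by (simp add: a_minus_def M.M.a_comm)
      also have "\<dots> = v" using that by (simp add: M.M.a_assoc M.M.r_neg)
      finally show ?thesis using that by (simp add: a_minus_def M.M.r_neg)
    qed
    have rel0: "\<mu> a = \<zero>\<^bsub>M\<^esub>" if rel: "a \<in> tensor_rels R ?A M" for a
    proof -
      consider
        (1) r s m where "a = frag_of (r \<oplus>\<^bsub>R\<^esub> s, m) - frag_of (r, m) - frag_of (s, m)"
          "r \<in> carrier R" "s \<in> carrier R" "m \<in> carrier M"
      | (2) r m n where "a = frag_of (r, m \<oplus>\<^bsub>M\<^esub> n) - frag_of (r, m) - frag_of (r, n)"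
          "r \<in> carrier R" "m \<in> carrier M" "n \<in> carrier M"
      | (3) r s m where "a = frag_of (r \<otimes>\<^bsub>R\<^esub> s, m) - frag_of (s, r \<odot>\<^bsub>M\<^esub> m)"
          "r \<in> carrier R" "s \<in> carrier R" "m \<in> carrier M"
        using rel unfolding tensor_rels_def by (simp add: alg_module_def) blast
      then show ?thesis
      proof cases
        case (1 r s m)
        have "\<mu> a = (r \<oplus>\<^bsub>R\<^esub> s) \<odot>\<^bsub>M\<^esub> m \<ominus>\<^bsub>M\<^esub> r \<odot>\<^bsub>M\<^esub> m \<ominus>\<^bsub>M\<^esub> s \<odot>\<^bsub>M\<^esub> m"
          unfolding 1(1) using 1(2-4) by (simp add: \<mu>_diff \<mu>_of keys_diff')
        also have "\<dots> = \<zero>\<^bsub>M\<^esub>"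
          using 1(2-4) by (simp add: M.smult_l_distr cancel)
        finally show ?thesis .
      next
        case (2 r m n)
        have "\<mu> a = r \<odot>\<^bsub>M\<^esub> (m \<oplus>\<^bsub>M\<^esub> n) \<ominus>\<^bsub>M\<^esub> r \<odot>\<^bsub>M\<^esub> m \<ominus>\<^bsub>M\<^esub> r \<odot>\<^bsub>M\<^esub> n"
          unfolding 2(1) using 2(2-4) by (simp add: \<mu>_diff \<mu>_of keys_diff')
        also have "\<dots> = \<zero>\<^bsub>M\<^esub>"
          using 2(2-4) by (simp add: M.smult_r_distr cancel)
        finally show ?thesis .
      next
        case (3 r s m)
        have "\<mu> a = (r \<otimes>\<^bsub>R\<^esub> s) \<odot>\<^bsub>M\<^esub> m \<ominus>\<^bsub>M\<^esub> s \<odot>\<^bsub>M\<^esub> (r \<odot>\<^bsub>M\<^esub> m)"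
          unfolding 3(1) using 3(2-4) by (simp add: \<mu>_diff \<mu>_of)
        also have "\<dots> = \<zero>\<^bsub>M\<^esub>"
          using 3(2-4) by (simp add: M.smult_assoc1[symmetric] M.R.m_comm a_minus_def M.M.r_neg)
        finally show ?thesis .
      qed
    qed
    have ker: "\<mu> a = \<zero>\<^bsub>M\<^esub>" if "a \<in> ?K" for a
      using that unfolding tensor_kernel_def carA
    proof (induction rule: generate.induct)
      case one
      then show ?case using \<mu>.hom_one by simp
    next
      case (incl a)
      then show ?case by (rule rel0)
    next
      case (inv a)
      then have "Poly_Mapping.keys a \<subseteq> ?C"
        using tensor_rels_keys[OF A assms(1) inv] by simp
      then show ?case using \<mu>_minus[of a] rel0[OF inv] by simp
    next
      case (eng a b)
      then have "Poly_Mapping.keys a \<subseteq> ?C" "Poly_Mapping.keys b \<subseteq> ?C"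
        using K(5) unfolding tensor_kernel_def carA by blast+
      then show ?case using \<mu>_add eng by simp
    qed
    have IC: "I \<times> carrier M \<subseteq> ?C" using I_car by auto
    have keys_c: "Poly_Mapping.keys c \<subseteq> ?C" using c(1) IC by blast
    have "\<mu> (frag_of (\<one>\<^bsub>R\<^esub>, x) - c) = \<zero>\<^bsub>M\<^esub>" by (rule ker[OF c(2)])
    then have "\<mu> ((frag_of (\<one>\<^bsub>R\<^esub>, x) - c) + c) = \<mu> c"
      using keys_c assms(3) by (subst \<mu>_add) (auto simp: keys_diff' \<mu>_closed)
    then have "x = \<mu> c" using \<mu>_of[of "\<one>\<^bsub>R\<^esub>" x] assms(3) by simp
    moreover have "\<mu> c \<in> ideal_times I M"
      using c(1)
    proof (induction rule: free_Abelian_group_induct[consumes 1, case_names zero diff one])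
      case zero
      then show ?case using \<mu>.hom_one subgroup.one_closed[OF sub] by simp
    next
      case (diff a b)
      then have "\<mu> (a - b) = \<mu> a \<oplus>\<^bsub>M\<^esub> inv\<^bsub>add_monoid M\<^esub> \<mu> b"
        using \<mu>_diff[of a b] IC by (simp add: a_minus_def a_inv_def)
      then show ?case
        using subgroup.m_closed[OF sub diff(3) subgroup.m_inv_closed[OF sub diff(4)]] by simp
    next
      case (one p)
      then obtain a m where "p = (a, m)" "a \<in> I" "m \<in> carrier M" by blast
      then show ?case
        using \<mu>_of[of a m] I_car unfolding ideal_times_def by (auto intro: generate.incl)
    qed
    ultimately show "x \<in> ideal_times I M" by simp
  qed
qed

end

theory Submission
  imports Defs
begin

text \<open>
  Write \<open>M\<^sub>S\<close> for the base change \<open>S \<otimes>\<^sub>R M\<close>. Both halves of the theorem rest on one contraction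
  principle (\<open>flat_contraction\<close>). Let \<open>L\<close> be an \<open>R\<close>-module, \<open>Q\<close> an \<open>S\<close>-module, \<open>h\<close> an \<open>R\<close>-linear map
  from \<open>L\<close> to \<open>Q\<close> and \<open>V\<close> an \<open>S\<close>-submodule of \<open>Q\<close> with preimage \<open>U\<close> in \<open>L\<close>. If \<open>M\<close> is flat and the
  image of \<open>z \<in> L \<otimes> M\<close> in \<open>Q \<otimes>\<^sub>S M\<^sub>S\<close> lies in \<open>V M\<^sub>S\<close>, then \<open>z\<close> lies in \<open>U M\<close>: the group
  \<open>(Q / V) \<otimes>\<^sub>S M\<^sub>S\<close> is \<open>(Q / V) \<otimes>\<^sub>R M\<close>, and by flatness it contains \<open>(L / U) \<otimes>\<^sub>R M\<close>. On the other hand purity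
  says that submodules are contracted from their extensions (\<open>unit_faithful_contraction\<close>): if
  \<open>1 \<otimes> l\<close> lies in the \<open>S\<close>-span of \<open>U\<close> in \<open>S \<otimes> L\<close>, then \<open>1 \<otimes> l\<close> vanishes in \<open>S \<otimes> L / U\<close>, so \<open>l \<in> U\<close>.

  For part (1), suppose that \<open>z \<in> L \<otimes> M\<close> lies in every \<open>U\<^sub>i M\<close>, and let \<open>V\<close> be the intersection of the
  \<open>S\<close>-spans of the \<open>U\<^sub>i\<close> in \<open>S \<otimes> L\<close>. Intersection flatness of \<open>M\<^sub>S\<close> puts the image of \<open>z\<close> into
  \<open>V M\<^sub>S\<close>, the preimage of \<open>V\<close> in \<open>L\<close> is the intersection of the \<open>U\<^sub>i\<close> by purity, and the contraction
  principle gives the claim. For part (2) the same argument is used with \<open>L = R\<close>, \<open>Q = S\<close> and \<open>V\<close>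
  the content of \<open>1 \<otimes> x\<close>; here the quotients \<open>R / I\<close> are cyclic, so cyclic purity suffices.

  In part (1) the flatness of \<open>M\<close> has to be proved (\<open>pure_intersection_flat_imp_fg_flat\<close>). Applied
  to the graph of a linear map \<open>\<phi>\<close> on \<open>W\<close> and to \<open>W \<times> 0\<close>, intersection flatness of a module \<open>A\<close> shows that
  the kernel of \<open>\<phi> \<otimes> A\<close> is generated by the kernel of \<open>\<phi>\<close> (\<open>intersection_flat_kernel\<close>). For an injection
  \<open>g\<close> from \<open>N\<close> to \<open>N'\<close> this controls the kernel of \<open>N \<otimes> M \<rightarrow> N' \<otimes> M\<close> after the base change to \<open>S\<close>, although
  \<open>S \<otimes> N \<rightarrow> S \<otimes> N'\<close> may fail to be injective. To come back to \<open>R\<close>, write \<open>M = F / K\<close> with \<open>F\<close> free and let \<open>P\<close>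
  be the quotient of \<open>N' \<otimes> F\<close> by the image of \<open>N \<otimes> K\<close>. It contains \<open>N \<otimes> M\<close> because \<open>F\<close> is flat
  (\<open>tensor_embedding\<close>), and an element of \<open>N \<otimes> M\<close> that dies in \<open>N' \<otimes> M\<close> maps to zero in \<open>S \<otimes> P\<close>,
  hence is zero by purity of \<open>R \<rightarrow> S\<close>.

  The hypotheses only speak of test modules in a fixed type. The reductions of arbitrary modules to
  those use that a vanishing tensor already vanishes over finitely generated submodules
  (\<open>tensor_kernel_finite_support\<close>), and that every finitely generated module has a copy in the
  test type (\<open>fin_gen_transport\<close>).
\<close>

section \<open>Submodules, spans and quotients\<close>

lemma (in abelian_group) minus_eq_zero_iff:
  assumes "x \<in> carrier G" "y \<in> carrier G"
  shows "x \<ominus> y = \<zero> \<longleftrightarrow> x = y"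
proof
  assume "x \<ominus> y = \<zero>"
  then have "(x \<ominus> y) \<oplus> y = y"
    using assms by simp
  then show "x = y"
    using assms by (simp add: a_minus_def a_assoc l_neg)
qed (use assms in \<open>simp add: a_minus_def r_neg\<close>)

lemma submodule_iff:
  assumes "module R L"
  shows "submodule U R L \<longleftrightarrow> U \<subseteq> carrier L \<and> \<zero>\<^bsub>L\<^esub> \<in> U \<and>
    (\<forall>x\<in>U. \<forall>y\<in>U. x \<oplus>\<^bsub>L\<^esub> y \<in> U) \<and> (\<forall>r\<in>carrier R. \<forall>x\<in>U. r \<odot>\<^bsub>L\<^esub> x \<in> U)"
    (is "_ \<longleftrightarrow> ?P")
proof -
  interpret L: module R L by fact
  show ?thesis
  proof
    assume U: "submodule U R L"
    then interpret U: submodule U R L .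
    show ?P
      using L.submoduleE[OF U] U.one_closed by auto
  next
    assume P: ?P
    show "submodule U R L"
    proof (rule L.submoduleI)
      fix x assume "x \<in> U"
      moreover from this P have "\<ominus>\<^bsub>L\<^esub> x = (\<ominus>\<^bsub>R\<^esub> \<one>\<^bsub>R\<^esub>) \<odot>\<^bsub>L\<^esub> x"
        using L.smult_l_minus[of "\<one>\<^bsub>R\<^esub>" x] by auto
      ultimately show "\<ominus>\<^bsub>L\<^esub> x \<in> U"
        using P by simp
    qed (use P in auto)
  qed
qed

lemma lin_mapsD:
  assumes "g \<in> lin_maps R M N"
  shows "x \<in> carrier M \<Longrightarrow> g x \<in> carrier N"
    and "x \<in> carrier M \<Longrightarrow> y \<in> carrier M \<Longrightarrow> g (x \<oplus>\<^bsub>M\<^esub> y) = g x \<oplus>\<^bsub>N\<^esub> g y"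
    and "r \<in> carrier R \<Longrightarrow> x \<in> carrier M \<Longrightarrow> g (r \<odot>\<^bsub>M\<^esub> x) = r \<odot>\<^bsub>N\<^esub> g x"
  using assms by (auto simp: lin_maps_def)

lemma lin_maps_zero:
  assumes "module R M" "module R N" "g \<in> lin_maps R M N"
  shows "g \<zero>\<^bsub>M\<^esub> = \<zero>\<^bsub>N\<^esub>"
proof -
  interpret M: module R M by fact
  interpret N: module R N by fact
  have "g (\<zero>\<^bsub>R\<^esub> \<odot>\<^bsub>M\<^esub> \<zero>\<^bsub>M\<^esub>) = \<zero>\<^bsub>R\<^esub> \<odot>\<^bsub>N\<^esub> g \<zero>\<^bsub>M\<^esub>"
    by (rule lin_mapsD(3)[OF assms(3)]) simp_all
  then show ?thesis
    using lin_mapsD(1)[OF assms(3)] by simp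
qed

lemma lin_maps_minus:
  assumes "module R M" "module R N" "g \<in> lin_maps R M N" "x \<in> carrier M" "y \<in> carrier M"
  shows "g (x \<ominus>\<^bsub>M\<^esub> y) = g x \<ominus>\<^bsub>N\<^esub> g y"
proof -
  interpret M: module R M by fact
  interpret N: module R N by fact
  have "g (\<ominus>\<^bsub>M\<^esub> y) \<oplus>\<^bsub>N\<^esub> g y = g (\<ominus>\<^bsub>M\<^esub> y \<oplus>\<^bsub>M\<^esub> y)"
    using lin_mapsD(2)[OF assms(3)] assms(5) by simp
  also have "\<dots> = \<zero>\<^bsub>N\<^esub>"
    using lin_maps_zero[OF assms(1-3)] assms(5) by (simp add: M.M.l_neg)
  finally have "g (\<ominus>\<^bsub>M\<^esub> y) = \<ominus>\<^bsub>N\<^esub> g y"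
    using lin_mapsD(1)[OF assms(3)] assms(5) by (metis M.M.a_inv_closed N.M.minus_equality)
  then show ?thesis
    using lin_mapsD(2)[OF assms(3), of x "\<ominus>\<^bsub>M\<^esub> y"] assms(4,5) by (simp add: a_minus_def)
qed

lemma lin_maps_comp:
  "g \<in> lin_maps R M N \<Longrightarrow> h \<in> lin_maps R N P \<Longrightarrow> (\<lambda>x. h (g x)) \<in> lin_maps R M P"
  by (auto simp: lin_maps_def Pi_iff)

lemma lin_maps_id: "(\<lambda>x. x) \<in> lin_maps R M M"
  by (auto simp: lin_maps_def)

definition lin_ker :: "('r, 'm, 'y) module_scheme \<Rightarrow> ('r, 'n, 'z) module_scheme \<Rightarrow> ('m \<Rightarrow> 'n) \<Rightarrow> 'm set"
  where "lin_ker M N g = {x \<in> carrier M. g x = \<zero>\<^bsub>N\<^esub>}"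

lemma vimage_submodule:
  assumes "module R M" "module R N" "g \<in> lin_maps R M N" "submodule V R N"
  shows "submodule {x \<in> carrier M. g x \<in> V} R M"
proof -
  interpret M: module R M by fact
  show ?thesis
    using assms(4) lin_mapsD[OF assms(3)] lin_maps_zero[OF assms(1-3)]
    unfolding submodule_iff[OF assms(1)] submodule_iff[OF assms(2)] by auto
qed

lemma lin_ker_submodule:
  assumes "module R M" "module R N" "g \<in> lin_maps R M N"
  shows "submodule (lin_ker M N g) R M"
proof -
  interpret N: module R N by fact
  have "submodule {\<zero>\<^bsub>N\<^esub>} R N"
    unfolding submodule_iff[OF assms(2)] by auto
  from vimage_submodule[OF assms this] show ?thesis
    by (simp add: lin_ker_def)
qed

lemma image_submodule:
  assumes "module R M" "module R N" "g \<in> lin_maps R M N" "submodule U R M"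
  shows "submodule (g ` U) R N"
proof -
  have U: "U \<subseteq> carrier M" "\<zero>\<^bsub>M\<^esub> \<in> U" "\<And>x y. x \<in> U \<Longrightarrow> y \<in> U \<Longrightarrow> x \<oplus>\<^bsub>M\<^esub> y \<in> U"
    "\<And>r x. r \<in> carrier R \<Longrightarrow> x \<in> U \<Longrightarrow> r \<odot>\<^bsub>M\<^esub> x \<in> U"
    using assms(4) unfolding submodule_iff[OF assms(1)] by auto
  show ?thesis
    unfolding submodule_iff[OF assms(2)]
  proof (intro conjI ballI)
    show "\<zero>\<^bsub>N\<^esub> \<in> g ` U"
      using U(2) lin_maps_zero[OF assms(1-3)] by force
  next
    fix a b assume "a \<in> g ` U" "b \<in> g ` U"
    then obtain x y where "x \<in> U" "y \<in> U" "a = g x" "b = g y" by auto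
    then have "a \<oplus>\<^bsub>N\<^esub> b = g (x \<oplus>\<^bsub>M\<^esub> y)"
      using lin_mapsD(2)[OF assms(3)] U(1) by (auto simp: subset_iff)
    then show "a \<oplus>\<^bsub>N\<^esub> b \<in> g ` U"
      using U(3) \<open>x \<in> U\<close> \<open>y \<in> U\<close> by auto
  next
    fix r a assume r: "r \<in> carrier R" and "a \<in> g ` U"
    then obtain x where "x \<in> U" "a = g x" by auto
    then have "r \<odot>\<^bsub>N\<^esub> a = g (r \<odot>\<^bsub>M\<^esub> x)"
      using lin_mapsD(3)[OF assms(3)] U(1) r by (auto simp: subset_iff)
    then show "r \<odot>\<^bsub>N\<^esub> a \<in> g ` U"
      using U(4) r \<open>x \<in> U\<close> by auto
  qed (use U(1) lin_mapsD(1)[OF assms(3)] in auto)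
qed

lemma Inter_submodule:
  assumes "module R L" "\<And>U. U \<in> \<U> \<Longrightarrow> submodule U R L"
  shows "submodule (carrier L \<inter> \<Inter>\<U>) R L"
proof -
  interpret L: module R L by fact
  show ?thesis
    using assms(2) unfolding submodule_iff[OF assms(1)] by auto
qed

lemma submodule_trans:
  assumes "module R L" "submodule U R L" "submodule V R (L\<lparr>carrier := U\<rparr>)"
  shows "submodule V R L"
proof -
  have U: "module R (L\<lparr>carrier := U\<rparr>)"
    by (rule submodule.submodule_is_module[OF assms(2,1)])
  show ?thesis
    using assms(2,3) unfolding submodule_iff[OF assms(1)] submodule_iff[OF U] by auto
qed

definition mod_span :: "('r, 'x) ring_scheme \<Rightarrow> ('r, 'm, 'y) module_scheme \<Rightarrow> 'm set \<Rightarrow> 'm set"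
  where "mod_span R L G = carrier L \<inter> \<Inter>{U. submodule U R L \<and> G \<subseteq> U}"

lemma mod_span:
  assumes "module R L" "G \<subseteq> carrier L"
  shows "submodule (mod_span R L G) R L" "G \<subseteq> mod_span R L G"
    "\<And>U. submodule U R L \<Longrightarrow> G \<subseteq> U \<Longrightarrow> mod_span R L G \<subseteq> U"
proof -
  show "submodule (mod_span R L G) R L"
    unfolding mod_span_def by (rule Inter_submodule[OF assms(1)]) simp
qed (use assms(2) in \<open>auto simp: mod_span_def\<close>)

text \<open>
  The reformulation by submodules is the one that passes easily to images, products and base changes,
  because preimages of submodules are submodules; sums over generators would not.
\<close>

lemma fin_gen_module_iff:
  assumes "module R L"
  shows "fin_gen_module R L \<longleftrightarrow>
    (\<exists>G. finite G \<and> G \<subseteq> carrier L \<and> (\<forall>U. submodule U R L \<and> G \<subseteq> U \<longrightarrow> U = carrier L))"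
proof -
  interpret L: module R L by fact
  show ?thesis
  proof
    assume "fin_gen_module R L"
    then obtain G where G: "finite G" "G \<subseteq> carrier L"
      "carrier L = {(\<Oplus>\<^bsub>L\<^esub>g\<in>G. a g \<odot>\<^bsub>L\<^esub> g) | a. a \<in> G \<rightarrow> carrier R}"
      unfolding fin_gen_module_def by blast
    have "U = carrier L" if U: "submodule U R L" "G \<subseteq> U" for U
    proof -
      note U' = U(1)[unfolded submodule_iff[OF assms]]
      have "finite H \<Longrightarrow> H \<subseteq> G \<Longrightarrow> (\<Oplus>\<^bsub>L\<^esub>g\<in>H. a g \<odot>\<^bsub>L\<^esub> g) \<in> U" if a: "a \<in> G \<rightarrow> carrier R" for a H
      proof (induction H rule: finite_induct)
        case empty
        then show ?case using U' by simp
      next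
        case (insert g H)
        have "(\<Oplus>\<^bsub>L\<^esub>g\<in>insert g H. a g \<odot>\<^bsub>L\<^esub> g) = a g \<odot>\<^bsub>L\<^esub> g \<oplus>\<^bsub>L\<^esub> (\<Oplus>\<^bsub>L\<^esub>g\<in>H. a g \<odot>\<^bsub>L\<^esub> g)"
          using insert a G(2) by (intro L.M.finsum_insert) (auto simp: Pi_iff subset_iff)
        then show ?case
          using insert U' U(2) a by (auto simp: Pi_iff subset_iff)
      qed
      then have "carrier L \<subseteq> U"
        unfolding G(3) using G(1) by auto
      then show ?thesis using U' by auto
    qed
    then show "\<exists>G. finite G \<and> G \<subseteq> carrier L \<and> (\<forall>U. submodule U R L \<and> G \<subseteq> U \<longrightarrow> U = carrier L)"
      using G by blast
  next
    assume "\<exists>G. finite G \<and> G \<subseteq> carrier L \<and> (\<forall>U. submodule U R L \<and> G \<subseteq> U \<longrightarrow> U = carrier L)"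
    then obtain G where G: "finite G" "G \<subseteq> carrier L"
      "\<forall>U. submodule U R L \<and> G \<subseteq> U \<longrightarrow> U = carrier L" by blast
    define U where "U = {(\<Oplus>\<^bsub>L\<^esub>g\<in>G. a g \<odot>\<^bsub>L\<^esub> g) | a. a \<in> G \<rightarrow> carrier R}"
    have g_in [simp]: "g \<in> G \<Longrightarrow> g \<in> carrier L" for g using G(2) by blast
    have "submodule U R L"
      unfolding submodule_iff[OF assms]
    proof (intro conjI ballI)
      show "U \<subseteq> carrier L"
        unfolding U_def by (auto simp: Pi_iff intro!: L.M.finsum_closed)
      have "(\<Oplus>\<^bsub>L\<^esub>g\<in>G. \<zero>\<^bsub>R\<^esub> \<odot>\<^bsub>L\<^esub> g) = \<zero>\<^bsub>L\<^esub>"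
        by (rule L.M.add.finprod_one_eqI) simp
      then show "\<zero>\<^bsub>L\<^esub> \<in> U"
        unfolding U_def by (auto intro!: exI[of _ "\<lambda>_. \<zero>\<^bsub>R\<^esub>"])
    next
      fix x y assume "x \<in> U" "y \<in> U"
      then obtain a b where ab: "a \<in> G \<rightarrow> carrier R" "b \<in> G \<rightarrow> carrier R"
        "x = (\<Oplus>\<^bsub>L\<^esub>g\<in>G. a g \<odot>\<^bsub>L\<^esub> g)" "y = (\<Oplus>\<^bsub>L\<^esub>g\<in>G. b g \<odot>\<^bsub>L\<^esub> g)" unfolding U_def by blast
      have "x \<oplus>\<^bsub>L\<^esub> y = (\<Oplus>\<^bsub>L\<^esub>g\<in>G. a g \<odot>\<^bsub>L\<^esub> g \<oplus>\<^bsub>L\<^esub> b g \<odot>\<^bsub>L\<^esub> g)"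
        unfolding ab(3,4) using ab(1,2)
        by (intro L.M.finsum_addf[symmetric]) (auto simp: Pi_iff)
      also have "\<dots> = (\<Oplus>\<^bsub>L\<^esub>g\<in>G. (a g \<oplus>\<^bsub>R\<^esub> b g) \<odot>\<^bsub>L\<^esub> g)"
        using ab(1,2) by (intro L.M.finsum_cong') (auto simp: Pi_iff L.smult_l_distr)
      finally show "x \<oplus>\<^bsub>L\<^esub> y \<in> U"
        unfolding U_def using ab(1,2) by (auto simp: Pi_iff intro!: exI[of _ "\<lambda>g. a g \<oplus>\<^bsub>R\<^esub> b g"])
    next
      fix r x assume r: "r \<in> carrier R" and "x \<in> U"
      then obtain a where a: "a \<in> G \<rightarrow> carrier R"
        "x = (\<Oplus>\<^bsub>L\<^esub>g\<in>G. a g \<odot>\<^bsub>L\<^esub> g)" unfolding U_def by blast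
      have "r \<odot>\<^bsub>L\<^esub> x = (\<Oplus>\<^bsub>L\<^esub>g\<in>G. r \<odot>\<^bsub>L\<^esub> (a g \<odot>\<^bsub>L\<^esub> g))"
        unfolding a(2) using a(1) r G(1)
        by (intro L.finsum_smult_ldistr) (auto simp: Pi_iff)
      also have "\<dots> = (\<Oplus>\<^bsub>L\<^esub>g\<in>G. (r \<otimes>\<^bsub>R\<^esub> a g) \<odot>\<^bsub>L\<^esub> g)"
        using a(1) r by (intro L.M.finsum_cong') (auto simp: Pi_iff L.smult_assoc1)
      finally show "r \<odot>\<^bsub>L\<^esub> x \<in> U"
        unfolding U_def using a(1) r by (auto simp: Pi_iff intro!: exI[of _ "\<lambda>g. r \<otimes>\<^bsub>R\<^esub> a g"])
    qed
    moreover have "G \<subseteq> U"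
    proof
      fix h assume h: "h \<in> G"
      have "(\<Oplus>\<^bsub>L\<^esub>g\<in>G. (if h = g then \<one>\<^bsub>R\<^esub> else \<zero>\<^bsub>R\<^esub>) \<odot>\<^bsub>L\<^esub> g) =
        (\<Oplus>\<^bsub>L\<^esub>g\<in>G. if h = g then g else \<zero>\<^bsub>L\<^esub>)"
        by (intro L.M.finsum_cong') auto
      also have "\<dots> = h"
        using h G(1) by (intro L.M.finsum_singleton) auto
      finally show "h \<in> U"
        unfolding U_def by (auto intro!: exI[of _ "\<lambda>g. if h = g then \<one>\<^bsub>R\<^esub> else \<zero>\<^bsub>R\<^esub>"])
    qed
    ultimately have "carrier L = U"
      using G(3) by blast
    then show "fin_gen_module R L"
      unfolding fin_gen_module_def U_def using G(1,2) by blast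
  qed
qed

lemma mod_span_fin_gen:
  assumes "module R L" "finite G" "G \<subseteq> carrier L"
  shows "fin_gen_module R (L\<lparr>carrier := mod_span R L G\<rparr>)"
proof -
  note span = mod_span[OF assms(1,3)]
  have N: "module R (L\<lparr>carrier := mod_span R L G\<rparr>)"
    by (rule submodule.submodule_is_module[OF span(1) assms(1)])
  have "U = mod_span R L G"
    if "submodule U R (L\<lparr>carrier := mod_span R L G\<rparr>)" "G \<subseteq> U" for U
    using span(3)[OF submodule_trans[OF assms(1) span(1) that(1)] that(2)]
      that(1)[unfolded submodule_iff[OF N]] by auto
  then show ?thesis
    unfolding fin_gen_module_iff[OF N] using assms(2) span(2) by auto
qed

lemma fin_gen_image:
  assumes "module R L" "module R N" "g \<in> lin_maps R L N" "g ` carrier L = carrier N"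
    and "fin_gen_module R L"
  shows "fin_gen_module R N"
proof -
  obtain G where G: "finite G" "G \<subseteq> carrier L"
      "\<forall>U. submodule U R L \<and> G \<subseteq> U \<longrightarrow> U = carrier L"
    using assms(5) unfolding fin_gen_module_iff[OF assms(1)] by blast
  have "U = carrier N" if U: "submodule U R N" "g ` G \<subseteq> U" for U
  proof -
    have "{x \<in> carrier L. g x \<in> U} = carrier L"
      using G(2) U(2) vimage_submodule[OF assms(1-3) U(1)] by (intro G(3)[rule_format]) auto
    then have "carrier N \<subseteq> U"
      unfolding assms(4)[symmetric] by blast
    then show ?thesis
      using U(1) unfolding submodule_iff[OF assms(2)] by blast
  qed
  then show ?thesis
    unfolding fin_gen_module_iff[OF assms(2)]
    using G(1,2) lin_mapsD(1)[OF assms(3)] by (intro exI[of _ "g ` G"]) auto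
qed

text \<open>
  The elements of the quotient are the values of an arbitrary map \<open>g\<close> whose fibres are the cosets of \<open>V\<close>.
  This freedom covers both the actual quotient and, for \<open>V = 0\<close>, copies of a module in another type.
\<close>

lemma quotient_module:
  fixes g :: "'l \<Rightarrow> 'q"
  assumes "module R L" "submodule V R L"
    and fib: "\<And>x y. x \<in> carrier L \<Longrightarrow> y \<in> carrier L \<Longrightarrow> g x = g y \<longleftrightarrow> x \<ominus>\<^bsub>L\<^esub> y \<in> V"
  obtains Q :: "('r, 'q) module" where "module R Q" "carrier Q = g ` carrier L"
    "g \<in> lin_maps R L Q" "lin_ker L Q g = V"
proof -
  interpret L: module R L by fact
  note V = assms(2)[unfolded submodule_iff[OF assms(1)]]
  define s where "s = inv_into (carrier L) g"
  have s: "s (g x) \<in> carrier L" "g (s (g x)) = g x" if "x \<in> carrier L" for x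
    unfolding s_def using that by (auto intro: inv_into_into f_inv_into_f)
  define Q :: "('r, 'q) module" where "Q = \<lparr>carrier = g ` carrier L, mult = (\<lambda>_ _. g \<zero>\<^bsub>L\<^esub>),
    one = g \<zero>\<^bsub>L\<^esub>, zero = g \<zero>\<^bsub>L\<^esub>, add = (\<lambda>X Y. g (s X \<oplus>\<^bsub>L\<^esub> s Y)), smult = (\<lambda>r X. g (r \<odot>\<^bsub>L\<^esub> s X))\<rparr>"
  have sV: "s (g x) \<ominus>\<^bsub>L\<^esub> x \<in> V" if "x \<in> carrier L" for x
    using fib s that by blast
  have add: "g x \<oplus>\<^bsub>Q\<^esub> g y = g (x \<oplus>\<^bsub>L\<^esub> y)" if "x \<in> carrier L" "y \<in> carrier L" for x y
  proof -
    have "(s (g x) \<oplus>\<^bsub>L\<^esub> s (g y)) \<ominus>\<^bsub>L\<^esub> (x \<oplus>\<^bsub>L\<^esub> y) = (s (g x) \<ominus>\<^bsub>L\<^esub> x) \<oplus>\<^bsub>L\<^esub> (s (g y) \<ominus>\<^bsub>L\<^esub> y)"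
      using that s by (simp add: a_minus_def L.M.minus_add L.M.a_ac)
    then show ?thesis
      using that s V sV by (simp add: Q_def fib)
  qed
  have smult: "r \<odot>\<^bsub>Q\<^esub> g x = g (r \<odot>\<^bsub>L\<^esub> x)" if "x \<in> carrier L" "r \<in> carrier R" for x r
  proof -
    have "r \<odot>\<^bsub>L\<^esub> s (g x) \<ominus>\<^bsub>L\<^esub> r \<odot>\<^bsub>L\<^esub> x = r \<odot>\<^bsub>L\<^esub> (s (g x) \<ominus>\<^bsub>L\<^esub> x)"
      using that s by (simp add: a_minus_def L.smult_r_distr L.smult_r_minus)
    then show ?thesis
      using that s V sV by (simp add: Q_def fib)
  qed
  have car: "carrier Q = g ` carrier L" and zero: "\<zero>\<^bsub>Q\<^esub> = g \<zero>\<^bsub>L\<^esub>"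
    by (simp_all add: Q_def)
  have "abelian_group Q"
  proof (rule abelian_groupI)
    fix X assume "X \<in> carrier Q"
    then obtain x where x: "x \<in> carrier L" "X = g x" by (auto simp: car)
    then have "g (\<ominus>\<^bsub>L\<^esub> x) \<oplus>\<^bsub>Q\<^esub> X = \<zero>\<^bsub>Q\<^esub>"
      by (simp add: add zero L.M.l_neg)
    then show "\<exists>Y\<in>carrier Q. Y \<oplus>\<^bsub>Q\<^esub> X = \<zero>\<^bsub>Q\<^esub>"
      using x by (auto simp: car)
  qed (auto simp: car zero add L.M.a_ac)
  then have Q: "module R Q"
    by (rule moduleI[OF L.R.is_cring])
      (auto simp: car add smult L.smult_l_distr L.smult_r_distr L.smult_assoc1)
  have lin: "g \<in> lin_maps R L Q"
    by (auto simp: lin_maps_def car add smult)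
  have "x \<ominus>\<^bsub>L\<^esub> \<zero>\<^bsub>L\<^esub> = x" if "x \<in> carrier L" for x
    using that L.M.minus_equality[of "\<zero>\<^bsub>L\<^esub>" "\<zero>\<^bsub>L\<^esub>"] by (simp add: a_minus_def)
  then have "lin_ker L Q g = V"
    using fib[OF _ L.M.zero_closed] V by (auto simp: lin_ker_def zero)
  with Q car lin show thesis
    by (rule that)
qed

lemma transport_module:
  fixes e :: "'l \<Rightarrow> 'q"
  assumes "module R L" "inj_on e (carrier L)"
  obtains Q :: "('r, 'q) module" where "module R Q" "carrier Q = e ` carrier L"
    "e \<in> lin_maps R L Q" "inv_into (carrier L) e \<in> lin_maps R Q L"
proof -
  interpret L: module R L by fact
  have "submodule {\<zero>\<^bsub>L\<^esub>} R L"
    unfolding submodule_iff[OF assms(1)] by auto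
  moreover have "e x = e y \<longleftrightarrow> x \<ominus>\<^bsub>L\<^esub> y \<in> {\<zero>\<^bsub>L\<^esub>}" if "x \<in> carrier L" "y \<in> carrier L" for x y
    using that assms(2) L.M.minus_eq_zero_iff by (auto simp: inj_on_eq_iff)
  ultimately obtain Q :: "('r, 'q) module" where Q: "module R Q" "carrier Q = e ` carrier L"
    "e \<in> lin_maps R L Q" "lin_ker L Q e = {\<zero>\<^bsub>L\<^esub>}"
    using quotient_module[OF assms(1)] by metis
  have "inv_into (carrier L) e \<in> lin_maps R Q L"
    using assms(2) unfolding lin_maps_def
    by (auto simp: Q(2) lin_mapsD(2,3)[OF Q(3), symmetric])
  with Q(1-3) show thesis
    by (rule that)
qed

lemma quotient_exists:
  fixes L :: "('r, 'l, 'y) module_scheme"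
  assumes "module R L" "submodule V R L"
  obtains Q :: "('r, 'l set) module" and g :: "'l \<Rightarrow> 'l set" where "module R Q" "carrier Q = g ` carrier L"
    "g \<in> lin_maps R L Q" "lin_ker L Q g = V"
proof -
  interpret L: module R L by fact
  note V = assms(2)[unfolded submodule_iff[OF assms(1)]]
  define g where "g x = {y \<in> carrier L. y \<ominus>\<^bsub>L\<^esub> x \<in> V}" for x
  have minus: "y \<ominus>\<^bsub>L\<^esub> x \<in> V" if "x \<ominus>\<^bsub>L\<^esub> y \<in> V" "x \<in> carrier L" "y \<in> carrier L" for x y
  proof -
    have "\<ominus>\<^bsub>L\<^esub> (x \<ominus>\<^bsub>L\<^esub> y) \<in> V"
      using L.submoduleE(3)[OF assms(2) that(1)] .
    then show ?thesis
      using that by (simp add: a_minus_def L.M.minus_add L.M.a_ac)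
  qed
  have trans: "x \<ominus>\<^bsub>L\<^esub> z \<in> V"
    if "x \<ominus>\<^bsub>L\<^esub> y \<in> V" "y \<ominus>\<^bsub>L\<^esub> z \<in> V" "x \<in> carrier L" "y \<in> carrier L" "z \<in> carrier L" for x y z
  proof -
    have "(x \<ominus>\<^bsub>L\<^esub> y) \<oplus>\<^bsub>L\<^esub> (y \<ominus>\<^bsub>L\<^esub> z) = x \<ominus>\<^bsub>L\<^esub> z"
      using that by (simp add: a_minus_def L.M.a_assoc L.M.r_neg1)
    then show ?thesis using V that by metis
  qed
  have "g x = g y \<longleftrightarrow> x \<ominus>\<^bsub>L\<^esub> y \<in> V" if "x \<in> carrier L" "y \<in> carrier L" for x y
  proof
    assume "g x = g y"
    moreover have "x \<in> g x"
      using V that L.M.minus_eq_zero_iff[of x x] by (simp add: g_def)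
    ultimately show "x \<ominus>\<^bsub>L\<^esub> y \<in> V" by (simp add: g_def)
  next
    assume "x \<ominus>\<^bsub>L\<^esub> y \<in> V"
    then show "g x = g y"
      using trans minus that unfolding g_def by blast
  qed
  with assms obtain Q :: "('r, 'l set) module" where "module R Q" "carrier Q = g ` carrier L"
    "g \<in> lin_maps R L Q" "lin_ker L Q g = V"
    by (rule quotient_module) auto
  then show thesis by (rule that)
qed

text \<open>
  An element of \<open>L\<close> is determined by a choice of its finitely many coefficients on the generators,
  so \<open>L\<close> injects into \<open>nat \<Rightarrow> 'r\<close> already; the injection takes singletons to land in the test type.
\<close>

lemma fin_gen_transport:
  fixes R :: "('r, 'x) ring_scheme" and L :: "('r, 'l, 'y) module_scheme"
  assumes "module R L" "fin_gen_module R L"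
  obtains Q :: "('r, 'r test_carrier) module" and e k
  where "module R Q" "fin_gen_module R Q" "e \<in> lin_maps R L Q" "k \<in> lin_maps R Q L"
    "\<And>x. x \<in> carrier L \<Longrightarrow> k (e x) = x" "\<And>y. y \<in> carrier Q \<Longrightarrow> e (k y) = y"
proof -
  interpret L: module R L by fact
  obtain G where G: "finite G" "G \<subseteq> carrier L"
    "carrier L = {(\<Oplus>\<^bsub>L\<^esub>g\<in>G. a g \<odot>\<^bsub>L\<^esub> g) | a. a \<in> G \<rightarrow> carrier R}"
    using assms(2) unfolding fin_gen_module_def by blast
  have "\<forall>x\<in>carrier L. \<exists>a. a \<in> G \<rightarrow> carrier R \<and> (\<Oplus>\<^bsub>L\<^esub>g\<in>G. a g \<odot>\<^bsub>L\<^esub> g) = x"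
    by (subst G(3)) blast
  then obtain a where a: "\<And>x. x \<in> carrier L \<Longrightarrow> a x \<in> G \<rightarrow> carrier R"
    "\<And>x. x \<in> carrier L \<Longrightarrow> (\<Oplus>\<^bsub>L\<^esub>g\<in>G. a x g \<odot>\<^bsub>L\<^esub> g) = x" by metis
  obtain en :: "nat \<Rightarrow> 'l" and n where en: "G = en ` {i. i < n}"
    using finite_imp_nat_seg_image_inj_on[OF G(1)] by blast
  define e :: "'l \<Rightarrow> 'r test_carrier" where "e x = {\<lambda>i. a x (en i)}" for x
  have "inj_on e (carrier L)"
  proof
    fix x y assume xy: "x \<in> carrier L" "y \<in> carrier L" "e x = e y"
    then have "a x (en i) = a y (en i)" for i
      unfolding e_def by (metis singleton_inject)
    then have "a x g = a y g" if "g \<in> G" for g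
      using that en by auto
    then have "(\<Oplus>\<^bsub>L\<^esub>g\<in>G. a x g \<odot>\<^bsub>L\<^esub> g) = (\<Oplus>\<^bsub>L\<^esub>g\<in>G. a y g \<odot>\<^bsub>L\<^esub> g)"
      using a(1)[OF xy(2)] G(2) by (intro L.M.finsum_cong') (auto simp: Pi_iff)
    then show "x = y"
      using a(2) xy by simp
  qed
  with transport_module[OF assms(1)] obtain Q :: "('r, 'r test_carrier) module" where
    Q: "module R Q" "carrier Q = e ` carrier L" "e \<in> lin_maps R L Q"
    "inv_into (carrier L) e \<in> lin_maps R Q L" by metis
  show thesis
    by (rule that[OF Q(1) _ Q(3,4)])
      (use fin_gen_image[OF assms(1) Q(1,3)] Q(2) assms(2) \<open>inj_on e _\<close>
        in \<open>auto simp: inv_into_f_f f_inv_into_f\<close>)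
qed

section \<open>Tensors as formal sums\<close>

abbreviation frag_map :: "('a \<Rightarrow> 'c) \<Rightarrow> ('b \<Rightarrow> 'd) \<Rightarrow> ('a \<times> 'b \<Rightarrow>\<^sub>0 int) \<Rightarrow> ('c \<times> 'd \<Rightarrow>\<^sub>0 int)"
  where "frag_map g h \<equiv> frag_extend (\<lambda>(x, y). frag_of (g x, h y))"

lemma frag_map_comp: "frag_map g' h' (frag_map g h c) = frag_map (\<lambda>x. g' (g x)) (\<lambda>y. h' (h y)) c"
  by (induction c rule: frag_induction[OF subset_UNIV]) (auto simp: frag_extend_diff)

lemma frag_map_cong:
  assumes "Poly_Mapping.keys c \<subseteq> A \<times> B" "\<And>x. x \<in> A \<Longrightarrow> g x = g' x" "\<And>y. y \<in> B \<Longrightarrow> h y = h' y"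
  shows "frag_map g h c = frag_map g' h' c"
  using assms by (intro frag_extend_eq) auto

lemma frag_map_id: "frag_map (\<lambda>x. x) (\<lambda>y. y) c = c"
  by (induction c rule: frag_induction[OF subset_UNIV]) (auto simp: frag_extend_diff)

lemma frag_map_keys_image:
  assumes "Poly_Mapping.keys c \<subseteq> A \<times> B" "g ` A \<subseteq> C" "h ` B \<subseteq> D"
  shows "Poly_Mapping.keys (frag_map g h c) \<subseteq> C \<times> D"
proof
  fix p assume "p \<in> Poly_Mapping.keys (frag_map g h c)"
  then obtain q where "q \<in> Poly_Mapping.keys c" "p \<in> Poly_Mapping.keys (case q of (x, y) \<Rightarrow> frag_of (g x, h y))"
    using keys_frag_extend[of "\<lambda>(x, y). frag_of (g x, h y)" c] by blast
  then show "p \<in> C \<times> D"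
    using assms by (cases q) auto
qed

lemma frag_extend_mem:
  assumes "Poly_Mapping.keys c \<subseteq> A" "0 \<in> T" "\<And>a b. a \<in> T \<Longrightarrow> b \<in> T \<Longrightarrow> a - b \<in> T"
    and "\<And>p. p \<in> A \<Longrightarrow> \<phi> p \<in> T"
  shows "frag_extend \<phi> c \<in> T"
  using assms(1) by (induction c rule: frag_induction) (auto simp: frag_extend_diff assms(2-4))

text \<open>
  How additive maps out of a tensor product are constructed: a map into a subgroup \<open>T\<close> has to be checked on the
  three kinds of defining relations only.
\<close>

lemma frag_extend_kernel:
  assumes "module R L" "module R M" "c \<in> tensor_kernel R L M"
    and T: "0 \<in> T" "\<And>a b. a \<in> T \<Longrightarrow> b \<in> T \<Longrightarrow> a - b \<in> T"
    and 1: "\<And>x x' y. x \<in> carrier L \<Longrightarrow> x' \<in> carrier L \<Longrightarrow> y \<in> carrier M \<Longrightarrow>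
      \<phi> (x \<oplus>\<^bsub>L\<^esub> x', y) - \<phi> (x, y) - \<phi> (x', y) \<in> T"
    and 2: "\<And>x y y'. x \<in> carrier L \<Longrightarrow> y \<in> carrier M \<Longrightarrow> y' \<in> carrier M \<Longrightarrow>
      \<phi> (x, y \<oplus>\<^bsub>M\<^esub> y') - \<phi> (x, y) - \<phi> (x, y') \<in> T"
    and 3: "\<And>r x y. r \<in> carrier R \<Longrightarrow> x \<in> carrier L \<Longrightarrow> y \<in> carrier M \<Longrightarrow>
      \<phi> (r \<odot>\<^bsub>L\<^esub> x, y) - \<phi> (x, r \<odot>\<^bsub>M\<^esub> y) \<in> T"
  shows "frag_extend \<phi> c \<in> T"
proof -
  have neg: "- a \<in> T" if "a \<in> T" for a
    using T(2)[OF T(1) that] by simp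
  have rel: "frag_extend \<phi> a \<in> T" if "a \<in> tensor_rels R L M" for a
    using that 1 2 3 unfolding tensor_rels_def by (auto simp: frag_extend_diff)
  show ?thesis
    using assms(3) unfolding tensor_kernel_def
  proof (induction rule: generate.induct)
    case (inv a)
    then show ?case
      using tensor_rels_keys[OF assms(1,2) inv] neg[OF rel[OF inv]] by (simp add: frag_extend_minus)
  next
    case (eng a b)
    then show ?case
      using T(2)[OF _ neg] by (simp add: frag_extend_add)
  qed (use T rel in auto)
qed

text \<open>
  The preimage of \<open>U M\<close> in the free abelian group. On formal sums, additive maps can be
  applied and composed without choosing representatives of cosets.
\<close>

definition times_chains ::
  "('r, 'x) ring_scheme \<Rightarrow> ('r, 'l, 'y) module_scheme \<Rightarrow> 'l set \<Rightarrow> ('r, 'm, 'z) module_scheme \<Rightarrow>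
   ('l \<times> 'm \<Rightarrow>\<^sub>0 int) set"
  where "times_chains R L U M =
    {c. \<exists>d. Poly_Mapping.keys d \<subseteq> U \<times> carrier M \<and> c - d \<in> tensor_kernel R L M}"

lemma times_chains_zero:
  assumes "module R L" "module R M"
  shows "0 \<in> times_chains R L U M"
  using tensor_kernel_closed(1)[OF assms] by (auto simp: times_chains_def intro: exI[of _ 0])

lemma times_chains_diff:
  assumes "module R L" "module R M" "a \<in> times_chains R L U M" "b \<in> times_chains R L U M"
  shows "a - b \<in> times_chains R L U M"
proof -
  obtain d e where de: "Poly_Mapping.keys d \<subseteq> U \<times> carrier M" "a - d \<in> tensor_kernel R L M"
    "Poly_Mapping.keys e \<subseteq> U \<times> carrier M" "b - e \<in> tensor_kernel R L M"
    using assms(3,4) unfolding times_chains_def by blast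
  from tensor_kernel_closed(4)[OF assms(1,2) de(2,4)]
  have "(a - b) - (d - e) \<in> tensor_kernel R L M" by (simp add: algebra_simps)
  moreover have "Poly_Mapping.keys (d - e) \<subseteq> U \<times> carrier M"
    using keys_diff[of d e] de(1,3) by blast
  ultimately show ?thesis unfolding times_chains_def by blast
qed

lemma times_chains_add:
  assumes "module R L" "module R M" "a \<in> times_chains R L U M" "b \<in> times_chains R L U M"
  shows "a + b \<in> times_chains R L U M"
  using times_chains_diff[OF assms(1,2,3) times_chains_diff[OF assms(1,2) times_chains_zero[OF assms(1,2)] assms(4)]]
  by simp

lemma times_chains_kernel: "c \<in> tensor_kernel R L M \<Longrightarrow> c \<in> times_chains R L U M"
  by (auto simp: times_chains_def intro: exI[of _ 0])

lemma times_chains_of_keys: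
  assumes "module R L" "module R M" "Poly_Mapping.keys c \<subseteq> U \<times> carrier M"
  shows "c \<in> times_chains R L U M"
  using assms tensor_kernel_closed(1)[OF assms(1,2)]
  by (auto simp: times_chains_def intro!: exI[of _ c])

lemma times_chains_frag_of:
  assumes "module R L" "module R M" "u \<in> U" "m \<in> carrier M"
  shows "frag_of (u, m) \<in> times_chains R L U M"
  using assms by (intro times_chains_of_keys) auto

lemma times_chains_eq_kernel:
  assumes "module R L" "module R M" "U \<subseteq> {\<zero>\<^bsub>L\<^esub>}"
  shows "times_chains R L U M = tensor_kernel R L M"
proof (intro equalityI subsetI)
  interpret L: module R L by fact
  note K = tensor_kernel_closed[OF assms(1,2)]
  have zero: "frag_of (\<zero>\<^bsub>L\<^esub>, m) \<in> tensor_kernel R L M" if "m \<in> carrier M" for m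
    using K(2)[OF tensor_kernel_rels(1)[OF assms(1,2) L.M.zero_closed L.M.zero_closed that]]
    by simp
  fix c assume "c \<in> times_chains R L U M"
  then obtain d where d: "Poly_Mapping.keys d \<subseteq> U \<times> carrier M" "c - d \<in> tensor_kernel R L M"
    unfolding times_chains_def by blast
  have "d \<in> tensor_kernel R L M"
    using d(1) by (induction d rule: frag_induction) (use K zero assms(3) in auto)
  from K(3)[OF d(2) this] show "c \<in> tensor_kernel R L M" by simp
qed (rule times_chains_kernel)

lemma times_chains_map:
  assumes "module R L" "module R M" "module R L'" "module R M'"
    and "g \<in> lin_maps R L L'" "h \<in> lin_maps R M M'" "g ` U \<subseteq> U'" "c \<in> times_chains R L U M"
  shows "frag_map g h c \<in> times_chains R L' U' M'"
proof -
  obtain d where d: "Poly_Mapping.keys d \<subseteq> U \<times> carrier M" "c - d \<in> tensor_kernel R L M"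
    using assms(8) unfolding times_chains_def by blast
  have "frag_map g h c - frag_map g h d \<in> tensor_kernel R L' M'"
    using frag_map_kernel[OF assms(1-6) d(2)] by (simp add: frag_extend_diff)
  moreover have "Poly_Mapping.keys (frag_map g h d) \<subseteq> U' \<times> carrier M'"
    using frag_map_keys_image[OF d(1) assms(7)] lin_mapsD(1)[OF assms(6)] by blast
  ultimately show ?thesis unfolding times_chains_def by blast
qed

lemma submodule_times_chains:
  assumes "module R L" "module R M" "submodule U R L"
  shows "tensor_coset R L M c \<in> submodule_times R L U M \<longleftrightarrow> c \<in> times_chains R L U M"
  unfolding submodule_times_eq[OF assms] times_chains_def
  by (auto simp: tensor_coset_eq_iff[OF assms(1,2)])

text \<open>
  Membership in the generated subgroup involves finitely many relations, and these involve finitely many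
  elements of \<open>L\<close> and of \<open>M\<close>.
\<close>

lemma tensor_kernel_finite_support:
  assumes "module R L" "module R M" "c \<in> tensor_kernel R L M"
  shows "\<exists>G H. finite G \<and> G \<subseteq> carrier L \<and> finite H \<and> H \<subseteq> carrier M \<and>
    (\<forall>U V. submodule U R L \<and> G \<subseteq> U \<and> submodule V R M \<and> H \<subseteq> V \<longrightarrow>
      c \<in> tensor_kernel R (L\<lparr>carrier := U\<rparr>) (M\<lparr>carrier := V\<rparr>))"
    (is "\<exists>G H. ?P G H c")
proof -
  have sub: "module R (L\<lparr>carrier := U\<rparr>)" "module R (M\<lparr>carrier := V\<rparr>)"
    if "submodule U R L" "submodule V R M" for U V
    using that assms(1,2) by (auto intro: submodule.submodule_is_module)
  have rel: "\<exists>G H. ?P G H a" if a: "a \<in> tensor_rels R L M" for a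
  proof -
    consider
      (1) x x' y where "a = frag_of (x \<oplus>\<^bsub>L\<^esub> x', y) - frag_of (x, y) - frag_of (x', y)"
         "x \<in> carrier L" "x' \<in> carrier L" "y \<in> carrier M"
    | (2) x y y' where "a = frag_of (x, y \<oplus>\<^bsub>M\<^esub> y') - frag_of (x, y) - frag_of (x, y')"
         "x \<in> carrier L" "y \<in> carrier M" "y' \<in> carrier M"
    | (3) r x y where "a = frag_of (r \<odot>\<^bsub>L\<^esub> x, y) - frag_of (x, r \<odot>\<^bsub>M\<^esub> y)"
         "r \<in> carrier R" "x \<in> carrier L" "y \<in> carrier M"
      using a unfolding tensor_rels_def by blast
    then show ?thesis
    proof cases
      case (1 x x' y)
      then show ?thesis
        using tensor_kernel_rels(1)[OF sub]
        by (intro exI[of _ "{x, x'}"] exI[of _ "{y}"]) auto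
    next
      case (2 x y y')
      then show ?thesis
        using tensor_kernel_rels(2)[OF sub]
        by (intro exI[of _ "{x}"] exI[of _ "{y, y'}"]) auto
    next
      case (3 r x y)
      then show ?thesis
        using tensor_kernel_rels(3)[OF sub]
        by (intro exI[of _ "{x}"] exI[of _ "{y}"]) auto
    qed
  qed
  show ?thesis
    using assms(3) unfolding tensor_kernel_def[of R L M]
  proof (induction rule: generate.induct)
    case one
    then show ?case
      using tensor_kernel_closed(1)[OF sub] by (intro exI[of _ "{}"]) auto
  next
    case (incl a)
    then show ?case by (rule rel)
  next
    case (inv a)
    obtain G H where "?P G H a" using rel[OF inv] by blast
    moreover have "inv\<^bsub>free_Abelian_group (carrier L \<times> carrier M)\<^esub> a = - a"
      using tensor_rels_keys[OF assms(1,2) inv] by simp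
    ultimately show ?case
      using tensor_kernel_closed(2)[OF sub] by (intro exI[of _ G] exI[of _ H]) auto
  next
    case (eng a b)
    then obtain G H G' H' where "?P G H a" "?P G' H' b" by blast
    then show ?case
      using tensor_kernel_closed(3)[OF sub]
      by (intro exI[of _ "G \<union> G'"] exI[of _ "H \<union> H'"]) auto
  qed
qed

text \<open>
  Right exactness of the tensor product. A set-theoretic section \<open>s\<close> of \<open>h\<close> induces an inverse map
  from \<open>N \<otimes> M\<close> to the quotient of \<open>L \<otimes> M\<close> by the image of the kernel, because \<open>s\<close> is linear modulo that kernel.
\<close>

lemma tensor_right_exact:
  assumes "module R L" "module R N" "module R M" "h \<in> lin_maps R L N" "h ` carrier L = carrier N"
    and "Poly_Mapping.keys c \<subseteq> carrier L \<times> carrier M"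
    and "frag_map h (\<lambda>m. m) c \<in> tensor_kernel R N M"
  shows "c \<in> times_chains R L (lin_ker L N h) M"
proof -
  interpret L: module R L by fact
  interpret N: module R N by fact
  interpret M: module R M by fact
  let ?T = "times_chains R L (lin_ker L N h) M"
  note h = lin_mapsD[OF assms(4)] and K = tensor_kernel_rels[OF assms(1,3)]
  note T = times_chains_zero[OF assms(1,3), of "lin_ker L N h"]
    times_chains_diff[OF assms(1,3), of _ "lin_ker L N h"]
    times_chains_add[OF assms(1,3), of _ "lin_ker L N h"]
  define s where "s = inv_into (carrier L) h"
  have s: "s n \<in> carrier L" "h (s n) = n" if "n \<in> carrier N" for n
    using that unfolding s_def assms(5)[symmetric] by (auto intro: inv_into_into f_inv_into_f)
  have *: "frag_of (x, m) - frag_of (y, m) \<in> ?T"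
    if "x \<in> carrier L" "y \<in> carrier L" "m \<in> carrier M" "h x = h y" for x y m
  proof -
    let ?k = "x \<ominus>\<^bsub>L\<^esub> y"
    have "h ?k = \<zero>\<^bsub>N\<^esub>"
      using that h(1) lin_maps_minus[OF assms(1,2,4)] by (simp add: N.M.minus_eq_zero_iff)
    then have "frag_of (?k, m) \<in> ?T"
      using that by (intro times_chains_frag_of assms) (auto simp: lin_ker_def)
    moreover have "?k \<oplus>\<^bsub>L\<^esub> y = x"
      using that by (simp add: a_minus_def L.M.a_assoc L.M.l_neg)
    then have "frag_of (x, m) - frag_of (?k, m) - frag_of (y, m) \<in> tensor_kernel R L M"
      using K(1)[of ?k y m] that by simp
    ultimately have "(frag_of (x, m) - frag_of (?k, m) - frag_of (y, m)) + frag_of (?k, m) \<in> ?T"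
      by (intro T(3)[OF times_chains_kernel])
    then show ?thesis by simp
  qed
  have 1: "frag_map s (\<lambda>m. m) (frag_map h (\<lambda>m. m) c) \<in> ?T"
  proof (rule frag_extend_kernel[OF assms(2,3,7) T(1,2)])
    fix x x' m assume a: "x \<in> carrier N" "x' \<in> carrier N" "m \<in> carrier M"
    have "(frag_of (s (x \<oplus>\<^bsub>N\<^esub> x'), m) - frag_of (s x \<oplus>\<^bsub>L\<^esub> s x', m)) +
      (frag_of (s x \<oplus>\<^bsub>L\<^esub> s x', m) - frag_of (s x, m) - frag_of (s x', m)) \<in> ?T"
      using a s h by (intro T(3) * times_chains_kernel K(1)) auto
    then show "(case (x \<oplus>\<^bsub>N\<^esub> x', m) of (x, y) \<Rightarrow> frag_of (s x, y)) -
      (case (x, m) of (x, y) \<Rightarrow> frag_of (s x, y)) - (case (x', m) of (x, y) \<Rightarrow> frag_of (s x, y)) \<in> ?T"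
      by (simp add: algebra_simps)
  next
    fix x m m' assume a: "x \<in> carrier N" "m \<in> carrier M" "m' \<in> carrier M"
    then show "(case (x, m \<oplus>\<^bsub>M\<^esub> m') of (x, y) \<Rightarrow> frag_of (s x, y)) -
      (case (x, m) of (x, y) \<Rightarrow> frag_of (s x, y)) - (case (x, m') of (x, y) \<Rightarrow> frag_of (s x, y)) \<in> ?T"
      using K(2)[of "s x" m m'] s by (auto intro: times_chains_kernel)
  next
    fix r x m assume a: "r \<in> carrier R" "x \<in> carrier N" "m \<in> carrier M"
    have "(frag_of (s (r \<odot>\<^bsub>N\<^esub> x), m) - frag_of (r \<odot>\<^bsub>L\<^esub> s x, m)) +
      (frag_of (r \<odot>\<^bsub>L\<^esub> s x, m) - frag_of (s x, r \<odot>\<^bsub>M\<^esub> m)) \<in> ?T"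
      using a s h by (intro T(3) * times_chains_kernel K(3)) auto
    then show "(case (r \<odot>\<^bsub>N\<^esub> x, m) of (x, y) \<Rightarrow> frag_of (s x, y)) -
      (case (x, r \<odot>\<^bsub>M\<^esub> m) of (x, y) \<Rightarrow> frag_of (s x, y)) \<in> ?T"
      by simp
  qed
  have 2: "c - frag_map s (\<lambda>m. m) (frag_map h (\<lambda>m. m) c) \<in> ?T"
    using assms(6)
  proof (induction c rule: frag_induction)
    case (one p)
    then show ?case using * s h by auto
  next
    case (diff a b)
    from T(2)[OF diff] show ?case by (simp add: frag_extend_diff algebra_simps)
  qed (use T in auto)
  from T(3)[OF 2 1] show ?thesis by simp
qed

section \<open>Flatness\<close>

lemma submodule_incl_lin:
  assumes "module R L" "submodule U R L"
  shows "(\<lambda>x. x) \<in> lin_maps R (L\<lparr>carrier := U\<rparr>) L"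
  using assms(2) unfolding submodule_iff[OF assms(1)] by (auto simp: lin_maps_def)

lemma lin_maps_restrict:
  assumes "g \<in> lin_maps R L N" "U \<subseteq> carrier L" "g ` U \<subseteq> V"
  shows "g \<in> lin_maps R (L\<lparr>carrier := U\<rparr>) (N\<lparr>carrier := V\<rparr>)"
  using assms by (auto simp: lin_maps_def subset_iff)

text \<open>
  Flatness, tested on injections between finitely generated modules in the test type and expressed by
  formal sums. It suffices for all injections between modules of any type, by \<open>fg_flat_exact\<close>.
\<close>

definition fg_flat :: "('r, 'x) ring_scheme \<Rightarrow> ('r, 'm, 'y) module_scheme \<Rightarrow> bool"
  where "fg_flat R M \<longleftrightarrow>
    (\<forall>(N :: ('r, 'r test_carrier) module) (N' :: ('r, 'r test_carrier) module) g c.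
      module R N \<and> fin_gen_module R N \<and> module R N' \<and> fin_gen_module R N' \<and>
      g \<in> lin_maps R N N' \<and> inj_on g (carrier N) \<and>
      Poly_Mapping.keys c \<subseteq> carrier N \<times> carrier M \<and>
      frag_map g (\<lambda>m. m) c \<in> tensor_kernel R N' M \<longrightarrow> c \<in> tensor_kernel R N M)"

lemma inj_on_tensor_mapD:
  assumes "module R N" "module R M" "module R N'" "g \<in> lin_maps R N N'"
    and "inj_on (tensor_map R N M N' M g (\<lambda>x. x)) (carrier (tensor R N M))"
    and "Poly_Mapping.keys c \<subseteq> carrier N \<times> carrier M"
    and "frag_map g (\<lambda>m. m) c \<in> tensor_kernel R N' M"
  shows "c \<in> tensor_kernel R N M"
proof -
  note eq = tensor_map_coset[OF assms(1-3,2,4) lin_maps_id]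
  have "tensor_coset R N M c = tensor_coset R N M 0"
  proof (rule inj_onD[OF assms(5)])
    show "tensor_map R N M N' M g (\<lambda>x. x) (tensor_coset R N M c) =
      tensor_map R N M N' M g (\<lambda>x. x) (tensor_coset R N M 0)"
      unfolding eq using assms(7) by (simp add: tensor_coset_eq_iff[OF assms(3,2)])
  qed (use assms(6) in \<open>auto simp: tensor_def tensor_by_simps(1)[OF assms(1,2)]\<close>)
  then show ?thesis
    by (simp add: tensor_coset_eq_iff[OF assms(1,2)])
qed

lemma flat_module_imp_fg_flat:
  fixes R :: "('r, 'x) ring_scheme"
  assumes "module R M" "flat_module TYPE('r test_carrier) R M"
  shows "fg_flat R M"
  unfolding fg_flat_def
proof (intro allI impI, elim conjE)
  fix N N' :: "('r, 'r test_carrier) module" and g c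
  assume a: "module R N" "module R N'" "g \<in> lin_maps R N N'" "inj_on g (carrier N)"
    "Poly_Mapping.keys c \<subseteq> carrier N \<times> carrier M"
    "frag_map g (\<lambda>m. m) c \<in> tensor_kernel R N' M"
  then have "inj_on (tensor_map R N M N' M g (\<lambda>x. x)) (carrier (tensor R N M))"
    using assms(2) unfolding flat_module_def by blast
  from inj_on_tensor_mapD[OF a(1) assms(1) a(2,3) this a(5,6)]
  show "c \<in> tensor_kernel R N M" .
qed

text \<open>
  A relation in \<open>Q \<otimes> M\<close> already holds over a finitely generated submodule of \<open>Q\<close>, so flatness
  applies to the inclusion of the span of the elements \<open>h l\<close> in such a submodule. It shows that the relation holds
  over that span, over which \<open>h\<close> becomes surjective, and right exactness finishes the argument.
\<close>

lemma fg_flat_exact: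
  fixes R :: "('r, 'x) ring_scheme"
  assumes "module R L" "module R Q" "module R M" "fg_flat R M" "h \<in> lin_maps R L Q"
    and "Poly_Mapping.keys c \<subseteq> carrier L \<times> carrier M"
    and "frag_map h (\<lambda>m. m) c \<in> tensor_kernel R Q M"
  shows "c \<in> times_chains R L (lin_ker L Q h) M"
proof -
  let ?c = "frag_map h (\<lambda>m. m) c"
  obtain G where G: "finite G" "G \<subseteq> carrier Q"
    "\<And>U. submodule U R Q \<Longrightarrow> G \<subseteq> U \<Longrightarrow> ?c \<in> tensor_kernel R (Q\<lparr>carrier := U\<rparr>) M"
  proof -
    obtain G H where GH: "finite G" "G \<subseteq> carrier Q" "finite H" "H \<subseteq> carrier M"
      "\<forall>U V. submodule U R Q \<and> G \<subseteq> U \<and> submodule V R M \<and> H \<subseteq> V \<longrightarrow>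
        ?c \<in> tensor_kernel R (Q\<lparr>carrier := U\<rparr>) (M\<lparr>carrier := V\<rparr>)"
      using tensor_kernel_finite_support[OF assms(2,3,7)] by blast
    have "?c \<in> tensor_kernel R (Q\<lparr>carrier := U\<rparr>) M" if "submodule U R Q" "G \<subseteq> U" for U
      using GH(5)[rule_format, of U "carrier M"] that GH(4) module.carrier_is_submodule[OF assms(3)]
      by simp
    then show thesis using that GH(1,2) by blast
  qed
  note h = lin_mapsD[OF assms(5)]
  define G0 where "G0 = h ` fst ` Poly_Mapping.keys c"
  have G0: "finite G0" "G0 \<subseteq> carrier Q"
    unfolding G0_def using assms(6) h(1) by auto
  let ?N = "mod_span R Q G0" and ?N' = "mod_span R Q (G \<union> G0)"
  have GG0: "finite (G \<union> G0)" "G \<union> G0 \<subseteq> carrier Q" using G G0 by auto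
  note N = mod_span[OF assms(2) G0(2)] and N' = mod_span[OF assms(2) GG0(2)]
  have NN': "?N \<subseteq> ?N'"
    using N(3)[OF N'(1)] N'(2) by blast
  have NQ: "?N \<subseteq> carrier Q"
    using N(1)[unfolded submodule_iff[OF assms(2)]] by blast
  note mN = submodule.submodule_is_module[OF N(1) assms(2)]
    and mN' = submodule.submodule_is_module[OF N'(1) assms(2)]
  obtain X :: "('r, 'r test_carrier) module" and e k where X: "module R X" "fin_gen_module R X"
    "e \<in> lin_maps R (Q\<lparr>carrier := ?N\<rparr>) X" "k \<in> lin_maps R X (Q\<lparr>carrier := ?N\<rparr>)"
    "\<And>x. x \<in> ?N \<Longrightarrow> k (e x) = x" "\<And>y. y \<in> carrier X \<Longrightarrow> e (k y) = y"
    using fin_gen_transport[OF mN mod_span_fin_gen[OF assms(2) G0]] by auto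
  obtain X' :: "('r, 'r test_carrier) module" and e' k' where X': "module R X'" "fin_gen_module R X'"
    "e' \<in> lin_maps R (Q\<lparr>carrier := ?N'\<rparr>) X'" "k' \<in> lin_maps R X' (Q\<lparr>carrier := ?N'\<rparr>)"
    "\<And>x. x \<in> ?N' \<Longrightarrow> k' (e' x) = x" "\<And>y. y \<in> carrier X' \<Longrightarrow> e' (k' y) = y"
    using fin_gen_transport[OF mN' mod_span_fin_gen[OF assms(2) GG0]] by auto
  have "(\<lambda>x. x) \<in> lin_maps R (Q\<lparr>carrier := ?N\<rparr>) (Q\<lparr>carrier := ?N'\<rparr>)"
    using lin_maps_restrict[OF lin_maps_id NQ] NN' by auto
  from lin_maps_comp[OF lin_maps_comp[OF X(4) this] X'(3)]
  have g: "(\<lambda>y. e' (k y)) \<in> lin_maps R X X'" .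
  have inj: "inj_on (\<lambda>y. e' (k y)) (carrier X)"
  proof (rule inj_on_inverseI[of _ "\<lambda>y. e (k' y)"])
    fix y assume "y \<in> carrier X"
    moreover from this have "k y \<in> ?N'"
      using lin_mapsD(1)[OF X(4)] NN' by auto
    ultimately show "e (k' (e' (k y))) = y"
      using X(6) X'(5) by simp
  qed
  have keys: "Poly_Mapping.keys ?c \<subseteq> ?N \<times> carrier M"
  proof (rule frag_map_keys_image[of _ "fst ` Poly_Mapping.keys c" "carrier M"])
    show "Poly_Mapping.keys c \<subseteq> fst ` Poly_Mapping.keys c \<times> carrier M"
      using assms(6) by force
  qed (use N(2) in \<open>auto simp: G0_def\<close>)
  have ke: "frag_map k (\<lambda>m. m) (frag_map e (\<lambda>m. m) ?c) = ?c"
    unfolding frag_map_comp[of k _ e] using X(5)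
    by (subst frag_map_cong[OF keys, of _ "\<lambda>x. x" _ "\<lambda>m. m"]) (auto simp: frag_map_id)
  have "frag_map e (\<lambda>m. m) ?c \<in> tensor_kernel R X M"
  proof -
    have 1: "Poly_Mapping.keys (frag_map e (\<lambda>m. m) ?c) \<subseteq> carrier X \<times> carrier M"
      using lin_mapsD(1)[OF X(3)] by (intro frag_map_keys_image[OF keys]) auto
    have "frag_map (\<lambda>y. e' (k y)) (\<lambda>m. m) (frag_map e (\<lambda>m. m) ?c) = frag_map e' (\<lambda>m. m) ?c"
      using ke frag_map_comp[of e' "\<lambda>m. m" k "\<lambda>m. m" "frag_map e (\<lambda>m. m) ?c"] by simp
    also have "\<dots> \<in> tensor_kernel R X' M"
      using G(3)[OF N'(1)] N'(2)
      by (intro frag_map_kernel[OF mN' assms(3) X'(1) assms(3) X'(3) lin_maps_id]) auto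
    finally show ?thesis
      using assms(4) 1 g inj X(1,2) X'(1,2) unfolding fg_flat_def by blast
  qed
  from frag_map_kernel[OF X(1) assms(3) mN assms(3) X(4) lin_maps_id this]
  have c: "?c \<in> tensor_kernel R (Q\<lparr>carrier := ?N\<rparr>) M"
    unfolding ke .
  let ?L = "{x \<in> carrier L. h x \<in> ?N}"
  have L: "submodule ?L R L"
    by (rule vimage_submodule[OF assms(1,2,5) N(1)])
  note mL = submodule.submodule_is_module[OF L assms(1)]
  have hL: "h \<in> lin_maps R (L\<lparr>carrier := ?L\<rparr>) (Q\<lparr>carrier := ?N\<rparr>)"
    by (rule lin_maps_restrict[OF assms(5)]) auto
  \<comment> \<open>The restriction of \<open>h\<close> to the preimage of \<open>?N\<close> maps onto \<open>?N\<close>.\<close>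
  have "?N \<subseteq> h ` carrier L"
  proof (rule N(3))
    show "submodule (h ` carrier L) R Q"
      by (rule image_submodule[OF assms(1,2,5) module.carrier_is_submodule[OF assms(1)]])
    show "G0 \<subseteq> h ` carrier L"
      unfolding G0_def using assms(6) by (auto intro!: imageI)
  qed
  then have surj: "h ` carrier (L\<lparr>carrier := ?L\<rparr>) = carrier (Q\<lparr>carrier := ?N\<rparr>)"
    by auto
  have "Poly_Mapping.keys c \<subseteq> carrier (L\<lparr>carrier := ?L\<rparr>) \<times> carrier M"
  proof
    fix p assume p: "p \<in> Poly_Mapping.keys c"
    then have "h (fst p) \<in> ?N" using N(2) by (auto simp: G0_def)
    moreover have "p \<in> carrier L \<times> carrier M" using p assms(6) by blast
    ultimately show "p \<in> carrier (L\<lparr>carrier := ?L\<rparr>) \<times> carrier M" by (cases p) simp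
  qed
  note c' = tensor_right_exact[OF mL mN assms(3) hL surj this c]
  have "(\<lambda>x. x) ` lin_ker (L\<lparr>carrier := ?L\<rparr>) (Q\<lparr>carrier := ?N\<rparr>) h \<subseteq> lin_ker L Q h"
    by (auto simp: lin_ker_def)
  from times_chains_map[OF mL assms(3,1,3) submodule_incl_lin[OF assms(1) L] lin_maps_id this c']
  show ?thesis by (simp only: frag_map_id)
qed

section \<open>Purity\<close>

text \<open>
  Injectivity of \<open>P \<rightarrow> S \<otimes> P\<close>, which is what purity of \<open>R \<rightarrow> S\<close> says about the module \<open>P\<close>.
\<close>

definition unit_faithful :: "('r, 'x) ring_scheme \<Rightarrow> ('s, 'y) ring_scheme \<Rightarrow> ('r \<Rightarrow> 's) \<Rightarrow> ('r, 'p, 'z) module_scheme \<Rightarrow> bool"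
  where "unit_faithful R S f P \<longleftrightarrow>
    (\<forall>p\<in>carrier P. frag_of (\<one>\<^bsub>S\<^esub>, p) \<in> tensor_kernel R (alg_module S f) P \<longrightarrow> p = \<zero>\<^bsub>P\<^esub>)"

lemma alg_module_self: "cring R \<Longrightarrow> module R (alg_module R (\<lambda>r. r))"
  by (rule alg_module_module)
    (simp add: ring_hom_cring_def ring_hom_cring_axioms_def ring_hom_def cring_def)

text \<open>
  This is injectivity of \<open>P \<rightarrow> R \<otimes> P\<close>. It is read off from the comparison of \<open>I P\<close> inside \<open>P\<close> and
  inside \<open>R \<otimes> P\<close>, for the ideal \<open>I = 0\<close>.
\<close>

lemma tensor_unit_zero:
  assumes "module R P" "p \<in> carrier P"
    and "frag_of (\<one>\<^bsub>R\<^esub>, p) \<in> tensor_kernel R (alg_module R (\<lambda>r. r)) P"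
  shows "p = \<zero>\<^bsub>P\<^esub>"
proof -
  interpret P: module R P by fact
  let ?A = "alg_module R (\<lambda>r. r)"
  note A = alg_module_self[OF P.R.is_cring]
  have sub: "submodule {\<zero>\<^bsub>R\<^esub>} R ?A"
    unfolding submodule_iff[OF A] by (auto simp: alg_module_def)
  have "pure_tensor R ?A P \<one>\<^bsub>R\<^esub> p \<in> submodule_times R ?A {\<zero>\<^bsub>R\<^esub>} P"
    unfolding pure_tensor_def submodule_times_chains[OF A assms(1) sub]
    by (rule times_chains_kernel[OF assms(3)])
  then have "p \<in> ideal_times {\<zero>\<^bsub>R\<^esub>} P"
    using ideal_times_eq[OF assms(1) P.R.zeroideal assms(2)] by simp
  moreover have "{a \<odot>\<^bsub>P\<^esub> x |a x. a \<in> {\<zero>\<^bsub>R\<^esub>} \<and> x \<in> carrier P} = {\<one>\<^bsub>add_monoid P\<^esub>}"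
    by (auto intro!: exI[of _ "\<zero>\<^bsub>P\<^esub>"])
  ultimately show ?thesis
    using group.generate_one[OF P.a_group] by (simp add: ideal_times_def)
qed

lemma unit_faithfulI:
  assumes "ring_hom_cring R S f" "module R P"
    and "inj_on (tensor_map R (alg_module R (\<lambda>r. r)) P (alg_module S f) P f (\<lambda>p. p))
      (carrier (tensor R (alg_module R (\<lambda>r. r)) P))"
  shows "unit_faithful R S f P"
  unfolding unit_faithful_def
proof (intro ballI impI)
  interpret f: ring_hom_cring R S f by fact
  fix p assume p: "p \<in> carrier P" "frag_of (\<one>\<^bsub>S\<^esub>, p) \<in> tensor_kernel R (alg_module S f) P"
  have "f \<in> lin_maps R (alg_module R (\<lambda>r. r)) (alg_module S f)"
    by (auto simp: lin_maps_def alg_module_def)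
  from inj_on_tensor_mapD[OF alg_module_self[OF f.R.is_cring] assms(2) alg_module_module[OF assms(1)] this
      assms(3), of "frag_of (\<one>\<^bsub>R\<^esub>, p)"]
  have "frag_of (\<one>\<^bsub>R\<^esub>, p) \<in> tensor_kernel R (alg_module R (\<lambda>r. r)) P"
    using p by (simp add: alg_module_def)
  with assms(2) p(1) show "p = \<zero>\<^bsub>P\<^esub>"
    by (rule tensor_unit_zero)
qed

text \<open>
  Purity is assumed for modules in the test type only. If \<open>1 \<otimes> p\<close> vanishes in \<open>S \<otimes> P\<close>, then it vanishes in
  \<open>S \<otimes> P\<^sub>0\<close> for some finitely generated submodule \<open>P\<^sub>0\<close> of \<open>P\<close> containing \<open>p\<close>, and \<open>P\<^sub>0\<close> has a
  copy in the test type.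
\<close>

lemma pure_imp_unit_faithful:
  fixes R :: "('r, 'x) ring_scheme"
  assumes "ring_hom_cring R S f" "pure_ring_hom TYPE('r test_carrier) R S f" "module R P"
  shows "unit_faithful R S f P"
  unfolding unit_faithful_def
proof (intro ballI impI)
  interpret f: ring_hom_cring R S f by fact
  interpret P: module R P by fact
  let ?S = "alg_module S f"
  note S = alg_module_module[OF assms(1)]
  fix p assume p: "p \<in> carrier P" "frag_of (\<one>\<^bsub>S\<^esub>, p) \<in> tensor_kernel R ?S P"
  obtain G H where GH: "finite G" "G \<subseteq> carrier ?S" "finite H" "H \<subseteq> carrier P"
    "\<forall>U V. submodule U R ?S \<and> G \<subseteq> U \<and> submodule V R P \<and> H \<subseteq> V \<longrightarrow>
      frag_of (\<one>\<^bsub>S\<^esub>, p) \<in> tensor_kernel R (?S\<lparr>carrier := U\<rparr>) (P\<lparr>carrier := V\<rparr>)"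
    using tensor_kernel_finite_support[OF S assms(3) p(2)] by blast
  have fin: "finite (insert p H)" "insert p H \<subseteq> carrier P" using GH p by auto
  let ?N = "mod_span R P (insert p H)"
  note N = mod_span[OF assms(3) fin(2)]
  note mN = submodule.submodule_is_module[OF N(1) assms(3)]
  have 1: "frag_of (\<one>\<^bsub>S\<^esub>, p) \<in> tensor_kernel R ?S (P\<lparr>carrier := ?N\<rparr>)"
    using GH(5)[rule_format, of "carrier ?S" ?N] GH(2) N(1,2) module.carrier_is_submodule[OF S]
    by simp
  obtain X :: "('r, 'r test_carrier) module" and e k where X: "module R X" "fin_gen_module R X"
    "e \<in> lin_maps R (P\<lparr>carrier := ?N\<rparr>) X" "k \<in> lin_maps R X (P\<lparr>carrier := ?N\<rparr>)"
    "\<And>x. x \<in> ?N \<Longrightarrow> k (e x) = x" "\<And>y. y \<in> carrier X \<Longrightarrow> e (k y) = y"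
    using fin_gen_transport[OF mN mod_span_fin_gen[OF assms(3) fin]] by auto
  have "unit_faithful R S f X"
    using assms(2) X(1) unfolding pure_ring_hom_def pure_map_def
    by (intro unit_faithfulI assms(1)) auto
  moreover have "frag_of (\<one>\<^bsub>S\<^esub>, e p) \<in> tensor_kernel R ?S X"
    using frag_map_kernel[OF S mN S X(1) lin_maps_id X(3) 1] by simp
  moreover have pN: "p \<in> ?N" using N(2) by simp
  ultimately have "e p = \<zero>\<^bsub>X\<^esub>"
    using lin_mapsD(1)[OF X(3)] unfolding unit_faithful_def by simp
  then have "p = k \<zero>\<^bsub>X\<^esub>" using X(5)[OF pN] by simp
  then show "p = \<zero>\<^bsub>P\<^esub>" using lin_maps_zero[OF X(1) mN X(4)] by simp
qed

section \<open>Restriction and extension of scalars\<close>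

definition restrict_scalars :: "('r \<Rightarrow> 's) \<Rightarrow> ('s, 'q, 'z) module_scheme \<Rightarrow> ('r, 'q) module"
  where "restrict_scalars f Q =
    \<lparr>carrier = carrier Q, mult = monoid.mult Q, one = one Q, zero = zero Q, add = add Q,
     smult = (\<lambda>r q. f r \<odot>\<^bsub>Q\<^esub> q)\<rparr>"

lemma restrict_scalars_simps [simp]:
  "carrier (restrict_scalars f Q) = carrier Q" "zero (restrict_scalars f Q) = zero Q"
  "add (restrict_scalars f Q) = add Q" "r \<odot>\<^bsub>restrict_scalars f Q\<^esub> q = f r \<odot>\<^bsub>Q\<^esub> q"
  by (simp_all add: restrict_scalars_def)

lemma alg_module_simps [simp]:
  "carrier (alg_module S f) = carrier S" "zero (alg_module S f) = zero S"
  "add (alg_module S f) = add S" "r \<odot>\<^bsub>alg_module S f\<^esub> s = f r \<otimes>\<^bsub>S\<^esub> s"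
  by (simp_all add: alg_module_def)

lemma restrict_scalars_module:
  assumes "ring_hom_cring R S f" "module S Q"
  shows "module R (restrict_scalars f Q)"
proof -
  interpret f: ring_hom_cring R S f by fact
  interpret Q: module S Q by fact
  show ?thesis
  proof (rule moduleI)
    show "abelian_group (restrict_scalars f Q)"
      by (rule abelian_groupI) (auto simp: Q.M.a_ac intro: Q.M.add.l_inv_ex)
  qed (auto simp: f.R.is_cring Q.smult_l_distr Q.smult_r_distr Q.smult_assoc1)
qed

lemma restrict_scalars_submodule:
  assumes "ring_hom_cring R S f" "module S Q" "submodule V S Q"
  shows "submodule V R (restrict_scalars f Q)"
proof -
  interpret f: ring_hom_cring R S f by fact
  show ?thesis
    using assms(3) unfolding submodule_iff[OF assms(2)]
      submodule_iff[OF restrict_scalars_module[OF assms(1,2)]] by auto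
qed

lemma restrict_scalars_kernel:
  assumes "ring_hom_cring R S f" "module S P" "module S Q"
    and "c \<in> tensor_kernel R (restrict_scalars f P) (restrict_scalars f Q)"
  shows "c \<in> tensor_kernel S P Q"
proof -
  interpret f: ring_hom_cring R S f by fact
  note K = tensor_kernel_closed[OF assms(2,3)] and rels = tensor_kernel_rels[OF assms(2,3)]
  have "frag_extend frag_of c \<in> tensor_kernel S P Q"
    by (rule frag_extend_kernel[OF restrict_scalars_module[OF assms(1,2)]
      restrict_scalars_module[OF assms(1,3)] assms(4)]) (auto intro: K rels)
  then show ?thesis by (simp flip: frag_expansion)
qed

abbreviation bc_unit ::
  "('r, 'x) ring_scheme \<Rightarrow> ('s, 'y) ring_scheme \<Rightarrow> ('r \<Rightarrow> 's) \<Rightarrow> ('r, 'm, 'z) module_scheme \<Rightarrow>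
   'm \<Rightarrow> ('s \<times> 'm \<Rightarrow>\<^sub>0 int) set"
  where "bc_unit R S f M m \<equiv> pure_tensor R (alg_module S f) M \<one>\<^bsub>S\<^esub> m"

lemma mult_lin_alg:
  assumes "ring_hom_cring R S f" "a \<in> carrier S"
  shows "monoid.mult S a \<in> lin_maps R (alg_module S f) (alg_module S f)"
proof -
  interpret f: ring_hom_cring R S f by fact
  show ?thesis using assms(2) by (auto simp: lin_maps_def f.S.r_distr f.S.m_lcomm)
qed

lemma base_change_simps:
  assumes "ring_hom_cring R S f" "module R M"
  shows "carrier (base_change R S f M) =
      tensor_coset R (alg_module S f) M ` {c. Poly_Mapping.keys c \<subseteq> carrier S \<times> carrier M}"
    and "zero (base_change R S f M) = tensor_coset R (alg_module S f) M 0"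
    and "Poly_Mapping.keys c \<subseteq> carrier S \<times> carrier M \<Longrightarrow>
      Poly_Mapping.keys d \<subseteq> carrier S \<times> carrier M \<Longrightarrow>
      tensor_coset R (alg_module S f) M c \<oplus>\<^bsub>base_change R S f M\<^esub> tensor_coset R (alg_module S f) M d =
      tensor_coset R (alg_module S f) M (c + d)"
    and "a \<in> carrier S \<Longrightarrow>
      a \<odot>\<^bsub>base_change R S f M\<^esub> tensor_coset R (alg_module S f) M c =
      tensor_coset R (alg_module S f) M (frag_map (\<lambda>s. a \<otimes>\<^bsub>S\<^esub> s) (\<lambda>m. m) c)"
  unfolding base_change_def
  using tensor_by_simps(1-3)[OF alg_module_module[OF assms(1)] assms(2)]
    tensor_by_simps(4)[OF alg_module_module[OF assms(1)] assms(2), of "monoid.mult S",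
      OF mult_lin_alg[OF assms(1)]]
  by simp_all

lemmas base_change_eq_iff = tensor_coset_eq_iff[OF alg_module_module]

lemma frag_map_mult_keys:
  assumes "ring_hom_cring R S f" "a \<in> carrier S" "Poly_Mapping.keys c \<subseteq> carrier S \<times> carrier M"
  shows "Poly_Mapping.keys (frag_map (\<lambda>s. a \<otimes>\<^bsub>S\<^esub> s) (\<lambda>m. m) c) \<subseteq> carrier S \<times> carrier M"
proof -
  interpret f: ring_hom_cring R S f by fact
  show ?thesis using assms by (intro frag_map_keys_image[OF assms(3)]) auto
qed

lemma bc_unit_lin:
  assumes "ring_hom_cring R S f" "module R M"
  shows "bc_unit R S f M \<in> lin_maps R M (restrict_scalars f (base_change R S f M))"
proof -
  interpret f: ring_hom_cring R S f by fact
  interpret M: module R M by fact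
  note simps = base_change_simps[OF assms] and eq = base_change_eq_iff[OF assms]
  note K = tensor_kernel_closed[OF alg_module_module[OF assms(1)] assms(2)]
    and rels = tensor_kernel_rels[OF alg_module_module[OF assms(1)] assms(2)]
  show ?thesis
    unfolding lin_maps_def
  proof (intro CollectI conjI ballI)
    fix x y assume "x \<in> carrier M" "y \<in> carrier M"
    then show "bc_unit R S f M (x \<oplus>\<^bsub>M\<^esub> y) =
      bc_unit R S f M x \<oplus>\<^bsub>restrict_scalars f (base_change R S f M)\<^esub> bc_unit R S f M y"
      using rels(2)[of "\<one>\<^bsub>S\<^esub>" x y] by (simp add: pure_tensor_def simps eq algebra_simps)
  next
    fix r x assume "r \<in> carrier R" "x \<in> carrier M"
    then show "bc_unit R S f M (r \<odot>\<^bsub>M\<^esub> x) =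
      r \<odot>\<^bsub>restrict_scalars f (base_change R S f M)\<^esub> bc_unit R S f M x"
      using K(2)[OF rels(3)[of r "\<one>\<^bsub>S\<^esub>" x]] by (simp add: pure_tensor_def simps eq)
  qed (auto simp: pure_tensor_def simps)
qed

text \<open>
  A formal sum representing an element of \<open>S \<otimes> M\<close>. Maps out of the iterated tensor product
  \<open>Q \<otimes>\<^sub>S (S \<otimes>\<^sub>R M)\<close> are defined on representatives, which is legitimate because representatives are additive and
  \<open>S\<close>-linear modulo the relations.
\<close>

definition bc_rep ::
  "('r, 'x) ring_scheme \<Rightarrow> ('s, 'y) ring_scheme \<Rightarrow> ('r \<Rightarrow> 's) \<Rightarrow> ('r, 'm, 'z) module_scheme \<Rightarrow>
   ('s \<times> 'm \<Rightarrow>\<^sub>0 int) set \<Rightarrow> ('s \<times> 'm \<Rightarrow>\<^sub>0 int)"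
  where "bc_rep R S f M t = (SOME c. Poly_Mapping.keys c \<subseteq> carrier S \<times> carrier M \<and>
    tensor_coset R (alg_module S f) M c = t)"

lemma bc_rep:
  assumes "ring_hom_cring R S f" "module R M" "t \<in> carrier (base_change R S f M)"
  shows "Poly_Mapping.keys (bc_rep R S f M t) \<subseteq> carrier S \<times> carrier M"
    "tensor_coset R (alg_module S f) M (bc_rep R S f M t) = t"
proof -
  have "\<exists>c. Poly_Mapping.keys c \<subseteq> carrier S \<times> carrier M \<and> tensor_coset R (alg_module S f) M c = t"
    using assms(3) unfolding base_change_simps(1)[OF assms(1,2)] by blast
  from someI_ex[OF this, folded bc_rep_def]
  show "Poly_Mapping.keys (bc_rep R S f M t) \<subseteq> carrier S \<times> carrier M"
    "tensor_coset R (alg_module S f) M (bc_rep R S f M t) = t" by auto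
qed

lemma bc_rep_coset:
  assumes "ring_hom_cring R S f" "module R M" "Poly_Mapping.keys c \<subseteq> carrier S \<times> carrier M"
  shows "bc_rep R S f M (tensor_coset R (alg_module S f) M c) - c \<in> tensor_kernel R (alg_module S f) M"
proof -
  have "tensor_coset R (alg_module S f) M c \<in> carrier (base_change R S f M)"
    using assms by (auto simp: base_change_simps)
  from bc_rep(2)[OF assms(1,2) this] show ?thesis
    by (simp add: base_change_eq_iff[OF assms(1,2)])
qed

lemma bc_rep_add:
  assumes "ring_hom_cring R S f" "module R M" "t \<in> carrier (base_change R S f M)"
    "u \<in> carrier (base_change R S f M)"
  shows "bc_rep R S f M (t \<oplus>\<^bsub>base_change R S f M\<^esub> u) - bc_rep R S f M t - bc_rep R S f M u
    \<in> tensor_kernel R (alg_module S f) M"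
proof -
  note t = bc_rep[OF assms(1,2,3)] and u = bc_rep[OF assms(1,2,4)]
  have "t \<oplus>\<^bsub>base_change R S f M\<^esub> u =
    tensor_coset R (alg_module S f) M (bc_rep R S f M t + bc_rep R S f M u)"
    using base_change_simps(3)[OF assms(1,2) t(1) u(1)] t(2) u(2) by simp
  moreover have "Poly_Mapping.keys (bc_rep R S f M t + bc_rep R S f M u) \<subseteq> carrier S \<times> carrier M"
    using keys_add[of "bc_rep R S f M t" "bc_rep R S f M u"] t(1) u(1) by blast
  ultimately show ?thesis
    using bc_rep_coset[OF assms(1,2), of "bc_rep R S f M t + bc_rep R S f M u"]
    by (simp add: diff_diff_eq)
qed

lemma bc_rep_smult:
  assumes "ring_hom_cring R S f" "module R M" "a \<in> carrier S" "t \<in> carrier (base_change R S f M)"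
  shows "bc_rep R S f M (a \<odot>\<^bsub>base_change R S f M\<^esub> t) -
    frag_map (\<lambda>s. a \<otimes>\<^bsub>S\<^esub> s) (\<lambda>m. m) (bc_rep R S f M t) \<in> tensor_kernel R (alg_module S f) M"
proof -
  note t = bc_rep[OF assms(1,2,4)]
  have "a \<odot>\<^bsub>base_change R S f M\<^esub> t =
    tensor_coset R (alg_module S f) M (frag_map (\<lambda>s. a \<otimes>\<^bsub>S\<^esub> s) (\<lambda>m. m) (bc_rep R S f M t))"
    using base_change_simps(4)[OF assms(1,2,3), of "bc_rep R S f M t"] t(2) by simp
  with bc_rep_coset[OF assms(1,2) frag_map_mult_keys[OF assms(1,3) t(1)]] show ?thesis
    by simp
qed

lemma base_change_generated:
  assumes "ring_hom_cring R S f" "module R M" "submodule V S (base_change R S f M)"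
    and "\<And>m. m \<in> carrier M \<Longrightarrow> bc_unit R S f M m \<in> V"
  shows "V = carrier (base_change R S f M)"
proof -
  interpret f: ring_hom_cring R S f by fact
  note simps = base_change_simps[OF assms(1,2)]
  note bc = base_change_module[OF assms(1,2)]
  interpret B: module S "base_change R S f M" by fact
  note V = assms(3)[unfolded submodule_iff[OF bc]]
  let ?co = "tensor_coset R (alg_module S f) M"
  have "Poly_Mapping.keys c \<subseteq> carrier S \<times> carrier M \<and> ?co c \<in> V"
    if "Poly_Mapping.keys c \<subseteq> carrier S \<times> carrier M" for c
    using that
  proof (induction c rule: frag_induction)
    case zero
    then show ?case using V simps(2) by simp
  next
    case (one p)
    then obtain s m where sm: "p = (s, m)" "s \<in> carrier S" "m \<in> carrier M" by auto
    have "s \<odot>\<^bsub>base_change R S f M\<^esub> bc_unit R S f M m = ?co (frag_of p)"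
      using sm by (simp add: pure_tensor_def simps)
    then show ?case using V assms(4) sm by force
  next
    case (diff a b)
    have neg: "Poly_Mapping.keys (- b) \<subseteq> carrier S \<times> carrier M" using diff by simp
    have "?co b \<in> carrier (base_change R S f M)" using diff V by blast
    moreover have "?co (- b) \<in> carrier (base_change R S f M)" using neg by (auto simp: simps(1))
    moreover have "?co (- b) \<oplus>\<^bsub>base_change R S f M\<^esub> ?co b = \<zero>\<^bsub>base_change R S f M\<^esub>"
      using simps(3)[OF neg, of b] diff by (simp add: simps(2))
    ultimately have "\<ominus>\<^bsub>base_change R S f M\<^esub> ?co b = ?co (- b)"
      using B.M.minus_equality by blast
    then have "?co (- b) \<in> V"
      using B.submoduleE(3)[OF assms(3), of "?co b"] diff by simp
    then have "?co a \<oplus>\<^bsub>base_change R S f M\<^esub> ?co (- b) \<in> V"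
      using V diff by blast
    then show ?case
      using simps(3)[OF _ neg, of a] diff keys_diff[of a b] by auto
  qed
  then have "carrier (base_change R S f M) \<subseteq> V"
    unfolding simps(1) by blast
  then show ?thesis using V by blast
qed

lemma base_change_fin_gen:
  assumes "ring_hom_cring R S f" "module R M" "fin_gen_module R M"
  shows "fin_gen_module S (base_change R S f M)"
proof -
  note bc = base_change_module[OF assms(1,2)] and u = bc_unit_lin[OF assms(1,2)]
  obtain G where G: "finite G" "G \<subseteq> carrier M"
      "\<forall>U. submodule U R M \<and> G \<subseteq> U \<longrightarrow> U = carrier M"
    using assms(3) unfolding fin_gen_module_iff[OF assms(2)] by blast
  have "V = carrier (base_change R S f M)"
    if V: "submodule V S (base_change R S f M)" "bc_unit R S f M ` G \<subseteq> V" for V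
  proof (rule base_change_generated[OF assms(1,2) V(1)])
    have "{m \<in> carrier M. bc_unit R S f M m \<in> V} = carrier M"
      using G(2) V(2) vimage_submodule[OF assms(2) restrict_scalars_module[OF assms(1) bc] u
        restrict_scalars_submodule[OF assms(1) bc V(1)]]
      by (intro G(3)[rule_format]) auto
    then show "bc_unit R S f M m \<in> V" if "m \<in> carrier M" for m using that by blast
  qed
  then show ?thesis
    unfolding fin_gen_module_iff[OF bc]
    using G(1,2) lin_mapsD(1)[OF u] by (intro exI[of _ "bc_unit R S f M ` G"]) auto
qed

definition bc_map ::
  "('r, 'x) ring_scheme \<Rightarrow> ('s, 'y) ring_scheme \<Rightarrow> ('r \<Rightarrow> 's) \<Rightarrow> ('r, 'm, 'z) module_scheme \<Rightarrow>
   ('r, 'n, 'w) module_scheme \<Rightarrow> ('m \<Rightarrow> 'n) \<Rightarrow> ('s \<times> 'm \<Rightarrow>\<^sub>0 int) set \<Rightarrow> ('s \<times> 'n \<Rightarrow>\<^sub>0 int) set"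
  where "bc_map R S f M N g = tensor_map R (alg_module S f) M (alg_module S f) N (\<lambda>s. s) g"

lemma bc_map_coset:
  assumes "ring_hom_cring R S f" "module R M" "module R N" "g \<in> lin_maps R M N"
  shows "bc_map R S f M N g (tensor_coset R (alg_module S f) M c) =
    tensor_coset R (alg_module S f) N (frag_map (\<lambda>s. s) g c)"
  unfolding bc_map_def
  by (rule tensor_map_coset[OF alg_module_module[OF assms(1)] assms(2)
      alg_module_module[OF assms(1)] assms(3) lin_maps_id assms(4)])

lemma bc_map_unit:
  assumes "ring_hom_cring R S f" "module R M" "module R N" "g \<in> lin_maps R M N"
  shows "bc_map R S f M N g (bc_unit R S f M m) = bc_unit R S f N (g m)"
  unfolding pure_tensor_def bc_map_coset[OF assms] by simp

lemma bc_map_lin: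
  assumes "ring_hom_cring R S f" "module R M" "module R N" "g \<in> lin_maps R M N"
  shows "bc_map R S f M N g \<in> lin_maps S (base_change R S f M) (base_change R S f N)"
proof -
  note M = base_change_simps[OF assms(1,2)] and N = base_change_simps[OF assms(1,3)]
  have keys: "Poly_Mapping.keys (frag_map (\<lambda>s. s) g c) \<subseteq> carrier S \<times> carrier N"
    if "Poly_Mapping.keys c \<subseteq> carrier S \<times> carrier M" for c
    using lin_mapsD(1)[OF assms(4)] by (intro frag_map_keys_image[OF that]) auto
  show ?thesis
    unfolding lin_maps_def
    by (auto simp: M N bc_map_coset[OF assms] keys frag_extend_add frag_map_comp)
qed

lemma base_change_times_chains:
  assumes "ring_hom_cring R S f" "module R M" "module R L" "module S Q"
    and "h \<in> lin_maps R L (restrict_scalars f Q)" "c \<in> times_chains R L U M" "h ` U \<subseteq> V"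
  shows "frag_map h (bc_unit R S f M) c \<in> times_chains S Q V (base_change R S f M)"
proof -
  note bc = base_change_module[OF assms(1,2)]
  note r = restrict_scalars_module[OF assms(1,4)] restrict_scalars_module[OF assms(1) bc]
  have "frag_map h (bc_unit R S f M) c \<in>
    times_chains R (restrict_scalars f Q) V (restrict_scalars f (base_change R S f M))"
    by (rule times_chains_map[OF assms(3,2) r assms(5) bc_unit_lin[OF assms(1,2)] assms(7,6)])
  then show ?thesis
    using restrict_scalars_kernel[OF assms(1,4) bc] by (auto simp: times_chains_def)
qed

text \<open>
  The isomorphism of \<open>Q \<otimes>\<^sub>S (S \<otimes>\<^sub>R M)\<close> with \<open>Q \<otimes>\<^sub>R M\<close>, in the one direction that matters:
  \<open>q \<otimes> (s \<otimes> m) \<mapsto> s q \<otimes> m\<close> is well defined, sends \<open>q \<otimes> (1 \<otimes> m)\<close> to \<open>q \<otimes> m\<close> and preserves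
  the elements that come from the \<open>S\<close>-submodule \<open>V\<close>.
\<close>

lemma base_change_adjoint:
  fixes S :: "('s, 'y) ring_scheme" and M :: "('r, 'm, 'z) module_scheme"
  assumes "ring_hom_cring R S f" "module R M" "module S Q" "submodule V S Q"
    and "Poly_Mapping.keys c \<subseteq> carrier Q \<times> carrier M"
    and "frag_map (\<lambda>q. q) (bc_unit R S f M) c \<in> times_chains S Q V (base_change R S f M)"
  shows "c \<in> times_chains R (restrict_scalars f Q) V M"
proof -
  interpret f: ring_hom_cring R S f by fact
  interpret M: module R M by fact
  interpret Q: module S Q by fact
  let ?B = "base_change R S f M" and ?Q = "restrict_scalars f Q" and ?S = "alg_module S f"
  note bc = base_change_module[OF assms(1,2)] and mQ = restrict_scalars_module[OF assms(1,3)]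
  note S = alg_module_module[OF assms(1)]
  interpret B: module S ?B by fact
  note K = tensor_kernel_closed[OF mQ assms(2)] and rels = tensor_kernel_rels[OF mQ assms(2)]
  define a where "a q d = frag_map (\<lambda>s. s \<odot>\<^bsub>Q\<^esub> q) (\<lambda>m. m) d" for q and d :: "'s \<times> 'm \<Rightarrow>\<^sub>0 int"
  have a_diff: "a q (d - e) = a q d - a q e" for q d e
    by (simp add: a_def frag_extend_diff)
  have a_kernel: "a q d \<in> tensor_kernel R ?Q M" if "d \<in> tensor_kernel R ?S M" "q \<in> carrier Q" for q d
    unfolding a_def
    by (rule frag_map_kernel[OF S assms(2) mQ assms(2) _ lin_maps_id that(1)])
      (use that in \<open>auto simp: lin_maps_def Q.smult_l_distr Q.smult_assoc1\<close>)
  \<comment> \<open>For fixed \<open>q\<close>, the map \<open>a q\<close> represents \<open>s \<otimes> m \<mapsto> s q \<otimes> m\<close>.\<close>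
  define \<psi> where "\<psi> = (\<lambda>(q, t). a q (bc_rep R S f M t))"
  have ker: "frag_extend \<psi> d \<in> tensor_kernel R ?Q M" if "d \<in> tensor_kernel S Q ?B" for d
  proof (rule frag_extend_kernel[OF assms(3) bc that K(1) K(4)])
    fix q q' t assume q: "q \<in> carrier Q" "q' \<in> carrier Q" "t \<in> carrier ?B"
    have "a (q \<oplus>\<^bsub>Q\<^esub> q') d - a q d - a q' d \<in> tensor_kernel R ?Q M"
      if "Poly_Mapping.keys d \<subseteq> carrier S \<times> carrier M" for d
      using that
    proof (induction d rule: frag_induction)
      case (one p)
      then show ?case
        using q rels(1) by (auto simp: a_def Q.smult_r_distr)
    next
      case (diff b d)
      from K(4)[OF diff] show ?case by (simp add: a_diff algebra_simps)
    qed (use K(1) in \<open>simp add: a_def\<close>)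
    then show "\<psi> (q \<oplus>\<^bsub>Q\<^esub> q', t) - \<psi> (q, t) - \<psi> (q', t) \<in> tensor_kernel R ?Q M"
      using bc_rep(1)[OF assms(1,2) q(3)] by (simp add: \<psi>_def)
  next
    fix q t u assume q: "q \<in> carrier Q" "t \<in> carrier ?B" "u \<in> carrier ?B"
    from a_kernel[OF bc_rep_add[OF assms(1,2) q(2,3)] q(1)]
    show "\<psi> (q, t \<oplus>\<^bsub>?B\<^esub> u) - \<psi> (q, t) - \<psi> (q, u) \<in> tensor_kernel R ?Q M"
      by (simp add: \<psi>_def a_diff)
  next
    fix r q t assume q: "r \<in> carrier S" "q \<in> carrier Q" "t \<in> carrier ?B"
    have "a q (frag_map (\<lambda>s. r \<otimes>\<^bsub>S\<^esub> s) (\<lambda>m. m) (bc_rep R S f M t)) = a (r \<odot>\<^bsub>Q\<^esub> q) (bc_rep R S f M t)"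
      unfolding a_def frag_map_comp
      by (rule frag_map_cong[OF bc_rep(1)[OF assms(1,2) q(3)]])
        (use q in \<open>auto simp: Q.smult_assoc1 f.S.m_comm[of r]\<close>)
    with K(2)[OF a_kernel[OF bc_rep_smult[OF assms(1,2) q(1,3)] q(2)]]
    show "\<psi> (r \<odot>\<^bsub>Q\<^esub> q, t) - \<psi> (q, r \<odot>\<^bsub>?B\<^esub> t) \<in> tensor_kernel R ?Q M"
      by (simp add: \<psi>_def a_diff)
  qed
  obtain d where d: "Poly_Mapping.keys d \<subseteq> V \<times> carrier ?B"
    "frag_map (\<lambda>q. q) (bc_unit R S f M) c - d \<in> tensor_kernel S Q ?B"
    using assms(6) unfolding times_chains_def by blast
  note V = assms(4)[unfolded submodule_iff[OF assms(3)]]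
  have 1: "frag_extend \<psi> d \<in> times_chains R ?Q V M"
  proof (rule frag_extend_mem[OF d(1) times_chains_zero[OF mQ assms(2)] times_chains_diff[OF mQ assms(2)]])
    fix p assume "p \<in> V \<times> carrier ?B"
    then obtain q t where p: "p = (q, t)" "q \<in> V" "t \<in> carrier ?B" by auto
    have "Poly_Mapping.keys (a q (bc_rep R S f M t)) \<subseteq> V \<times> carrier M"
      unfolding a_def using p V by (intro frag_map_keys_image[OF bc_rep(1)[OF assms(1,2) p(3)]]) auto
    then show "\<psi> p \<in> times_chains R ?Q V M"
      unfolding p \<psi>_def by (auto intro: times_chains_of_keys[OF mQ assms(2)])
  qed
  have 2: "frag_extend \<psi> (frag_map (\<lambda>q. q) (bc_unit R S f M) c) - c \<in> tensor_kernel R ?Q M"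
    using assms(5)
  proof (induction c rule: frag_induction)
    case (one p)
    then obtain q m where p: "p = (q, m)" "q \<in> carrier Q" "m \<in> carrier M" by auto
    have "bc_rep R S f M (bc_unit R S f M m) - frag_of (\<one>\<^bsub>S\<^esub>, m) \<in> tensor_kernel R ?S M"
      unfolding pure_tensor_def using p by (intro bc_rep_coset[OF assms(1,2)]) auto
    from a_kernel[OF this p(2)] show ?case
      using p by (simp add: \<psi>_def a_diff) (simp add: a_def)
  next
    case (diff a b)
    from K(4)[OF diff] show ?case by (simp add: frag_extend_diff algebra_simps)
  qed (use K(1) in simp)
  note T = times_chains_add[OF mQ assms(2)] times_chains_diff[OF mQ assms(2)]
    times_chains_kernel[of _ R ?Q M V]
  have "frag_extend \<psi> (frag_map (\<lambda>q. q) (bc_unit R S f M) c) \<in> times_chains R ?Q V M"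
    using T(1)[OF T(3)[OF ker[OF d(2)]] 1] by (simp add: frag_extend_diff)
  from T(2)[OF this T(3)[OF 2]] show ?thesis by simp
qed

text \<open>
  The induced map from \<open>L / U\<close> to \<open>Q / V\<close> is injective, where \<open>U\<close> is the preimage of \<open>V\<close>; so
  \<open>(L / U) \<otimes> M \<rightarrow> (Q / V) \<otimes> M\<close> is injective by flatness, and the image of \<open>c\<close> in its target is zero.
\<close>

lemma flat_contraction:
  fixes R :: "('r, 'x) ring_scheme" and Q :: "('s, 'q, 'w) module_scheme"
  assumes "ring_hom_cring R S f" "module R M" "module R L" "module S Q" "fg_flat R M"
    and "h \<in> lin_maps R L (restrict_scalars f Q)" "submodule V S Q"
    and "Poly_Mapping.keys c \<subseteq> carrier L \<times> carrier M"
    and "frag_map h (bc_unit R S f M) c \<in> times_chains S Q V (base_change R S f M)"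
  shows "c \<in> times_chains R L {l \<in> carrier L. h l \<in> V} M"
proof -
  note mQ = restrict_scalars_module[OF assms(1,4)]
  have "frag_map (\<lambda>q. q) (bc_unit R S f M) (frag_map h (\<lambda>m. m) c) \<in> times_chains S Q V (base_change R S f M)"
    using assms(9) by (simp add: frag_map_comp)
  moreover have "Poly_Mapping.keys (frag_map h (\<lambda>m. m) c) \<subseteq> carrier Q \<times> carrier M"
    using lin_mapsD(1)[OF assms(6)] by (intro frag_map_keys_image[OF assms(8)]) auto
  ultimately have c: "frag_map h (\<lambda>m. m) c \<in> times_chains R (restrict_scalars f Q) V M"
    by (intro base_change_adjoint[OF assms(1,2,4,7)])
  obtain P :: "('r, 'q set) module" and g where P: "module R P"
    "carrier P = g ` carrier (restrict_scalars f Q)"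
    "g \<in> lin_maps R (restrict_scalars f Q) P" "lin_ker (restrict_scalars f Q) P g = V"
    using quotient_exists[OF mQ restrict_scalars_submodule[OF assms(1,4,7)]] by metis
  have "frag_map g (\<lambda>m. m) (frag_map h (\<lambda>m. m) c) \<in> times_chains R P {\<zero>\<^bsub>P\<^esub>} M"
    by (rule times_chains_map[OF mQ assms(2) P(1) assms(2) P(3) lin_maps_id _ c])
      (use P(4) in \<open>auto simp: lin_ker_def\<close>)
  then have "frag_map (\<lambda>l. g (h l)) (\<lambda>m. m) c \<in> tensor_kernel R P M"
    by (simp add: frag_map_comp times_chains_eq_kernel[OF P(1) assms(2)])
  from fg_flat_exact[OF assms(3) P(1) assms(2,5) lin_maps_comp[OF assms(6) P(3)] assms(8) this]
  have "c \<in> times_chains R L (lin_ker L P (\<lambda>l. g (h l))) M" .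
  also have "lin_ker L P (\<lambda>l. g (h l)) = {l \<in> carrier L. h l \<in> V}"
    using lin_mapsD(1)[OF assms(6)] unfolding P(4)[symmetric] by (auto simp: lin_ker_def)
  finally show ?thesis .
qed

text \<open>
  The map \<open>\<chi>\<close> plays the role of the natural map from \<open>S \<otimes> L\<close> to \<open>S \<otimes> L / U\<close>; it kills the \<open>S\<close>-span of \<open>U\<close>.
  Keeping \<open>Q\<close> and \<open>\<chi>\<close> abstract allows \<open>Q = S\<close> for \<open>L = R\<close>, without passing through \<open>S \<otimes> R\<close>.
\<close>

lemma unit_faithful_contraction:
  assumes "ring_hom_cring R S f" "module R L" "module R P" "unit_faithful R S f P"
    and "\<pi> \<in> lin_maps R L P" "lin_ker L P \<pi> = U"
    and "module S Q" "\<chi> \<in> lin_maps S Q (base_change R S f P)" "h \<in> carrier L \<rightarrow> carrier Q"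
    and "\<And>l. l \<in> carrier L \<Longrightarrow> \<chi> (h l) = bc_unit R S f P (\<pi> l)"
    and "l \<in> carrier L" "h l \<in> mod_span S Q (h ` U)"
  shows "l \<in> U"
proof -
  note bc = base_change_module[OF assms(1,3)]
  have "h ` U \<subseteq> lin_ker Q (base_change R S f P) \<chi>"
  proof
    fix q assume "q \<in> h ` U"
    then obtain u where u: "u \<in> carrier L" "\<pi> u = \<zero>\<^bsub>P\<^esub>" "q = h u"
      using assms(6) by (auto simp: lin_ker_def)
    have "bc_unit R S f P \<zero>\<^bsub>P\<^esub> = \<zero>\<^bsub>base_change R S f P\<^esub>"
      using lin_maps_zero[OF assms(3) restrict_scalars_module[OF assms(1) bc] bc_unit_lin[OF assms(1,3)]]
      by simp
    then show "q \<in> lin_ker Q (base_change R S f P) \<chi>"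
      using u assms(9) assms(10)[OF u(1)] by (auto simp: lin_ker_def)
  qed
  moreover have "h ` U \<subseteq> carrier Q"
    using assms(6,9) by (auto simp: lin_ker_def)
  ultimately have "mod_span S Q (h ` U) \<subseteq> lin_ker Q (base_change R S f P) \<chi>"
    by (intro mod_span(3) lin_ker_submodule assms(7,8) bc)
  then have "bc_unit R S f P (\<pi> l) = \<zero>\<^bsub>base_change R S f P\<^esub>"
    using assms(10-12) by (auto simp: lin_ker_def)
  then have "frag_of (\<one>\<^bsub>S\<^esub>, \<pi> l) \<in> tensor_kernel R (alg_module S f) P"
    by (simp add: pure_tensor_def base_change_simps(2)[OF assms(1,3)] base_change_eq_iff[OF assms(1,3)])
  then have "\<pi> l = \<zero>\<^bsub>P\<^esub>"
    using assms(4,11) lin_mapsD(1)[OF assms(5)] unfolding unit_faithful_def by blast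
  then show ?thesis using assms(6,11) by (auto simp: lin_ker_def)
qed

section \<open>Consequences of intersection flatness\<close>

lemma times_chains_mono: "U \<subseteq> V \<Longrightarrow> times_chains R L U M \<subseteq> times_chains R L V M"
  unfolding times_chains_def by blast

lemma intersection_equality_iff:
  assumes "module R L" "module R M" "\<And>U. U \<in> \<U> \<Longrightarrow> submodule U R L"
  shows "submodule_times R L (carrier L \<inter> \<Inter>\<U>) M =
      carrier (tensor R L M) \<inter> (\<Inter>U\<in>\<U>. submodule_times R L U M) \<longleftrightarrow>
    (\<forall>c. Poly_Mapping.keys c \<subseteq> carrier L \<times> carrier M \<and> (\<forall>U\<in>\<U>. c \<in> times_chains R L U M) \<longrightarrow>
      c \<in> times_chains R L (carrier L \<inter> \<Inter>\<U>) M)" (is "?A = ?B \<longleftrightarrow> ?C")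
proof -
  have int: "submodule (carrier L \<inter> \<Inter>\<U>) R L"
    by (rule Inter_submodule[OF assms(1)]) (rule assms(3))
  have car: "carrier (tensor R L M) =
    tensor_coset R L M ` {c. Poly_Mapping.keys c \<subseteq> carrier L \<times> carrier M}"
    unfolding tensor_def tensor_by_simps(1)[OF assms(1,2)] ..
  have mem: "tensor_coset R L M c \<in> submodule_times R L U M \<longleftrightarrow> c \<in> times_chains R L U M"
    if "U \<in> \<U>" for U c
    by (rule submodule_times_chains[OF assms(1,2) assms(3)[OF that]])
  have sub: "?A \<subseteq> ?B"
  proof
    fix X assume "X \<in> ?A"
    then obtain c where c: "X = tensor_coset R L M c" "Poly_Mapping.keys c \<subseteq> (carrier L \<inter> \<Inter>\<U>) \<times> carrier M"
      unfolding submodule_times_eq[OF assms(1,2) int] by (elim imageE CollectE) (rule that)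
    have "c \<in> times_chains R L U M" if "U \<in> \<U>" for U
      using c(2) that by (intro times_chains_of_keys[OF assms(1,2)]) auto
    moreover have "Poly_Mapping.keys c \<subseteq> carrier L \<times> carrier M" using c(2) by auto
    ultimately show "X \<in> ?B"
      using mem unfolding c(1) car by auto
  qed
  show ?thesis
  proof
    assume eq: "?A = ?B"
    show ?C
    proof (intro allI impI, elim conjE)
      fix c assume "Poly_Mapping.keys c \<subseteq> carrier L \<times> carrier M" "\<forall>U\<in>\<U>. c \<in> times_chains R L U M"
      then have "tensor_coset R L M c \<in> ?B" using mem unfolding car by auto
      then have "tensor_coset R L M c \<in> ?A" using eq by simp
      then show "c \<in> times_chains R L (carrier L \<inter> \<Inter>\<U>) M"
        using submodule_times_chains[OF assms(1,2) int] by simp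
    qed
  next
    assume C: ?C
    have "X \<in> ?A" if X: "X \<in> ?B" for X
    proof -
      obtain c where c: "X = tensor_coset R L M c" "Poly_Mapping.keys c \<subseteq> carrier L \<times> carrier M"
        using X unfolding car by blast
      with X mem have "\<forall>U\<in>\<U>. c \<in> times_chains R L U M" by auto
      with C c(2) have "c \<in> times_chains R L (carrier L \<inter> \<Inter>\<U>) M" by blast
      then show "X \<in> ?A"
        using submodule_times_chains[OF assms(1,2) int] c(1) by simp
    qed
    with sub show "?A = ?B" by blast
  qed
qed

lemma intersection_flat_chains:
  fixes R :: "('r, 'x) ring_scheme"
  assumes "module R M" "intersection_flat TYPE('r test_carrier) R M"
    and "module R L" "fin_gen_module R L" "\<And>U. U \<in> \<U> \<Longrightarrow> submodule U R L"
    and "Poly_Mapping.keys c \<subseteq> carrier L \<times> carrier M" "\<And>U. U \<in> \<U> \<Longrightarrow> c \<in> times_chains R L U M"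
  shows "c \<in> times_chains R L (carrier L \<inter> \<Inter>\<U>) M"
proof -
  obtain X :: "('r, 'r test_carrier) module" and e k where X: "module R X" "fin_gen_module R X"
    "e \<in> lin_maps R L X" "k \<in> lin_maps R X L"
    "\<And>x. x \<in> carrier L \<Longrightarrow> k (e x) = x" "\<And>y. y \<in> carrier X \<Longrightarrow> e (k y) = y"
    using fin_gen_transport[OF assms(3,4)] by blast
  let ?U = "(`) e ` \<U>"
  have UL: "U \<subseteq> carrier L" if "U \<in> \<U>" for U
    using assms(5)[OF that, unfolded submodule_iff[OF assms(3)]] by blast
  have sub: "submodule U R X" if "U \<in> ?U" for U
  proof -
    from that obtain V where "V \<in> \<U>" "U = e ` V" by blast
    then show ?thesis using image_submodule[OF assms(3) X(1,3) assms(5)] by simp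
  qed
  have 1: "Poly_Mapping.keys (frag_map e (\<lambda>m. m) c) \<subseteq> carrier X \<times> carrier M"
    using lin_mapsD(1)[OF X(3)] by (intro frag_map_keys_image[OF assms(6)]) auto
  have 2: "frag_map e (\<lambda>m. m) c \<in> times_chains R X U M" if "U \<in> ?U" for U
  proof -
    from that obtain V where V: "V \<in> \<U>" "U = e ` V" by blast
    show ?thesis
      unfolding V(2)
      by (rule times_chains_map[OF assms(3,1) X(1) assms(1) X(3) lin_maps_id order_refl assms(7)[OF V(1)]])
  qed
  have "submodule_times R X (carrier X \<inter> \<Inter>?U) M =
      carrier (tensor R X M) \<inter> (\<Inter>U\<in>?U. submodule_times R X U M)"
    by (rule assms(2)[unfolded intersection_flat_def, rule_format]) (intro conjI ballI X(1,2) sub)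
  with intersection_equality_iff[OF X(1) assms(1), of ?U] sub 1 2
  have "frag_map e (\<lambda>m. m) c \<in> times_chains R X (carrier X \<inter> \<Inter>?U) M"
    by simp
  moreover have "k ` (carrier X \<inter> \<Inter>?U) \<subseteq> carrier L \<inter> \<Inter>\<U>"
  proof (intro image_subsetI IntI InterI)
    fix y U assume y: "y \<in> carrier X \<inter> \<Inter>?U" "U \<in> \<U>"
    then obtain u where "u \<in> U" "y = e u" by auto
    then show "k y \<in> U" using X(5) UL[OF y(2)] by auto
  qed (use lin_mapsD(1)[OF X(4)] in auto)
  ultimately have "frag_map k (\<lambda>m. m) (frag_map e (\<lambda>m. m) c) \<in> times_chains R L (carrier L \<inter> \<Inter>\<U>) M"
    using times_chains_map[OF X(1) assms(1,3,1) X(4) lin_maps_id] by blast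
  moreover have "frag_map k (\<lambda>m. m) (frag_map e (\<lambda>m. m) c) = c"
    unfolding frag_map_comp[of k _ e] using X(5)
    by (subst frag_map_cong[OF assms(6), of _ "\<lambda>x. x" _ "\<lambda>m. m"]) (auto simp: frag_map_id)
  ultimately show ?thesis by simp
qed

definition prod_module ::
  "('r, 'm, 'y) module_scheme \<Rightarrow> ('r, 'n, 'z) module_scheme \<Rightarrow> ('r, 'm \<times> 'n) module"
  where "prod_module M N = \<lparr>carrier = carrier M \<times> carrier N, mult = (\<lambda>_ _. (\<zero>\<^bsub>M\<^esub>, \<zero>\<^bsub>N\<^esub>)),
    one = (\<zero>\<^bsub>M\<^esub>, \<zero>\<^bsub>N\<^esub>), zero = (\<zero>\<^bsub>M\<^esub>, \<zero>\<^bsub>N\<^esub>),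
    add = (\<lambda>(x, y) (x', y'). (x \<oplus>\<^bsub>M\<^esub> x', y \<oplus>\<^bsub>N\<^esub> y')), smult = (\<lambda>r (x, y). (r \<odot>\<^bsub>M\<^esub> x, r \<odot>\<^bsub>N\<^esub> y))\<rparr>"

lemma prod_module_simps [simp]:
  "carrier (prod_module M N) = carrier M \<times> carrier N" "\<zero>\<^bsub>prod_module M N\<^esub> = (\<zero>\<^bsub>M\<^esub>, \<zero>\<^bsub>N\<^esub>)"
  "(x, y) \<oplus>\<^bsub>prod_module M N\<^esub> (x', y') = (x \<oplus>\<^bsub>M\<^esub> x', y \<oplus>\<^bsub>N\<^esub> y')"
  "r \<odot>\<^bsub>prod_module M N\<^esub> (x, y) = (r \<odot>\<^bsub>M\<^esub> x, r \<odot>\<^bsub>N\<^esub> y)"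
  by (simp_all add: prod_module_def)

lemma prod_module:
  assumes "module R M" "module R N"
  shows "module R (prod_module M N)"
proof -
  interpret M: module R M by fact
  interpret N: module R N by fact
  have "abelian_group (prod_module M N)"
  proof (rule abelian_groupI)
    fix p assume "p \<in> carrier (prod_module M N)"
    then obtain x y where p: "p = (x, y)" "x \<in> carrier M" "y \<in> carrier N" by auto
    then show "\<exists>q\<in>carrier (prod_module M N). q \<oplus>\<^bsub>prod_module M N\<^esub> p = \<zero>\<^bsub>prod_module M N\<^esub>"
      by (intro bexI[of _ "(\<ominus>\<^bsub>M\<^esub> x, \<ominus>\<^bsub>N\<^esub> y)"]) (auto simp: M.M.l_neg N.M.l_neg)
  qed (auto simp: M.M.a_ac N.M.a_ac)
  then show ?thesis
    by (rule moduleI[OF M.R.is_cring])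
      (auto simp: M.smult_l_distr M.smult_r_distr M.smult_assoc1
        N.smult_l_distr N.smult_r_distr N.smult_assoc1)
qed

lemma prod_module_lin:
  assumes "module R M" "module R N"
  shows "(\<lambda>x. (x, \<zero>\<^bsub>N\<^esub>)) \<in> lin_maps R M (prod_module M N)"
    and "(\<lambda>y. (\<zero>\<^bsub>M\<^esub>, y)) \<in> lin_maps R N (prod_module M N)"
    and "fst \<in> lin_maps R (prod_module M N) M"
    and "g \<in> lin_maps R M N \<Longrightarrow> (\<lambda>x. (x, g x)) \<in> lin_maps R M (prod_module M N)"
proof -
  interpret M: module R M by fact
  interpret N: module R N by fact
  show "(\<lambda>x. (x, \<zero>\<^bsub>N\<^esub>)) \<in> lin_maps R M (prod_module M N)"
    "(\<lambda>y. (\<zero>\<^bsub>M\<^esub>, y)) \<in> lin_maps R N (prod_module M N)"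
    "fst \<in> lin_maps R (prod_module M N) M"
    by (auto simp: lin_maps_def)
  show "g \<in> lin_maps R M N \<Longrightarrow> (\<lambda>x. (x, g x)) \<in> lin_maps R M (prod_module M N)"
    by (auto simp: lin_maps_def)
qed

lemma prod_module_fin_gen:
  assumes "module R M" "module R N" "fin_gen_module R M" "fin_gen_module R N"
  shows "fin_gen_module R (prod_module M N)"
proof -
  interpret M: module R M by fact
  interpret N: module R N by fact
  let ?P = "prod_module M N"
  note P = prod_module[OF assms(1,2)] and lin = prod_module_lin[OF assms(1,2)]
  obtain G where G: "finite G" "G \<subseteq> carrier M" "\<forall>U. submodule U R M \<and> G \<subseteq> U \<longrightarrow> U = carrier M"
    using assms(3) unfolding fin_gen_module_iff[OF assms(1)] by blast
  obtain H where H: "finite H" "H \<subseteq> carrier N" "\<forall>U. submodule U R N \<and> H \<subseteq> U \<longrightarrow> U = carrier N"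
    using assms(4) unfolding fin_gen_module_iff[OF assms(2)] by blast
  let ?G = "(\<lambda>x. (x, \<zero>\<^bsub>N\<^esub>)) ` G \<union> (\<lambda>y. (\<zero>\<^bsub>M\<^esub>, y)) ` H"
  have "U = carrier ?P" if U: "submodule U R ?P" "?G \<subseteq> U" for U
  proof -
    note U' = U(1)[unfolded submodule_iff[OF P]]
    have "{x \<in> carrier M. (x, \<zero>\<^bsub>N\<^esub>) \<in> U} = carrier M"
      using vimage_submodule[OF assms(1) P lin(1) U(1)] G(2) U(2) by (intro G(3)[rule_format]) auto
    moreover have "{y \<in> carrier N. (\<zero>\<^bsub>M\<^esub>, y) \<in> U} = carrier N"
      using vimage_submodule[OF assms(2) P lin(2) U(1)] H(2) U(2) by (intro H(3)[rule_format]) auto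
    ultimately have mem: "(x, \<zero>\<^bsub>N\<^esub>) \<in> U" "(\<zero>\<^bsub>M\<^esub>, y) \<in> U" if "x \<in> carrier M" "y \<in> carrier N" for x y
      using that by blast+
    have "(x, y) \<in> U" if "x \<in> carrier M" "y \<in> carrier N" for x y
    proof -
      have "(x, \<zero>\<^bsub>N\<^esub>) \<oplus>\<^bsub>?P\<^esub> (\<zero>\<^bsub>M\<^esub>, y) \<in> U"
        using mem[OF that] U' by blast
      then show ?thesis using that by simp
    qed
    then show ?thesis using U' by auto
  qed
  then show ?thesis
    unfolding fin_gen_module_iff[OF P] using G(1,2) H(1,2) by (intro exI[of _ ?G]) auto
qed

text \<open>
  Let \<open>A\<close> be the submodule \<open>W \<times> 0\<close> of \<open>W \<times> Q\<close> and \<open>B\<close> the graph of \<open>\<phi>\<close>; they meet in \<open>ker \<phi> \<times> 0\<close>. If \<open>\<phi>\<close>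
  kills \<open>\<Sum> w \<otimes> m\<close>, then \<open>\<Sum> (w, 0) \<otimes> m = \<Sum> (w, \<phi> w) \<otimes> m\<close> lies in \<open>A M\<close> and in \<open>B M\<close>, so in
  \<open>(ker \<phi> \<times> 0) M\<close>. For injective \<open>\<phi>\<close> this shows that intersection flat modules are flat.
\<close>

lemma intersection_flat_kernel:
  fixes R :: "('r, 'x) ring_scheme"
  assumes "module R M" "intersection_flat TYPE('r test_carrier) R M"
    and "module R W" "module R Q" "fin_gen_module R W" "fin_gen_module R Q"
    and "\<phi> \<in> lin_maps R W Q" "Poly_Mapping.keys c \<subseteq> carrier W \<times> carrier M"
    and "frag_map \<phi> (\<lambda>m. m) c \<in> tensor_kernel R Q M"
  shows "c \<in> times_chains R W (lin_ker W Q \<phi>) M"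
proof -
  interpret W: module R W by fact
  interpret Q: module R Q by fact
  let ?P = "prod_module W Q"
  let ?i = "\<lambda>w. (w, \<zero>\<^bsub>Q\<^esub>)" and ?j = "\<lambda>q. (\<zero>\<^bsub>W\<^esub>, q)" and ?\<gamma> = "\<lambda>w. (w, \<phi> w)"
  note P = prod_module[OF assms(3,4)] and lin = prod_module_lin[OF assms(3,4)]
  note \<gamma> = lin(4)[OF assms(7)] and \<phi> = lin_mapsD[OF assms(7)]
  note K = tensor_kernel_closed[OF P assms(1)] and rels = tensor_kernel_rels[OF P assms(1)]
  let ?A = "?i ` carrier W" and ?B = "?\<gamma> ` carrier W"
  have sub: "submodule ?A R ?P" "submodule ?B R ?P"
    using image_submodule[OF assms(3) P lin(1)] image_submodule[OF assms(3) P \<gamma>]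
      module.carrier_is_submodule[OF assms(3)] by blast+
  let ?c = "frag_map ?i (\<lambda>m. m) c"
  have keys: "Poly_Mapping.keys ?c \<subseteq> ?A \<times> carrier M"
    by (rule frag_map_keys_image[OF assms(8)]) auto
  have A: "?c \<in> times_chains R ?P ?A M"
    by (rule times_chains_of_keys[OF P assms(1) keys])
  have "frag_map ?\<gamma> (\<lambda>m. m) c - ?c - frag_map ?j (\<lambda>m. m) (frag_map \<phi> (\<lambda>m. m) c) \<in> tensor_kernel R ?P M"
    unfolding frag_map_comp[of ?j _ \<phi>] using assms(8)
  proof (induction c rule: frag_induction)
    case (one p)
    then obtain w m where "p = (w, m)" "w \<in> carrier W" "m \<in> carrier M" by auto
    then show ?case using rels(1)[of "(w, \<zero>\<^bsub>Q\<^esub>)" "(\<zero>\<^bsub>W\<^esub>, \<phi> w)" m] \<phi>(1) by simp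
  next
    case (diff a b)
    from K(4)[OF diff] show ?case by (simp add: frag_extend_diff algebra_simps)
  qed (use K(1) in simp)
  from K(3)[OF this frag_map_kernel[OF assms(4,1) P assms(1) lin(2) lin_maps_id assms(9)]]
  have "?c - frag_map ?\<gamma> (\<lambda>m. m) c \<in> tensor_kernel R ?P M"
    using K(2) by fastforce
  moreover have "Poly_Mapping.keys (frag_map ?\<gamma> (\<lambda>m. m) c) \<subseteq> ?B \<times> carrier M"
    by (rule frag_map_keys_image[OF assms(8)]) auto
  ultimately have B: "?c \<in> times_chains R ?P ?B M"
    unfolding times_chains_def by blast
  have keys_P: "Poly_Mapping.keys ?c \<subseteq> carrier ?P \<times> carrier M"
    using keys by auto
  have "?c \<in> times_chains R ?P (carrier ?P \<inter> \<Inter>{?A, ?B}) M"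
    by (rule intersection_flat_chains[OF assms(1,2) P prod_module_fin_gen[OF assms(3-6)] _ keys_P])
      (use sub A B in auto)
  moreover have "fst ` (carrier ?P \<inter> \<Inter>{?A, ?B}) \<subseteq> lin_ker W Q \<phi>"
    by (auto simp: lin_ker_def)
  ultimately have "frag_map fst (\<lambda>m. m) ?c \<in> times_chains R W (lin_ker W Q \<phi>) M"
    using times_chains_map[OF P assms(1,3,1) lin(3) lin_maps_id] by blast
  then show ?thesis
    by (simp add: frag_map_comp frag_map_id)
qed

section \<open>Descent of flatness along pure ring homomorphisms\<close>

definition fun_module :: "('r, 'n, 'y) module_scheme \<Rightarrow> ('r, 'i \<Rightarrow> 'n) module"
  where "fun_module N = \<lparr>carrier = {x. \<forall>i. x i \<in> carrier N}, mult = (\<lambda>_ _ _. \<zero>\<^bsub>N\<^esub>), one = (\<lambda>_. \<zero>\<^bsub>N\<^esub>),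
    zero = (\<lambda>_. \<zero>\<^bsub>N\<^esub>), add = (\<lambda>x y i. x i \<oplus>\<^bsub>N\<^esub> y i), smult = (\<lambda>r x i. r \<odot>\<^bsub>N\<^esub> x i)\<rparr>"

lemma fun_module_simps [simp]:
  "x \<in> carrier (fun_module N) \<longleftrightarrow> (\<forall>i. x i \<in> carrier N)" "\<zero>\<^bsub>fun_module N\<^esub> = (\<lambda>_. \<zero>\<^bsub>N\<^esub>)"
  "x \<oplus>\<^bsub>fun_module N\<^esub> y = (\<lambda>i. x i \<oplus>\<^bsub>N\<^esub> y i)" "r \<odot>\<^bsub>fun_module N\<^esub> x = (\<lambda>i. r \<odot>\<^bsub>N\<^esub> x i)"
  by (simp_all add: fun_module_def)

lemma fun_module:
  fixes N :: "('r, 'n, 'y) module_scheme"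
  assumes "module R N"
  shows "module R (fun_module N :: ('r, 'i \<Rightarrow> 'n) module)"
proof -
  interpret N: module R N by fact
  have "abelian_group (fun_module N :: ('r, 'i \<Rightarrow> 'n) module)"
  proof (rule abelian_groupI)
    fix x :: "'i \<Rightarrow> 'n" assume "x \<in> carrier (fun_module N)"
    then show "\<exists>y\<in>carrier (fun_module N). y \<oplus>\<^bsub>fun_module N\<^esub> x = \<zero>\<^bsub>fun_module N\<^esub>"
      by (intro bexI[of _ "\<lambda>i. \<ominus>\<^bsub>N\<^esub> x i"]) (auto simp: N.M.l_neg)
  qed (auto simp: N.M.a_ac)
  then show ?thesis
    by (rule moduleI[OF N.R.is_cring])
      (auto simp: N.smult_l_distr N.smult_r_distr N.smult_assoc1)
qed

text \<open>
  Write \<open>M = F / K\<close> with \<open>F\<close> free on the elements of \<open>M\<close>. As \<open>N \<otimes> F \<rightarrow> N' \<otimes> F\<close> is injective,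
  \<open>N \<otimes> M = (N \<otimes> F) / (N \<otimes> K)\<close> embeds into \<open>P = (N' \<otimes> F) / (N \<otimes> K)\<close>. The map \<open>\<nu>\<close> is this embedding,
  and \<open>\<beta> m\<close> sends \<open>n'\<close> to the class of \<open>n' \<otimes> m\<close>. The elements of \<open>N' \<otimes> F\<close> are functions from \<open>M\<close> to \<open>N'\<close>
  with finite support; the module of all functions contains them and serves equally well.
\<close>

lemma tensor_embedding:
  fixes R :: "('r, 'x) ring_scheme" and M :: "('r, 'm, 'z) module_scheme"
    and N :: "('r, 'n, 'y) module_scheme" and N' :: "('r, 'n1, 'y1) module_scheme"
  assumes "module R N" "module R N'" "module R M" "g \<in> lin_maps R N N'" "inj_on g (carrier N)"
  obtains P :: "('r, ('m \<Rightarrow> 'n1) set) module" and \<beta> \<nu>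
  where "module R P" "\<And>m. \<beta> m \<in> lin_maps R N' P"
    "\<And>n m. n \<in> carrier N \<Longrightarrow> m \<in> carrier M \<Longrightarrow> \<nu> (frag_of (n, m)) = \<beta> m (g n)"
    "\<And>c d. Poly_Mapping.keys c \<subseteq> carrier N \<times> carrier M \<Longrightarrow>
      Poly_Mapping.keys d \<subseteq> carrier N \<times> carrier M \<Longrightarrow> \<nu> (c - d) = \<nu> c \<ominus>\<^bsub>P\<^esub> \<nu> d"
    "\<And>c. Poly_Mapping.keys c \<subseteq> carrier N \<times> carrier M \<Longrightarrow> \<nu> c \<in> carrier P"
    "\<And>c. Poly_Mapping.keys c \<subseteq> carrier N \<times> carrier M \<Longrightarrow>
      \<nu> c = \<zero>\<^bsub>P\<^esub> \<longleftrightarrow> c \<in> tensor_kernel R N M"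
proof -
  interpret N: module R N by fact
  interpret N': module R N' by fact
  interpret M: module R M by fact
  let ?C = "carrier N \<times> carrier M"
  let ?F = "fun_module N :: ('r, 'm \<Rightarrow> 'n) module" and ?F' = "fun_module N' :: ('r, 'm \<Rightarrow> 'n1) module"
  note mF = fun_module[OF assms(1)] and mF' = fun_module[OF assms(2)]
  interpret F: module R ?F by (rule mF)
  note K = tensor_kernel_closed[OF assms(1,3)] and rels = tensor_kernel_rels[OF assms(1,3)]
  note g = lin_mapsD[OF assms(4)]
  define \<iota> :: "'n \<times> 'm \<Rightarrow> 'm \<Rightarrow> 'n" where "\<iota> = (\<lambda>(n, m) i. if i = m then n else \<zero>\<^bsub>N\<^esub>)"
  have "\<iota> ` ?C \<subseteq> carrier (add_monoid ?F)" by (auto simp: \<iota>_def)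
  then obtain \<mu> where \<mu>: "\<mu> \<in> hom (free_Abelian_group ?C) (add_monoid ?F)"
    "\<And>p. p \<in> ?C \<Longrightarrow> \<mu> (frag_of p) = \<iota> p"
    using comm_group.free_Abelian_group_universal[OF F.a_comm_group] by metis
  interpret \<mu>: group_hom "free_Abelian_group ?C" "add_monoid ?F" \<mu>
    using \<mu>(1) F.a_group by (simp add: group_hom_def group_hom_axioms_def)
  have \<mu>_closed: "\<mu> a \<in> carrier ?F" if "Poly_Mapping.keys a \<subseteq> ?C" for a
    using \<mu>.hom_closed[of a] that by simp
  have \<mu>_add: "\<mu> (a + b) = \<mu> a \<oplus>\<^bsub>?F\<^esub> \<mu> b"
    if "Poly_Mapping.keys a \<subseteq> ?C" "Poly_Mapping.keys b \<subseteq> ?C" for a b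
    using \<mu>.hom_mult[of a b] that by simp
  have \<mu>_minus: "\<mu> (- a) = \<ominus>\<^bsub>?F\<^esub> \<mu> a" if "Poly_Mapping.keys a \<subseteq> ?C" for a
    using \<mu>.hom_inv[of a] that by (simp add: a_inv_def)
  have \<mu>_diff: "\<mu> (a - b) = \<mu> a \<ominus>\<^bsub>?F\<^esub> \<mu> b"
    if "Poly_Mapping.keys a \<subseteq> ?C" "Poly_Mapping.keys b \<subseteq> ?C" for a b
    using \<mu>_add[of a "- b"] \<mu>_minus[of b] that by (simp add: a_minus_def)
  have \<mu>_zero: "\<mu> 0 = \<zero>\<^bsub>?F\<^esub>" using \<mu>.hom_one by simp
  have \<mu>_diff_app: "\<mu> (a - b) i = \<mu> a i \<ominus>\<^bsub>N\<^esub> \<mu> b i"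
    if "Poly_Mapping.keys a \<subseteq> ?C" "Poly_Mapping.keys b \<subseteq> ?C" for a b i
  proof -
    have "(\<lambda>x. x i) \<in> lin_maps R ?F N" by (auto simp: lin_maps_def)
    from lin_maps_minus[OF mF assms(1) this \<mu>_closed[OF that(1)] \<mu>_closed[OF that(2)]] show ?thesis
      by (simp add: \<mu>_diff[OF that])
  qed
  have \<mu>_smult: "\<mu> (frag_map (\<lambda>n. r \<odot>\<^bsub>N\<^esub> n) (\<lambda>m. m) c) = r \<odot>\<^bsub>?F\<^esub> \<mu> c"
    if r: "r \<in> carrier R" and c: "Poly_Mapping.keys c \<subseteq> ?C" for r c
    using c
  proof (induction c rule: free_Abelian_group_induct[consumes 1, case_names zero diff one])
    case zero
    then show ?case using \<mu>_zero r by simp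
  next
    case (one p)
    then show ?case using \<mu>(2) r by (auto simp: \<iota>_def fun_eq_iff)
  next
    case (diff a b)
    have keys: "Poly_Mapping.keys (frag_map (\<lambda>n. r \<odot>\<^bsub>N\<^esub> n) (\<lambda>m. m) c) \<subseteq> ?C"
      if "Poly_Mapping.keys c \<subseteq> ?C" for c
      using r by (intro frag_map_keys_image[OF that]) auto
    have "(\<lambda>x. r \<odot>\<^bsub>?F\<^esub> x) \<in> lin_maps R ?F ?F"
      using r by (auto simp: lin_maps_def N.smult_r_distr N.smult_assoc1[symmetric] N.R.m_comm)
    from lin_maps_minus[OF mF mF this \<mu>_closed[OF diff(1)] \<mu>_closed[OF diff(2)]]
    show ?case
      unfolding frag_extend_diff \<mu>_diff[OF diff(1,2)] \<mu>_diff[OF keys[OF diff(1)] keys[OF diff(2)]] diff(3,4)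
      by (rule sym)
  qed
  have smult_kernel: "frag_map (\<lambda>n. r \<odot>\<^bsub>N\<^esub> n) (\<lambda>m. m) c \<in> tensor_kernel R N M"
    if "r \<in> carrier R" "c \<in> tensor_kernel R N M" for r c
    using that by (intro frag_map_kernel[OF assms(1,3,1,3) _ lin_maps_id])
      (auto simp: lin_maps_def N.smult_r_distr N.smult_assoc1[symmetric] N.R.m_comm)
  \<comment> \<open>The map \<open>\<mu>\<close> to \<open>N \<otimes> F\<close> sends the relations of \<open>N \<otimes> M\<close> onto the image of \<open>N \<otimes> K\<close> in \<open>N \<otimes> F\<close>.\<close>
  let ?T = "\<mu> ` tensor_kernel R N M"
  have T: "submodule ?T R ?F"
    unfolding submodule_iff[OF mF]
  proof (intro conjI ballI)
    show "?T \<subseteq> carrier ?F" using \<mu>_closed K(5) by blast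
    show "\<zero>\<^bsub>?F\<^esub> \<in> ?T" using \<mu>_zero K(1) by force
  next
    fix x y assume "x \<in> ?T" "y \<in> ?T"
    then obtain a b where "a \<in> tensor_kernel R N M" "b \<in> tensor_kernel R N M" "x = \<mu> a" "y = \<mu> b"
      by blast
    then show "x \<oplus>\<^bsub>?F\<^esub> y \<in> ?T" using \<mu>_add K(3,5) by (metis imageI)
  next
    fix r x assume r: "r \<in> carrier R" and "x \<in> ?T"
    then obtain a where a: "a \<in> tensor_kernel R N M" "x = \<mu> a" by blast
    show "r \<odot>\<^bsub>?F\<^esub> x \<in> ?T"
      unfolding a(2) \<mu>_smult[OF r K(5)[OF a(1)], symmetric]
      by (rule imageI[OF smult_kernel[OF r a(1)]])
  qed
  define \<gamma> where "\<gamma> x = (\<lambda>i. g (x i))" for x :: "'m \<Rightarrow> 'n"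
  have \<gamma>: "\<gamma> \<in> lin_maps R ?F ?F'"
    using g by (auto simp: lin_maps_def \<gamma>_def)
  have \<gamma>_inj: "x = y" if "\<gamma> x = \<gamma> y" "x \<in> carrier ?F" "y \<in> carrier ?F" for x y
    using that assms(5) by (auto simp: \<gamma>_def fun_eq_iff dest: inj_onD)
  obtain P :: "('r, ('m \<Rightarrow> 'n1) set) module" and \<pi> where P: "module R P" "carrier P = \<pi> ` carrier ?F'"
    "\<pi> \<in> lin_maps R ?F' P" "lin_ker ?F' P \<pi> = \<gamma> ` ?T"
    by (rule quotient_exists[OF mF' image_submodule[OF mF mF' \<gamma> T]])
  define \<beta> where "\<beta> m n = \<pi> (\<lambda>i. if i = m then n else \<zero>\<^bsub>N'\<^esub>)" for m n
  define \<nu> where "\<nu> c = \<pi> (\<gamma> (\<mu> c))" for c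
  note \<pi>\<gamma> = lin_maps_comp[OF \<gamma> P(3)]
  have g0: "g \<zero>\<^bsub>N\<^esub> = \<zero>\<^bsub>N'\<^esub>" by (rule lin_maps_zero[OF assms(1,2,4)])
  show thesis
  proof (rule that[OF P(1)])
    show "\<beta> m \<in> lin_maps R N' P" for m
      unfolding \<beta>_def by (rule lin_maps_comp[OF _ P(3)]) (auto simp: lin_maps_def fun_eq_iff)
    show "\<nu> (frag_of (n, m)) = \<beta> m (g n)" if "n \<in> carrier N" "m \<in> carrier M" for n m
      using \<mu>(2)[of "(n, m)"] that g0
      by (auto simp: \<nu>_def \<beta>_def \<gamma>_def \<iota>_def intro!: arg_cong[of _ _ \<pi>])
    show "\<nu> (c - d) = \<nu> c \<ominus>\<^bsub>P\<^esub> \<nu> d"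
      if "Poly_Mapping.keys c \<subseteq> ?C" "Poly_Mapping.keys d \<subseteq> ?C" for c d
      unfolding \<nu>_def \<mu>_diff[OF that]
      by (rule lin_maps_minus[OF mF P(1) \<pi>\<gamma> \<mu>_closed[OF that(1)] \<mu>_closed[OF that(2)]])
    show "\<nu> c \<in> carrier P" if "Poly_Mapping.keys c \<subseteq> ?C" for c
      unfolding \<nu>_def by (rule lin_mapsD(1)[OF \<pi>\<gamma> \<mu>_closed[OF that]])
    fix c :: "'n \<times> 'm \<Rightarrow>\<^sub>0 int" assume c: "Poly_Mapping.keys c \<subseteq> ?C"
    have "\<nu> c = \<zero>\<^bsub>P\<^esub> \<longleftrightarrow> \<gamma> (\<mu> c) \<in> \<gamma> ` ?T"
      unfolding P(4)[symmetric] \<nu>_def lin_ker_def using lin_mapsD(1)[OF \<gamma> \<mu>_closed[OF c]] by blast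
    also have "\<dots> \<longleftrightarrow> (\<exists>k\<in>tensor_kernel R N M. \<mu> c = \<mu> k)"
    proof
      assume "\<gamma> (\<mu> c) \<in> \<gamma> ` ?T"
      then obtain k where k: "k \<in> tensor_kernel R N M" "\<gamma> (\<mu> c) = \<gamma> (\<mu> k)" by (elim imageE) simp
      from \<gamma>_inj[OF k(2) \<mu>_closed[OF c] \<mu>_closed[OF K(5)[OF k(1)]]] k(1)
      show "\<exists>k\<in>tensor_kernel R N M. \<mu> c = \<mu> k" by (rule bexI)
    qed auto
    also have "\<dots> \<longleftrightarrow> c \<in> tensor_kernel R N M"
    proof
      assume "\<exists>k\<in>tensor_kernel R N M. \<mu> c = \<mu> k"
      then obtain k where k: "k \<in> tensor_kernel R N M" "\<mu> c = \<mu> k" by blast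
      let ?A = "snd ` Poly_Mapping.keys (c - k)"
      have A: "finite ?A" by simp
      have ck: "Poly_Mapping.keys (c - k) \<subseteq> ?C"
        using keys_diff[of c k] c K(5)[OF k(1)] by blast
      then have AM: "?A \<subseteq> carrier M" by auto
      have frag0: "frag_of (\<zero>\<^bsub>N\<^esub>, m) \<in> tensor_kernel R N M" if "m \<in> carrier M" for m
        using K(2)[OF rels(1)[OF N.M.zero_closed N.M.zero_closed that]] by simp
      have K_sum: "(\<Sum>m\<in>B. h m) \<in> tensor_kernel R N M"
        if "finite B" "\<And>m. m \<in> B \<Longrightarrow> h m \<in> tensor_kernel R N M" for B :: "'m set" and h
        using that by (induction B rule: finite_induct) (auto intro: K(1,3))
      \<comment> \<open>Modulo additivity in \<open>N\<close>, a formal sum is determined by its value under \<open>\<mu>\<close>.\<close>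
      have expand: "d - (\<Sum>m\<in>?A. frag_of (\<mu> d m, m)) \<in> tensor_kernel R N M"
        if "Poly_Mapping.keys d \<subseteq> carrier N \<times> ?A" for d
        using that
      proof (induction d rule: free_Abelian_group_induct[consumes 1, case_names zero diff one])
        case zero
        have "(\<Sum>m\<in>?A. frag_of (\<zero>\<^bsub>N\<^esub>, m)) \<in> tensor_kernel R N M"
          by (rule K_sum[OF A]) (erule frag0[OF subsetD[OF AM]])
        then show ?case using K(2) by (fastforce simp: \<mu>_zero)
      next
        case (one p)
        then obtain n m where p: "p = (n, m)" "n \<in> carrier N" "m \<in> ?A" "m \<in> carrier M" using AM by blast
        have "(\<Sum>i\<in>?A. frag_of (\<mu> (frag_of p) i, i)) =
          frag_of p + (\<Sum>i\<in>?A - {m}. frag_of (\<zero>\<^bsub>N\<^esub>, i))"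
          using p \<mu>(2)[of p] sum.remove[OF A p(3), of "\<lambda>i. frag_of (\<mu> (frag_of p) i, i)"]
          by (simp add: \<iota>_def)
        moreover have "(\<Sum>i\<in>?A - {m}. frag_of (\<zero>\<^bsub>N\<^esub>, i)) \<in> tensor_kernel R N M"
          by (rule K_sum) (simp, erule DiffE, erule frag0[OF subsetD[OF AM]])
        ultimately show ?case using K(2) by fastforce
      next
        case (diff a b)
        have ab: "Poly_Mapping.keys a \<subseteq> ?C" "Poly_Mapping.keys b \<subseteq> ?C"
          using diff(1,2) AM by blast+
        have "(\<Sum>m\<in>?A. frag_of (\<mu> a m, m) - frag_of (\<mu> (a - b) m, m) - frag_of (\<mu> b m, m))
          \<in> tensor_kernel R N M"
        proof (rule K_sum[OF A])
          fix m assume "m \<in> ?A"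
          then have m: "m \<in> carrier M" using AM by blast
          have mem: "\<mu> a m \<in> carrier N" "\<mu> b m \<in> carrier N"
            using \<mu>_closed[OF ab(1)] \<mu>_closed[OF ab(2)] by simp_all
          then have "(\<mu> a m \<ominus>\<^bsub>N\<^esub> \<mu> b m) \<oplus>\<^bsub>N\<^esub> \<mu> b m = \<mu> a m"
            by (simp add: a_minus_def N.M.a_assoc N.M.l_neg)
          with rels(1)[OF _ mem(2) m, of "\<mu> a m \<ominus>\<^bsub>N\<^esub> \<mu> b m"] mem
          show "frag_of (\<mu> a m, m) - frag_of (\<mu> (a - b) m, m) - frag_of (\<mu> b m, m) \<in> tensor_kernel R N M"
            by (simp add: \<mu>_diff_app[OF ab])
        qed
        from K(3)[OF K(4)[OF diff(3,4)] this] show ?case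
          by (simp add: sum_subtractf sum.distrib algebra_simps)
      qed
      have ckA: "Poly_Mapping.keys (c - k) \<subseteq> carrier N \<times> ?A"
        using ck by force
      have "\<mu> (c - k) m = \<zero>\<^bsub>N\<^esub>" for m
        using \<mu>_diff_app[OF c K(5)[OF k(1)]] k(2) \<mu>_closed[OF c] by (simp add: N.M.minus_eq_zero_iff)
      with expand[OF ckA] have 1: "(c - k) - (\<Sum>m\<in>?A. frag_of (\<zero>\<^bsub>N\<^esub>, m)) \<in> tensor_kernel R N M"
        by simp
      have 2: "(\<Sum>m\<in>?A. frag_of (\<zero>\<^bsub>N\<^esub>, m)) \<in> tensor_kernel R N M"
        by (rule K_sum[OF A]) (erule frag0[OF subsetD[OF AM]])
      from K(3)[OF 1 2] have "c - k \<in> tensor_kernel R N M" by simp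
      from K(3)[OF this k(1)] show "c \<in> tensor_kernel R N M" by simp
    qed blast
    finally show "\<nu> c = \<zero>\<^bsub>P\<^esub> \<longleftrightarrow> c \<in> tensor_kernel R N M" .
  qed
qed

text \<open>
  Let \<open>c\<close> represent an element of \<open>N \<otimes> M\<close> that vanishes in \<open>N' \<otimes> M\<close>. Intersection flatness of \<open>M\<^sub>S\<close>
  shows that its image in \<open>(S \<otimes> N) \<otimes>\<^sub>R M\<close> comes from the kernel of \<open>\<phi> : S \<otimes> N \<rightarrow> S \<otimes> N'\<close>. With \<open>P\<close>,
  \<open>\<beta>\<close> and \<open>\<nu>\<close> as in \<open>tensor_embedding\<close>, the map \<open>\<theta> : (S \<otimes> N) \<otimes>\<^sub>R M \<rightarrow> S \<otimes> P\<close> given by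
  \<open>(s \<otimes> n) \<otimes> m \<mapsto> s \<otimes> \<beta> m (g n)\<close> kills these elements, as it factors through \<open>\<phi>\<close> in the first variable. It is well
  defined on \<open>(S \<otimes> N) \<otimes> M\<close> because the submodule \<open>N \<otimes> K\<close> has been divided out in \<open>P\<close>. So \<open>1 \<otimes> \<nu> c = 0\<close> in
  \<open>S \<otimes> P\<close>, and purity gives \<open>\<nu> c = 0\<close>.
\<close>

lemma pure_intersection_flat_imp_fg_flat:
  fixes R :: "('r, 'x) ring_scheme" and S :: "('s, 'y) ring_scheme"
    and M :: "('r, 'm, 'z) module_scheme"
  assumes "ring_hom_cring R S f" "module R M" "pure_ring_hom TYPE('r test_carrier) R S f"
    and "intersection_flat TYPE('s test_carrier) S (base_change R S f M)"
  shows "fg_flat R M"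
  unfolding fg_flat_def
proof (intro allI impI, elim conjE)
  fix N N' :: "('r, 'r test_carrier) module" and g c
  assume N: "module R N" "fin_gen_module R N" and N': "module R N'" "fin_gen_module R N'"
    and g: "g \<in> lin_maps R N N'" "inj_on g (carrier N)"
    and c: "Poly_Mapping.keys c \<subseteq> carrier N \<times> carrier M"
      "frag_map g (\<lambda>m. m) c \<in> tensor_kernel R N' M"
  interpret f: ring_hom_cring R S f by fact
  interpret N: module R N by fact
  interpret M: module R M by fact
  let ?S = "alg_module S f" and ?M = "base_change R S f M"
    and ?N = "base_change R S f N" and ?N' = "base_change R S f N'"
  note S = alg_module_module[OF assms(1)]
  note bM = base_change_module[OF assms(1,2)] and bN = base_change_module[OF assms(1) N(1)]
    and bN' = base_change_module[OF assms(1) N'(1)]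
  interpret bN: module S ?N by (rule bN)
  let ?\<phi> = "bc_map R S f N N' g"
  note \<phi> = bc_map_lin[OF assms(1) N(1) N'(1) g(1)]
  note uN = bc_unit_lin[OF assms(1) N(1)] and rN = restrict_scalars_module[OF assms(1) bN]
  let ?c = "frag_map (bc_unit R S f N) (\<lambda>m. m) c"
  have keys: "Poly_Mapping.keys ?c \<subseteq> carrier ?N \<times> carrier M"
    using lin_mapsD(1)[OF uN] by (intro frag_map_keys_image[OF c(1)]) auto
  have "?c \<in> times_chains R (restrict_scalars f ?N) (lin_ker ?N ?N' ?\<phi>) M"
  proof (rule base_change_adjoint[OF assms(1,2) bN lin_ker_submodule[OF bN bN' \<phi>] keys])
    let ?d = "frag_map (\<lambda>q. q) (bc_unit R S f M) ?c"
    have "frag_map g (\<lambda>m. m) c \<in> times_chains R N' {} M"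
      using c(2) by (rule times_chains_kernel)
    from base_change_times_chains[OF assms(1,2) N'(1) bN' bc_unit_lin[OF assms(1) N'(1)] this, of "{}"]
    have "frag_map ?\<phi> (\<lambda>m. m) ?d \<in> tensor_kernel S ?N' ?M"
      by (simp add: frag_map_comp times_chains_eq_kernel[OF bN' bM]
          bc_map_unit[OF assms(1) N(1) N'(1) g(1)])
    moreover have "Poly_Mapping.keys ?d \<subseteq> carrier ?N \<times> carrier ?M"
      using lin_mapsD(1)[OF bc_unit_lin[OF assms(1,2)]]
      by (intro frag_map_keys_image[OF keys]) auto
    ultimately show "?d \<in> times_chains S ?N (lin_ker ?N ?N' ?\<phi>) ?M"
      by (intro intersection_flat_kernel[OF bM assms(4) bN bN' _ _ \<phi>]
          base_change_fin_gen[OF assms(1)] N N')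
  qed
  then obtain d where d: "Poly_Mapping.keys d \<subseteq> lin_ker ?N ?N' ?\<phi> \<times> carrier M"
    "?c - d \<in> tensor_kernel R (restrict_scalars f ?N) M"
    unfolding times_chains_def by blast
  show "c \<in> tensor_kernel R N M"
  proof (rule tensor_embedding[OF N(1) N'(1) assms(2) g])
    fix P :: "('r, ('m \<Rightarrow> 'r test_carrier) set) module" and \<beta> \<nu>
    assume P: "module R P"
      and \<beta>: "\<And>m. \<beta> m \<in> lin_maps R N' P"
      and \<nu>_of: "\<And>n m. n \<in> carrier N \<Longrightarrow> m \<in> carrier M \<Longrightarrow> \<nu> (frag_of (n, m)) = \<beta> m (g n)"
      and \<nu>_diff: "\<And>c d. Poly_Mapping.keys c \<subseteq> carrier N \<times> carrier M \<Longrightarrow>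
        Poly_Mapping.keys d \<subseteq> carrier N \<times> carrier M \<Longrightarrow> \<nu> (c - d) = \<nu> c \<ominus>\<^bsub>P\<^esub> \<nu> d"
      and \<nu>_closed: "\<And>c. Poly_Mapping.keys c \<subseteq> carrier N \<times> carrier M \<Longrightarrow> \<nu> c \<in> carrier P"
      and \<nu>_ker: "\<And>c. Poly_Mapping.keys c \<subseteq> carrier N \<times> carrier M \<Longrightarrow>
        \<nu> c = \<zero>\<^bsub>P\<^esub> \<longleftrightarrow> c \<in> tensor_kernel R N M"
    interpret P: module R P by (rule P)
    note K = tensor_kernel_closed[OF S P] and rels = tensor_kernel_rels[OF S P, simplified]
    define \<gamma> where "\<gamma> m n = \<beta> m (g n)" for m n
    have \<gamma>: "\<gamma> m \<in> lin_maps R N P" for m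
      unfolding \<gamma>_def by (rule lin_maps_comp[OF g(1) \<beta>])
    note \<gamma>D = lin_mapsD[OF \<gamma>]
    have keys3: "Poly_Mapping.keys (frag_of a - frag_of b - frag_of e) \<subseteq> {a, b, e}"
      and keys2: "Poly_Mapping.keys (frag_of a - frag_of b) \<subseteq> {a, b}" for a b e :: "'r test_carrier \<times> 'm"
      using keys_diff[of "frag_of a - frag_of b" "frag_of e"] keys_diff[of "frag_of a" "frag_of b"]
      by auto
    have \<gamma>_add: "\<gamma> (m \<oplus>\<^bsub>M\<^esub> m') n = \<gamma> m n \<oplus>\<^bsub>P\<^esub> \<gamma> m' n"
      if n: "n \<in> carrier N" "m \<in> carrier M" "m' \<in> carrier M" for m m' n
    proof -
      let ?a = "frag_of (n, m \<oplus>\<^bsub>M\<^esub> m')" and ?b = "frag_of (n, m)" and ?e = "frag_of (n, m')"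
      have "\<nu> (?a - ?b - ?e) = \<zero>\<^bsub>P\<^esub>"
        using n by (subst \<nu>_ker) (auto intro!: tensor_kernel_rels(2)[OF N(1) assms(2)] dest!: subsetD[OF keys3])
      also have "\<nu> (?a - ?b - ?e) = \<gamma> (m \<oplus>\<^bsub>M\<^esub> m') n \<ominus>\<^bsub>P\<^esub> \<gamma> m n \<ominus>\<^bsub>P\<^esub> \<gamma> m' n"
        using n keys2[of "(n, m \<oplus>\<^bsub>M\<^esub> m')" "(n, m)"]
        by (subst \<nu>_diff, force, force, subst \<nu>_diff) (auto simp: \<nu>_of \<gamma>_def)
      finally show ?thesis
        using n \<gamma>D(1) P.M.minus_eq_zero_iff[of "\<gamma> (m \<oplus>\<^bsub>M\<^esub> m') n" "\<gamma> m n \<oplus>\<^bsub>P\<^esub> \<gamma> m' n"]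
        by (simp add: a_minus_def P.M.minus_add P.M.a_assoc)
    qed
    have \<gamma>_smult: "\<gamma> (r \<odot>\<^bsub>M\<^esub> m) n = r \<odot>\<^bsub>P\<^esub> \<gamma> m n"
      if n: "r \<in> carrier R" "n \<in> carrier N" "m \<in> carrier M" for r m n
    proof -
      have "\<nu> (frag_of (r \<odot>\<^bsub>N\<^esub> n, m) - frag_of (n, r \<odot>\<^bsub>M\<^esub> m)) = \<zero>\<^bsub>P\<^esub>"
        using n by (subst \<nu>_ker) (auto intro!: tensor_kernel_rels(3)[OF N(1) assms(2)] dest!: subsetD[OF keys2])
      then have "\<gamma> m (r \<odot>\<^bsub>N\<^esub> n) \<ominus>\<^bsub>P\<^esub> \<gamma> (r \<odot>\<^bsub>M\<^esub> m) n = \<zero>\<^bsub>P\<^esub>"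
        using n by (subst (asm) \<nu>_diff) (auto simp: \<nu>_of \<gamma>_def)
      then show ?thesis
        using n \<gamma>D(1) by (simp add: P.M.minus_eq_zero_iff \<gamma>D(3))
    qed
    define a where "a m e = frag_map (\<lambda>s. s) (\<gamma> m) e" for m and e :: "'s \<times> 'r test_carrier \<Rightarrow>\<^sub>0 int"
    have a_diff: "a m (x - y) = a m x - a m y" for m x y
      by (simp add: a_def frag_extend_diff)
    have a_kernel: "a m e \<in> tensor_kernel R ?S P" if "e \<in> tensor_kernel R ?S N" for m e
      unfolding a_def by (rule frag_map_kernel[OF S N(1) S P lin_maps_id \<gamma> that])
    define \<theta> where "\<theta> = (\<lambda>(q, m). a m (bc_rep R S f N q))"
    have ker: "frag_extend \<theta> e \<in> tensor_kernel R ?S P"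
      if "e \<in> tensor_kernel R (restrict_scalars f ?N) M" for e
    proof (rule frag_extend_kernel[OF rN assms(2) that K(1) K(4)])
      fix q q' m assume q: "q \<in> carrier (restrict_scalars f ?N)" "q' \<in> carrier (restrict_scalars f ?N)" "m \<in> carrier M"
      show "\<theta> (q \<oplus>\<^bsub>restrict_scalars f ?N\<^esub> q', m) - \<theta> (q, m) - \<theta> (q', m) \<in> tensor_kernel R ?S P"
        using a_kernel[OF bc_rep_add[OF assms(1) N(1), of q q'], of m] q by (simp add: \<theta>_def a_diff)
    next
      fix q m m' assume q: "q \<in> carrier (restrict_scalars f ?N)" "m \<in> carrier M" "m' \<in> carrier M"
      have "a (m \<oplus>\<^bsub>M\<^esub> m') e - a m e - a m' e \<in> tensor_kernel R ?S P"
        if "Poly_Mapping.keys e \<subseteq> carrier S \<times> carrier N" for e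
        using that
      proof (induction e rule: frag_induction)
        case (one p)
        then show ?case using q rels(2) \<gamma>_add \<gamma>D(1) by (auto simp: a_def)
      next
        case (diff x y)
        from K(4)[OF diff] show ?case by (simp add: a_diff algebra_simps)
      qed (use K(1) in \<open>simp add: a_def\<close>)
      then show "\<theta> (q, m \<oplus>\<^bsub>M\<^esub> m') - \<theta> (q, m) - \<theta> (q, m') \<in> tensor_kernel R ?S P"
        using bc_rep(1)[OF assms(1) N(1), of q] q(1) by (simp add: \<theta>_def)
    next
      fix r q m assume q: "r \<in> carrier R" "q \<in> carrier (restrict_scalars f ?N)" "m \<in> carrier M"
      have "a m (frag_map (\<lambda>s. f r \<otimes>\<^bsub>S\<^esub> s) (\<lambda>n. n) e) - a (r \<odot>\<^bsub>M\<^esub> m) e \<in> tensor_kernel R ?S P"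
        if "Poly_Mapping.keys e \<subseteq> carrier S \<times> carrier N" for e
        using that
      proof (induction e rule: frag_induction)
        case (one p)
        then show ?case using q rels(3) \<gamma>_smult \<gamma>D(1) by (auto simp: a_def)
      next
        case (diff x y)
        from K(4)[OF diff] show ?case by (simp add: a_diff frag_extend_diff algebra_simps)
      qed (use K(1) in \<open>simp add: a_def\<close>)
      from K(3)[OF a_kernel[OF bc_rep_smult[OF assms(1) N(1), of "f r" q], of m] this[OF bc_rep(1)[OF assms(1) N(1), of q]]]
      show "\<theta> (r \<odot>\<^bsub>restrict_scalars f ?N\<^esub> q, m) - \<theta> (q, r \<odot>\<^bsub>M\<^esub> m) \<in> tensor_kernel R ?S P"
        using q by (simp add: \<theta>_def a_diff)
    qed
    \<comment> \<open>An element of \<open>ker \<phi>\<close> only vanishes as a tensor over \<open>N'\<close>, so the argument needs that \<open>\<beta> m\<close> is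
      defined on all of \<open>N'\<close>.\<close>
    have d_ker: "frag_extend \<theta> d \<in> tensor_kernel R ?S P"
    proof (rule frag_extend_mem[OF d(1) K(1) K(4)])
      fix p assume "p \<in> lin_ker ?N ?N' ?\<phi> \<times> carrier M"
      then obtain q m where p: "p = (q, m)" "q \<in> carrier ?N" "?\<phi> q = \<zero>\<^bsub>?N'\<^esub>" "m \<in> carrier M"
        by (auto simp: lin_ker_def)
      let ?e = "bc_rep R S f N q"
      have "?\<phi> q = tensor_coset R ?S N' (frag_map (\<lambda>s. s) g ?e)"
        using bc_map_coset[OF assms(1) N(1) N'(1) g(1), of ?e] bc_rep(2)[OF assms(1) N(1) p(2)] by simp
      then have "tensor_coset R ?S N' (frag_map (\<lambda>s. s) g ?e) = tensor_coset R ?S N' 0"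
        using p(3) by (simp only: base_change_simps(2)[OF assms(1) N'(1)])
      then have "frag_map (\<lambda>s. s) g ?e \<in> tensor_kernel R ?S N'"
        by (simp add: base_change_eq_iff[OF assms(1) N'(1)])
      from frag_map_kernel[OF S N'(1) S P lin_maps_id \<beta> this]
      show "\<theta> p \<in> tensor_kernel R ?S P"
        by (simp add: p(1) \<theta>_def a_def frag_map_comp \<gamma>_def)
    qed
    have 1: "frag_extend \<theta> ?c \<in> tensor_kernel R ?S P"
      using K(3)[OF ker[OF d(2)] d_ker] by (simp add: frag_extend_diff)
    have "frag_extend \<theta> ?c - frag_of (\<one>\<^bsub>S\<^esub>, \<nu> c) \<in> tensor_kernel R ?S P"
      using c(1)
    proof (induction c rule: free_Abelian_group_induct[consumes 1, case_names zero diff one])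
      case zero
      have "\<nu> 0 = \<zero>\<^bsub>P\<^esub>" using tensor_kernel_closed(1)[OF N(1) assms(2)] by (subst \<nu>_ker) auto
      then show ?case
        using rels(2)[of "\<one>\<^bsub>S\<^esub>" "\<zero>\<^bsub>P\<^esub>" "\<zero>\<^bsub>P\<^esub>"] by simp
    next
      case (one p)
      then obtain n m where p: "p = (n, m)" "n \<in> carrier N" "m \<in> carrier M" by auto
      have "bc_rep R S f N (bc_unit R S f N n) - frag_of (\<one>\<^bsub>S\<^esub>, n) \<in> tensor_kernel R ?S N"
        unfolding pure_tensor_def using p by (intro bc_rep_coset[OF assms(1) N(1)]) auto
      from a_kernel[OF this, of m] show ?case
        using p by (simp add: \<theta>_def a_diff \<nu>_of) (simp add: a_def \<gamma>_def)
    next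
      case (diff x y)
      have "(\<nu> x \<ominus>\<^bsub>P\<^esub> \<nu> y) \<oplus>\<^bsub>P\<^esub> \<nu> y = \<nu> x"
        using \<nu>_closed[OF diff(1)] \<nu>_closed[OF diff(2)] by (simp add: a_minus_def P.M.a_assoc P.M.l_neg)
      with rels(2)[of "\<one>\<^bsub>S\<^esub>" "\<nu> x \<ominus>\<^bsub>P\<^esub> \<nu> y" "\<nu> y"]
      have "frag_of (\<one>\<^bsub>S\<^esub>, \<nu> x) - frag_of (\<one>\<^bsub>S\<^esub>, \<nu> x \<ominus>\<^bsub>P\<^esub> \<nu> y) - frag_of (\<one>\<^bsub>S\<^esub>, \<nu> y) \<in> tensor_kernel R ?S P"
        using \<nu>_closed[OF diff(1)] \<nu>_closed[OF diff(2)] by simp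
      from K(3)[OF K(4)[OF diff(3,4)] this] show ?case
        by (simp add: frag_extend_diff \<nu>_diff[OF diff(1,2)] algebra_simps)
    qed
    from K(4)[OF 1 this] have "frag_of (\<one>\<^bsub>S\<^esub>, \<nu> c) \<in> tensor_kernel R ?S P" by simp
    then have "\<nu> c = \<zero>\<^bsub>P\<^esub>"
      using pure_imp_unit_faithful[OF assms(1,3) P] \<nu>_closed[OF c(1)] unfolding unit_faithful_def by blast
    then show "c \<in> tensor_kernel R N M"
      using \<nu>_ker[OF c(1)] by simp
  qed
qed

section \<open>Descent of intersection flatness and of the Ohm-Rush property\<close>

text \<open>
  The contraction principle is applied to the natural map from \<open>L\<close> to \<open>S \<otimes> L\<close> and the intersection \<open>V\<close> of the \<open>S\<close>-spans
  of the given submodules, whose preimage in \<open>L\<close> is the intersection of the submodules by purity.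
\<close>

lemma pure_descends_intersection_flat:
  fixes R :: "('r, 'x) ring_scheme" and S :: "('s, 'y) ring_scheme"
    and M :: "('r, 'm, 'z) module_scheme"
  assumes "ring_hom_cring R S f" "module R M" "pure_ring_hom TYPE('r test_carrier) R S f"
    and "intersection_flat TYPE('s test_carrier) S (base_change R S f M)"
  shows "intersection_flat TYPE('l) R M"
  unfolding intersection_flat_def
proof (intro allI impI, elim conjE)
  fix L :: "('r, 'l) module" and \<U>
  assume L: "module R L" "fin_gen_module R L" and "\<forall>U\<in>\<U>. submodule U R L"
  then have \<U>: "submodule U R L" if "U \<in> \<U>" for U using that by blast
  let ?L = "base_change R S f L" and ?M = "base_change R S f M" and ?h = "bc_unit R S f L"
  note bL = base_change_module[OF assms(1) L(1)] and bM = base_change_module[OF assms(1,2)]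
  note h = bc_unit_lin[OF assms(1) L(1)]
  have hD: "?h l \<in> carrier ?L" if "l \<in> carrier L" for l
    using lin_mapsD(1)[OF h that] by simp
  have UL: "U \<subseteq> carrier L" if "U \<in> \<U>" for U
    using \<U>[OF that, unfolded submodule_iff[OF L(1)]] by blast
  define V where "V U = mod_span S ?L (?h ` U)" for U
  have V: "submodule (V U) S ?L" "?h ` U \<subseteq> V U" if "U \<in> \<U>" for U
    unfolding V_def using UL[OF that] hD by (auto intro!: mod_span[OF bL])
  let ?V = "carrier ?L \<inter> \<Inter>(V ` \<U>)"
  have subV: "submodule ?V S ?L"
    by (rule Inter_submodule[OF bL]) (use V in auto)
  have contraction: "{l \<in> carrier L. ?h l \<in> ?V} \<subseteq> carrier L \<inter> \<Inter>\<U>"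
  proof (rule subsetI)
    fix l assume "l \<in> {l \<in> carrier L. ?h l \<in> ?V}"
    then have l: "l \<in> carrier L" "?h l \<in> ?V" by blast+
    have "l \<in> U" if U: "U \<in> \<U>" for U
    proof -
      obtain P :: "('r, 'l set) module" and \<pi> where P: "module R P" "carrier P = \<pi> ` carrier L"
        "\<pi> \<in> lin_maps R L P" "lin_ker L P \<pi> = U"
        by (rule quotient_exists[OF L(1) \<U>[OF U]])
      show ?thesis
        by (rule unit_faithful_contraction[OF assms(1) L(1) P(1)
              pure_imp_unit_faithful[OF assms(1,3) P(1)] P(3,4) bL
              bc_map_lin[OF assms(1) L(1) P(1,3)], of ?h])
          (use l U hD in \<open>auto simp: bc_map_unit[OF assms(1) L(1) P(1,3)] V_def\<close>)
    qed
    then show "l \<in> carrier L \<inter> \<Inter>\<U>" using l(1) by blast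
  qed
  have "c \<in> times_chains R L (carrier L \<inter> \<Inter>\<U>) M"
    if c: "Poly_Mapping.keys c \<subseteq> carrier L \<times> carrier M" "\<forall>U\<in>\<U>. c \<in> times_chains R L U M" for c
  proof -
    have "frag_map ?h (bc_unit R S f M) c \<in> times_chains S ?L W ?M" if W: "W \<in> V ` \<U>" for W
    proof -
      from W obtain U where U: "U \<in> \<U>" "W = V U" by blast
      show ?thesis
        unfolding U(2)
        by (rule base_change_times_chains[OF assms(1,2) L(1) bL h c(2)[rule_format, OF U(1)] V(2)[OF U(1)]])
    qed
    moreover have "Poly_Mapping.keys (frag_map ?h (bc_unit R S f M) c) \<subseteq> carrier ?L \<times> carrier ?M"
      using hD lin_mapsD(1)[OF bc_unit_lin[OF assms(1,2)]]
      by (intro frag_map_keys_image[OF c(1)]) auto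
    ultimately have "frag_map ?h (bc_unit R S f M) c \<in> times_chains S ?L ?V ?M"
      using V(1) by (intro intersection_flat_chains[OF bM assms(4) bL
          base_change_fin_gen[OF assms(1) L]]) auto
    from flat_contraction[OF assms(1,2) L(1) bL pure_intersection_flat_imp_fg_flat[OF assms] h subV c(1) this]
    show ?thesis using times_chains_mono[OF contraction] by blast
  qed
  then show "submodule_times R L (carrier L \<inter> \<Inter>\<U>) M =
      carrier (tensor R L M) \<inter> (\<Inter>U\<in>\<U>. submodule_times R L U M)"
    using intersection_equality_iff[OF L(1) assms(2), of \<U>] \<U> by simp
qed

lemma ideal_iff_submodule:
  assumes "cring S"
  shows "ideal I S \<longleftrightarrow> submodule I S (alg_module S (\<lambda>s. s))"
proof -
  interpret S: cring S by fact
  note A = alg_module_self[OF assms]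
  show ?thesis
  proof
    assume "ideal I S"
    then interpret I: ideal I S .
    show "submodule I S (alg_module S (\<lambda>s. s))"
      unfolding submodule_iff[OF A] using I.a_subset I.I_l_closed by auto
  next
    assume sub: "submodule I S (alg_module S (\<lambda>s. s))"
    note I = sub[unfolded submodule_iff[OF A], simplified]
    have neg: "\<ominus>\<^bsub>S\<^esub> x \<in> I" if "x \<in> I" for x
      using module.submoduleE(3)[OF A sub that] by (simp add: a_inv_def m_inv_def alg_module_def)
    show "ideal I S"
    proof (rule idealI[OF S.ring_axioms])
      show "subgroup I (add_monoid S)"
        using I neg by (intro subgroup.intro) (auto simp: a_inv_def)
      show left: "x \<otimes>\<^bsub>S\<^esub> a \<in> I" if "a \<in> I" "x \<in> carrier S" for a x
        using I that by blast
      show "a \<otimes>\<^bsub>S\<^esub> x \<in> I" if "a \<in> I" "x \<in> carrier S" for a x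
      proof -
        have "a \<in> carrier S" using I that(1) by blast
        from left[OF that] show ?thesis unfolding S.m_comm[OF that(2) \<open>a \<in> carrier S\<close>] .
      qed
    qed
  qed
qed

lemma ideal_times_chains:
  assumes "module R M" "ideal I R" "x \<in> carrier M"
  shows "x \<in> ideal_times I M \<longleftrightarrow> frag_of (\<one>\<^bsub>R\<^esub>, x) \<in> times_chains R (alg_module R (\<lambda>r. r)) I M"
proof -
  have R: "cring R" using assms(1) by (simp add: module_def)
  show ?thesis
    unfolding ideal_times_eq[OF assms] pure_tensor_def
    by (rule submodule_times_chains[OF alg_module_self[OF R] assms(1)])
      (use assms(2) in \<open>simp add: ideal_iff_submodule[OF R]\<close>)
qed

text \<open>
  The ring itself is one of the ideals being intersected, so the intersection is not over the empty family.
\<close>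

lemma content_ideal:
  assumes "module R M" "x \<in> carrier M"
  shows "ideal (content R M x) R"
proof -
  interpret M: module R M by fact
  have "\<one>\<^bsub>R\<^esub> \<odot>\<^bsub>M\<^esub> x \<in> ideal_times (carrier R) M"
    unfolding ideal_times_def using assms(2) by (blast intro: generate.incl)
  then show ?thesis
    unfolding content_def using assms(2) M.R.oneideal by (intro M.R.i_Intersect) auto
qed

text \<open>
  Contraction for ideals: \<open>f r \<in> I S\<close> forces \<open>r \<in> I\<close>. The test module is \<open>R / I\<close>, and the map
  \<open>\<chi>\<close> from \<open>S\<close> to \<open>S \<otimes> R / I\<close> sends \<open>s\<close> to the tensor of \<open>s\<close> with the class of \<open>1\<close>.
\<close>

lemma cyclically_pure_contraction:
  fixes R :: "('r, 'x) ring_scheme" and S :: "('s, 'y) ring_scheme"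
  assumes "ring_hom_cring R S f" "cyclically_pure_ring_hom TYPE('r test_carrier) R S f"
    and "ideal I R" "r \<in> carrier R" "f r \<in> mod_span S (alg_module S (\<lambda>s. s)) (f ` I)"
  shows "r \<in> I"
proof -
  interpret f: ring_hom_cring R S f by fact
  let ?A = "alg_module R (\<lambda>r. r)" and ?Q = "alg_module S (\<lambda>s. s)"
  note A = alg_module_self[OF f.R.is_cring] and Q = alg_module_self[OF f.S.is_cring]
  obtain X :: "('r, 'r set) module" and \<pi> where X: "module R X" "carrier X = \<pi> ` carrier ?A"
    "\<pi> \<in> lin_maps R ?A X" "lin_ker ?A X \<pi> = I"
    using quotient_exists[OF A] assms(3) unfolding ideal_iff_submodule[OF f.R.is_cring] by metis
  \<comment> \<open>Encoding of cosets in the test type: an element of \<open>R\<close> becomes a constant sequence.\<close>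
  define e :: "'r set \<Rightarrow> 'r test_carrier" where "e X = (\<lambda>x _. x) ` X" for X
  have "inj_on e (carrier X)"
    unfolding e_def by (intro inj_on_image inj_onI) (auto dest: fun_cong)
  then obtain P :: "('r, 'r test_carrier) module" where P: "module R P" "carrier P = e ` carrier X"
    "e \<in> lin_maps R X P" "inv_into (carrier X) e \<in> lin_maps R P X"
    using transport_module[OF X(1)] by metis
  define \<rho> where "\<rho> r = e (\<pi> r)" for r
  have \<rho>: "\<rho> \<in> lin_maps R ?A P"
    unfolding \<rho>_def by (rule lin_maps_comp[OF X(3) P(3)])
  have zero: "e (\<pi> r) = \<zero>\<^bsub>P\<^esub> \<longleftrightarrow> \<pi> r = \<zero>\<^bsub>X\<^esub>" if "r \<in> carrier R" for r
  proof -
    interpret X: module R X by (rule X(1))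
    have "\<pi> r \<in> carrier X" using lin_mapsD(1)[OF X(3)] that by simp
    from inj_on_eq_iff[OF \<open>inj_on e (carrier X)\<close> this X.M.zero_closed] show ?thesis
      by (simp only: lin_maps_zero[OF X(1) P(1,3)])
  qed
  have ker: "lin_ker ?A P \<rho> = I"
    unfolding X(4)[symmetric] lin_ker_def \<rho>_def using zero by auto
  interpret P: module R P by (rule P)
  have \<rho>_eq: "\<rho> r = r \<odot>\<^bsub>P\<^esub> \<rho> \<one>\<^bsub>R\<^esub>" if "r \<in> carrier R" for r
    using lin_mapsD(3)[OF \<rho>, of r "\<one>\<^bsub>R\<^esub>"] that by simp
  have one: "\<rho> \<one>\<^bsub>R\<^esub> \<in> carrier P" using lin_mapsD(1)[OF \<rho>] by simp
  have "carrier P = \<rho> ` carrier R"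
    unfolding P(2) X(2) by (simp add: image_image \<rho>_def)
  also have "\<dots> = (\<lambda>r. r \<odot>\<^bsub>P\<^esub> \<rho> \<one>\<^bsub>R\<^esub>) ` carrier R"
    by (rule image_cong[OF refl \<rho>_eq])
  finally have "cyclic_module R P"
    unfolding cyclic_module_def using one by blast
  then have faith: "unit_faithful R S f P"
    using assms(2) P(1) unfolding cyclically_pure_ring_hom_def cyclically_pure_map_def
    by (intro unit_faithfulI assms(1)) auto
  let ?S = "alg_module S f" and ?B = "base_change R S f P"
  note simps = base_change_simps[OF assms(1) P(1)] and eq = base_change_eq_iff[OF assms(1) P(1)]
  note K = tensor_kernel_closed[OF alg_module_module[OF assms(1)] P(1)]
    and rels = tensor_kernel_rels[OF alg_module_module[OF assms(1)] P(1), simplified]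
  define \<chi> where "\<chi> s = pure_tensor R ?S P s (\<rho> \<one>\<^bsub>R\<^esub>)" for s
  have \<chi>: "\<chi> \<in> lin_maps S ?Q ?B"
    unfolding lin_maps_def
  proof (intro CollectI conjI ballI)
    fix s t assume "s \<in> carrier ?Q" "t \<in> carrier ?Q"
    then show "\<chi> (s \<oplus>\<^bsub>?Q\<^esub> t) = \<chi> s \<oplus>\<^bsub>?B\<^esub> \<chi> t"
      using rels(1)[of s t "\<rho> \<one>\<^bsub>R\<^esub>"] one by (simp add: \<chi>_def pure_tensor_def simps eq algebra_simps)
  qed (use one in \<open>auto simp: \<chi>_def pure_tensor_def simps\<close>)
  have "\<chi> (f r) = bc_unit R S f P (\<rho> r)" if "r \<in> carrier R" for r
    using rels(3)[of r "\<one>\<^bsub>S\<^esub>" "\<rho> \<one>\<^bsub>R\<^esub>"] that one \<rho>_eq[OF that]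
    by (simp add: \<chi>_def pure_tensor_def eq)
  then show ?thesis
    using unit_faithful_contraction[OF assms(1) A P(1) faith \<rho> ker Q \<chi>, of f r] assms(4,5) by auto
qed

text \<open>
  Let \<open>J\<close> be the content of \<open>1 \<otimes> x\<close>. If \<open>x \<in> I M\<close>, then \<open>1 \<otimes> x \<in> (I S) M\<^sub>S\<close>, so \<open>J \<subseteq> I S\<close> and the
  preimage of \<open>J\<close> in \<open>R\<close> lies in \<open>I\<close> by cyclic purity. Hence it lies in the content of \<open>x\<close>, and by the
  contraction principle \<open>x\<close> lies in the product of this preimage with \<open>M\<close>.
\<close>

lemma cyclically_pure_descends_ohm_rush:
  fixes R :: "('r, 'x) ring_scheme" and S :: "('s, 'y) ring_scheme"
    and M :: "('r, 'm, 'z) module_scheme"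
  assumes "ring_hom_cring R S f" "module R M" "cyclically_pure_ring_hom TYPE('r test_carrier) R S f"
    and "flat_module TYPE('r test_carrier) R M" "ohm_rush S (base_change R S f M)"
  shows "ohm_rush R M"
  unfolding ohm_rush_def
proof
  fix x assume x: "x \<in> carrier M"
  interpret f: ring_hom_cring R S f by fact
  let ?A = "alg_module R (\<lambda>r. r)" and ?Q = "alg_module S (\<lambda>s. s)" and ?M = "base_change R S f M"
  note A = alg_module_self[OF f.R.is_cring] and Q = alg_module_self[OF f.S.is_cring]
  note bM = base_change_module[OF assms(1,2)]
  let ?x = "bc_unit R S f M x"
  have sx: "?x \<in> carrier ?M"
    using lin_mapsD(1)[OF bc_unit_lin[OF assms(1,2)] x] by simp
  have h: "f \<in> lin_maps R ?A (restrict_scalars f ?Q)"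
    by (auto simp: lin_maps_def)
  let ?J = "content S ?M ?x"
  note J = content_ideal[OF bM sx]
  have "frag_map f (bc_unit R S f M) (frag_of (\<one>\<^bsub>R\<^esub>, x)) \<in> times_chains S ?Q ?J ?M"
    using assms(5) sx ideal_times_chains[OF bM J sx] by (simp add: ohm_rush_def)
  from flat_contraction[OF assms(1,2) A Q flat_module_imp_fg_flat[OF assms(2,4)] h _ _ this]
  have "frag_of (\<one>\<^bsub>R\<^esub>, x) \<in> times_chains R ?A {r \<in> carrier R. f r \<in> ?J} M"
    using J x by (simp add: ideal_iff_submodule[OF f.S.is_cring])
  moreover have "{r \<in> carrier R. f r \<in> ?J} \<subseteq> content R M x"
  proof (rule subsetI)
    fix r assume "r \<in> {r \<in> carrier R. f r \<in> ?J}"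
    then have r: "r \<in> carrier R" "f r \<in> ?J" by blast+
    have "r \<in> I" if I: "ideal I R" "x \<in> ideal_times I M" for I
    proof -
      interpret I: ideal I R by (rule I)
      let ?K = "mod_span S ?Q (f ` I)"
      have fI: "f ` I \<subseteq> carrier ?Q" using I.a_subset by auto
      have K: "ideal ?K S"
        unfolding ideal_iff_submodule[OF f.S.is_cring] by (rule mod_span(1)[OF Q fI])
      have "frag_of (\<one>\<^bsub>R\<^esub>, x) \<in> times_chains R ?A I M"
        using I x by (simp add: ideal_times_chains[OF assms(2)])
      from base_change_times_chains[OF assms(1,2) A Q h this mod_span(2)[OF Q fI]]
      have "?x \<in> ideal_times ?K ?M"
        by (simp add: ideal_times_chains[OF bM K sx])
      then have "?J \<subseteq> ?K"
        using K unfolding content_def by blast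
      with r show "r \<in> I"
        using cyclically_pure_contraction[OF assms(1,3) I(1) r(1)] by blast
    qed
    then show "r \<in> content R M x" unfolding content_def by blast
  qed
  ultimately have "frag_of (\<one>\<^bsub>R\<^esub>, x) \<in> times_chains R ?A (content R M x) M"
    using times_chains_mono by blast
  then show "x \<in> ideal_times (content R M x) M"
    using ideal_times_chains[OF assms(2) content_ideal[OF assms(2) x] x] by simp
qed

theorem mainTheorem5:
  fixes R :: "('r, 'x) ring_scheme" and S :: "('s, 'y) ring_scheme" and f :: "'r \<Rightarrow> 's"
    and M :: "('r, 'm, 'z) module_scheme"
  assumes "ring_hom_cring R S f" and "module R M"
  shows "(pure_ring_hom TYPE('r test_carrier) R S f \<and>
          intersection_flat TYPE('s test_carrier) S (base_change R S f M) \<longrightarrow>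
          intersection_flat TYPE('l) R M) \<and>
         (cyclically_pure_ring_hom TYPE('r test_carrier) R S f \<and>
          flat_module TYPE('r test_carrier) R M \<and>
          ohm_rush S (base_change R S f M) \<longrightarrow>
          ohm_rush R M)"
  using pure_descends_intersection_flat[OF assms] cyclically_pure_descends_ohm_rush[OF assms]
  by blast

end
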